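(* Let $L$ be an even lattice of signature $(b_+,b_-)$, let $v\in\operatorname{Gr}(L_{\mathbb{R}})$, let $\Gamma$ be a finite index subgroup of $\operatorname{Mp}_2(\mathbb{Z})$, and let $k,l\in\frac12\mathbb{Z}$. Let $F$ be a modular form of weight $\big(k-\frac{b_+}{2},l-\frac{b_-}{2}\big)$ and representation $\rho_L^*$ with respect to $\Gamma$, and let $\Phi_{L,v}^F(\tau,\zeta)=\langle\Theta_L(\tau,\zeta;v),F(\tau)\rangle_L$ be the corresponding Jacobi form of weight $(k,l)$ and index $(L,v)$ with respect to $\Gamma$. Then $F$ is weakly holomorphic if and only if $\Phi_{L,v}^F$ is pseudo-holomorphic, i.e., if and only if $(4\pi i\partial_{\overline{\tau}}-\Delta_{v_-}^h)\Phi_{L,v}^F=0$. In particular, non-zero pseudo-holomorphic Jacobi forms of index $(L,v)$ exist only in weights of the form $\big(k,\frac{b_-}{2}\big)$.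
   Context: Lattices. An even lattice is a free $\mathbb{Z}$-module $L$ of finite rank with a non-degenerate symmetric bilinear form $(\cdot,\cdot):L\times L\to\mathbb{Z}$ such that $\lambda^2:=(\lambda,\lambda)$ is even for every $\lambda\in L$. Put $L_{\mathbb{R}}=L\otimes\mathbb{R}$, $L_{\mathbb{C}}=L\otimes\mathbb{C}$; the pairing and $\lambda\mapsto\lambda^2$ are extended bilinearly (no complex conjugation). The signature of $L$ is that of $L_{\mathbb{R}}$. The dual lattice is $L^*=\{\lambda\in L_{\mathbb{R}}:(\lambda,L)\subseteq\mathbb{Z}\}\supseteq L$, and $D_L=L^*/L$ is a finite group. $\mathbb{C}[D_L]$ has basis $\{\mathfrak{e}_\gamma\}_{\gamma\in D_L}$. Write $\mathbf{e}(w)=e^{2\pi iw}$ and $\mathcal{H}=\{\tau=x+iy\in\mathbb{C}:y>0\}$. $\operatorname{Gr}(L_{\mathbb{R}})$ is the set of orthogonal decompositions $v$: $L_{\mathbb{R}}=v_+\oplus v_-$ with $v_+$ positive definite and $v_-$ negative definite; $\lambda_{v_\pm}$ is the orthogonal projection of $\lambda$ onto $v_\pm$, extended complex linearly to $\zeta\mapsto\zeta_{v_\pm}$ on $L_{\mathbb{C}}$. The Jacobi--Siegel theta function: for $\tau\in\mathcal{H}$, $\zeta\in L_{\mathbb{C}}$, $$\Theta_L(\tau,\zeta;v)=\sum_{\gamma\in D_L}\Big[\sum_{\lambda\in L+\gamma}\mathbf{e}\Big(\tau\tfrac{\lambda_{v_+}^2}{2}+\overline{\tau}\tfrac{\lambda_{v_-}^2}{2}+(\lambda,\zeta)\Big)\Big]\mathfrak{e}_\gamma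 .$$ Metaplectic group. For $A=\begin{pmatrix}a&b\\c&d\end{pmatrix}\in\operatorname{SL}_2(\mathbb{R})$ put $A\tau=\frac{a\tau+b}{c\tau+d}$, $j(A,\tau)=c\tau+d$, $j_A'=c$. $\operatorname{Mp}_2(\mathbb{R})$ is the group of pairs $(A,\phi)$ with $A\in\operatorname{SL}_2(\mathbb{R})$, $\phi:\mathcal{H}\to\mathbb{C}$ holomorphic, $\phi^2(\tau)=j(A,\tau)$, with product $(A,\phi)(B,\psi)=(AB,(\phi\circ B)\psi)$; $\operatorname{Mp}_2(\mathbb{Z})$ is the inverse image of $\operatorname{SL}_2(\mathbb{Z})$. It is generated by $T=\big(\begin{pmatrix}1&1\\0&1\end{pmatrix},1\big)$ and $S=\big(\begin{pmatrix}0&-1\\1&0\end{pmatrix},\sqrt{\tau}\big)$ with $\sqrt\tau\in\mathcal{H}$. The Weil representation $\rho_L$ of $\operatorname{Mp}_2(\mathbb{Z})$ on $\mathbb{C}[D_L]$ is given by $$\rho_L(T)\mathfrak{e}_\gamma=\mathbf{e}(\tfrac{\gamma^2}{2})\mathfrak{e}_\gamma,\qquad \rho_L(S)\mathfrak{e}_\gamma=\frac{\mathbf{e}\big(\frac{b_--b_+}{8}\big)}{\sqrt{|D_L|}}\sum_{\delta\in D_L}\mathbf{e}(-(\gamma,\delta))\mathfrak{e}_\delta .$$ $L(-1)$ is $L$ with the forms negated; $\mathbb{C}[D_{L(-1)}]$ has basis $\{\mathfrak{e}_\gamma^*\}_{\gamma\in D_L}$, regarded as dual to $\{\mathfrak{e}_\gamma\}$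 via the bilinear pairing $\langle\cdot,\cdot\rangle_L:\mathbb{C}[D_L]\times\mathbb{C}[D_{L(-1)}]\to\mathbb{C}$, $\langle\mathfrak{e}_\gamma,\mathfrak{e}_\delta^*\rangle_L=\delta_{\gamma,\delta}$. $\rho_L^*=\rho_{L(-1)}$ is the dual representation: $\langle\rho_L(A,\phi)U,\rho_L^*(A,\phi)V\rangle_L=\langle U,V\rangle_L$. Growth. A function $f$ on $\mathcal{H}$ has at most linear exponential growth at the cusps if for every $A\in\operatorname{SL}_2(\mathbb{Z})$ there is a constant $C$ with $f(A\tau)=O(e^{Cy})$ as $y\to\infty$, uniformly for $x$ in bounded sets. Modular forms. For $p,q\in\frac12\mathbb{Z}$, a modular form of weight $(p,q)$ and representation $\rho_L^*$ with respect to $\Gamma$ is a smooth $F:\mathcal{H}\to\mathbb{C}[D_{L(-1)}]$ with $F(A\tau)=\phi(\tau)^{2p}\overline{\phi(\tau)}^{2q}\rho_L^*(A,\phi)F(\tau)$ for all $\tau\in\mathcal{H}$, $(A,\phi)\in\Gamma$, and at most linear exponential growth at the cusps. It is weakly holomorphic if it is moreover holomorphic on $\mathcal{H}$. Jacobi forms. A Jacobi form of weight $(k,l)$ and index $(L,v)$ with respect to $\Gamma$ is a smooth $\Phi:\mathcal{H}\times L_{\mathbb{C}}\to\mathbb{C}$ such that: (1) for all $\tau,\zeta$ and $\sigma,\nu\in L$, $\Phi(\tau,\zeta+\tau\sigma_{v_+}+\overline\tau\sigma_{v_-}+\nu)=\mathbf{e}\big(-\tau\frac{\sigma_{v_+}^2}{2}-\overline\tau\frac{\sigma_{v_-}^2}{2}-(\sigma,\zeta)\big)\Phi(\tau,\zeta)$;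 (2) for all $\tau,\zeta$ and $(A,\phi)\in\Gamma$, $$\Phi\Big(A\tau,\tfrac{\zeta_{v_+}}{j(A,\tau)}+\tfrac{\zeta_{v_-}}{\overline{j(A,\tau)}}\Big)=\phi(\tau)^{2k}\overline{\phi(\tau)}^{2l}\,\mathbf{e}\Big(\tfrac{j_A'\zeta_{v_+}^2}{2j(A,\tau)}+\tfrac{j_A'\zeta_{v_-}^2}{2\overline{j(A,\tau)}}\Big)\Phi(\tau,\zeta);$$ (3) $\zeta\mapsto\Phi(\tau,\zeta)$ is holomorphic for each $\tau$; (4) the functions $f_\lambda$ ($\lambda\in L^*$) in the Fourier expansion $\Phi(\tau,\zeta)=\sum_{\lambda\in L^*}f_\lambda(\tau)\mathbf{e}\big(\tau\frac{\lambda_{v_+}^2}{2}+\overline\tau\frac{\lambda_{v_-}^2}{2}+(\lambda,\zeta)\big)$ have at most linear exponential growth at the cusps. The map $F\mapsto\Phi_{L,v}^F$ is an isomorphism from modular forms of weight $\big(k-\frac{b_+}{2},l-\frac{b_-}{2}\big)$ and representation $\rho_L^*$ with respect to $\Gamma$ onto Jacobi forms of weight $(k,l)$ and index $(L,v)$ with respect to $\Gamma$. Differential operators. $\partial_{\overline\tau}=\partial/\partial\overline\tau$. $\Delta_{v_-}^h$ is the holomorphic Laplacian of $v_-$ acting on the variable $\zeta$: if $e_1,\dots,e_{b_-}$ is an orthogonal basis of $v_-$ with $(e_l,e_l)=-1$ and $\zeta_l$ is the complex coordinate of $\zeta_{v_-}$ along $e_l$, then $\Delta_{v_-}^h=-\sum_{l=1}^{b_-}\partial_{\zeta_l}^2$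 (holomorphic derivatives). A Jacobi form is pseudo-holomorphic if it is annihilated by $4\pi i\partial_{\overline\tau}-\Delta_{v_-}^h$. *)

theory Defs
  imports "HOL-Complex_Analysis.Complex_Analysis" "HOL-Algebra.Coset"
begin

unbundle no fps_syntax

section \<open>Generalities\<close>

abbreviation upper_half :: "complex set" where
  "upper_half \<equiv> {\<tau>. Im \<tau> > 0}"

definition e2pi :: "complex \<Rightarrow> complex" where
  "e2pi w = exp (2 * of_real pi * \<i> * w)"

primrec Ck_on :: "nat \<Rightarrow> 'a::real_normed_vector set \<Rightarrow> ('a \<Rightarrow> 'b::real_normed_vector) \<Rightarrow> bool" where
  "Ck_on 0 S f \<longleftrightarrow> continuous_on S f"
| "Ck_on (Suc n) S f \<longleftrightarrow>
     (\<forall>x\<in>S. f differentiable (at x)) \<and> (\<forall>h. Ck_on n S (\<lambda>x. frechet_derivative f (at x) h))"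

text \<open>Used only for open subsets of finite-dimensional spaces, where this is the usual
  notion of a function of class \<open>C\<^sup>\<infinity>\<close>.\<close>

definition smooth_on :: "'a::real_normed_vector set \<Rightarrow> ('a \<Rightarrow> 'b::real_normed_vector) \<Rightarrow> bool" where
  "smooth_on S f \<longleftrightarrow> (\<forall>n. Ck_on n S f)"

section \<open>Even lattices\<close>

text \<open>A lattice \<open>L\<close> is given inside the real vector space \<open>L\<^sub>\<real>\<close>, which is the whole type \<open>'v\<close>:
  \<open>L\<close> is the set of integral combinations of some finite basis of \<open>'v\<close>, and \<open>B\<close> is the real
  bilinear extension of the lattice form. The class \<open>real_inner\<close> only supplies a topology
  on \<open>L\<^sub>\<real>\<close> (in finite dimension all choices agree); its inner product has nothing to do
  with \<open>B\<close>. In contrast to \<open>euclidean_space\<close> it admits the lattice of rank 0.\<close>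

definition int_span :: "'v::real_vector set \<Rightarrow> 'v set" where
  "int_span E = {(\<Sum>e\<in>E. of_int (c e) *\<^sub>R e) | c :: 'v \<Rightarrow> int. True}"

definition even_lattice :: "'v::real_inner set \<Rightarrow> ('v \<Rightarrow> 'v \<Rightarrow> real) \<Rightarrow> bool" where
  "even_lattice L B \<longleftrightarrow>
     (\<exists>E. finite E \<and> independent E \<and> span E = UNIV \<and> L = int_span E) \<and>
     bilinear B \<and> (\<forall>x y. B x y = B y x) \<and>
     (\<forall>x\<in>L. \<forall>y\<in>L. B x y \<in> \<int>) \<and>
     (\<forall>x\<in>L. (\<forall>y\<in>L. B x y = 0) \<longrightarrow> x = 0) \<and>
     (\<forall>x\<in>L. \<exists>m::int. B x x = 2 * of_int m)"

text \<open>The form of \<open>L(-1)\<close>.\<close>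

definition neg_form :: "('v \<Rightarrow> 'v \<Rightarrow> real) \<Rightarrow> 'v \<Rightarrow> 'v \<Rightarrow> real" where
  "neg_form B x y = - B x y"

definition pos_def_on :: "('v::real_vector \<Rightarrow> 'v \<Rightarrow> real) \<Rightarrow> 'v set \<Rightarrow> bool" where
  "pos_def_on B W \<longleftrightarrow> (\<forall>x\<in>W. x \<noteq> 0 \<longrightarrow> B x x > 0)"

definition pos_index :: "('v::real_vector \<Rightarrow> 'v \<Rightarrow> real) \<Rightarrow> nat" where
  "pos_index B = Max {dim W | W. subspace W \<and> pos_def_on B W}"

definition signature :: "('v::real_vector \<Rightarrow> 'v \<Rightarrow> real) \<Rightarrow> nat \<times> nat" where
  "signature B = (pos_index B, pos_index (neg_form B))"

definition dual_lattice :: "'v set \<Rightarrow> ('v \<Rightarrow> 'v \<Rightarrow> real) \<Rightarrow> 'v set" where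
  "dual_lattice L B = {x. \<forall>y\<in>L. B x y \<in> \<int>}"

text \<open>The elements of \<open>D\<^sub>L = L\<^sup>*/L\<close> are the cosets \<open>L + x\<close> themselves.\<close>

definition disc_group :: "'v::real_vector set \<Rightarrow> ('v \<Rightarrow> 'v \<Rightarrow> real) \<Rightarrow> 'v set set" where
  "disc_group L B = (\<lambda>x. (\<lambda>y. y + x) ` L) ` dual_lattice L B"

definition coset_rep :: "'v set \<Rightarrow> 'v" where
  "coset_rep \<gamma> = (SOME x. x \<in> \<gamma>)"

text \<open>\<open>\<complex>[D\<^sub>L]\<close>: functions on cosets vanishing off \<open>D\<^sub>L\<close>. Since \<open>D\<close> is the same set for \<open>L\<close> and
  \<open>L(-1)\<close>, this space also serves as \<open>\<complex>[D\<^bsub>L(-1)\<^esub>]\<close>, with \<open>unit_vec\<close> as the dual basis.\<close>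

definition group_space :: "'v::real_vector set \<Rightarrow> ('v \<Rightarrow> 'v \<Rightarrow> real) \<Rightarrow> ('v set \<Rightarrow> complex) set" where
  "group_space L B = {U. \<forall>\<gamma>. \<gamma> \<notin> disc_group L B \<longrightarrow> U \<gamma> = 0}"

definition unit_vec :: "'v set \<Rightarrow> 'v set \<Rightarrow> complex" where
  "unit_vec \<gamma> = (\<lambda>\<delta>. if \<delta> = \<gamma> then 1 else 0)"

definition pairing ::
  "'v::real_vector set \<Rightarrow> ('v \<Rightarrow> 'v \<Rightarrow> real) \<Rightarrow> ('v set \<Rightarrow> complex) \<Rightarrow> ('v set \<Rightarrow> complex) \<Rightarrow> complex" where
  "pairing L B U V = (\<Sum>\<gamma>\<in>disc_group L B. U \<gamma> * V \<gamma>)"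

section \<open>The Grassmannian and the complexification\<close>

text \<open>A point \<open>v\<close> is the pair \<open>(v\<^sub>+, v\<^sub>-)\<close>.\<close>

definition Grass :: "('v::real_vector \<Rightarrow> 'v \<Rightarrow> real) \<Rightarrow> ('v set \<times> 'v set) set" where
  "Grass B = {(P, N). subspace P \<and> subspace N \<and>
     P \<inter> N = {0} \<and> (\<forall>x. \<exists>p\<in>P. \<exists>n\<in>N. x = p + n) \<and>
     (\<forall>p\<in>P. \<forall>n\<in>N. B p n = 0) \<and> pos_def_on B P \<and> pos_def_on (neg_form B) N}"

definition proj_pos :: "'v set \<times> 'v set \<Rightarrow> 'v::real_vector \<Rightarrow> 'v" where
  "proj_pos v x = (THE y. y \<in> fst v \<and> x - y \<in> snd v)"

definition proj_neg :: "'v set \<times> 'v set \<Rightarrow> 'v::real_vector \<Rightarrow> 'v" where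
  "proj_neg v x = (THE y. y \<in> snd v \<and> x - y \<in> fst v)"

text \<open>\<open>L\<^sub>\<complex>\<close> is \<open>'v \<times> 'v\<close>, where \<open>(x, y)\<close> stands for \<open>x + \<i> y\<close>.\<close>

definition cx :: "'v::real_vector \<Rightarrow> 'v \<times> 'v" where
  "cx x = (x, 0)"

definition cscale :: "complex \<Rightarrow> 'v::real_vector \<times> 'v \<Rightarrow> 'v \<times> 'v" where
  "cscale c z = (Re c *\<^sub>R fst z - Im c *\<^sub>R snd z, Re c *\<^sub>R snd z + Im c *\<^sub>R fst z)"

definition cform :: "('v \<Rightarrow> 'v \<Rightarrow> real) \<Rightarrow> 'v \<times> 'v \<Rightarrow> 'v \<times> 'v \<Rightarrow> complex" where
  "cform B z w = Complex (B (fst z) (fst w) - B (snd z) (snd w)) (B (fst z) (snd w) + B (snd z) (fst w))"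

definition cproj_pos :: "'v set \<times> 'v set \<Rightarrow> 'v::real_vector \<times> 'v \<Rightarrow> 'v \<times> 'v" where
  "cproj_pos v = map_prod (proj_pos v) (proj_pos v)"

definition cproj_neg :: "'v set \<times> 'v set \<Rightarrow> 'v::real_vector \<times> 'v \<Rightarrow> 'v \<times> 'v" where
  "cproj_neg v = map_prod (proj_neg v) (proj_neg v)"

definition cx_holomorphic :: "('v::real_normed_vector \<times> 'v \<Rightarrow> complex) \<Rightarrow> bool" where
  "cx_holomorphic g \<longleftrightarrow>
     (\<forall>\<zeta>. \<exists>D. (g has_derivative D) (at \<zeta>) \<and> (\<forall>c h. D (cscale c h) = c * D h))"

section \<open>The theta function\<close>

definition theta_term ::
  "('v::real_vector \<Rightarrow> 'v \<Rightarrow> real) \<Rightarrow> 'v set \<times> 'v set \<Rightarrow> 'v \<Rightarrow> complex \<Rightarrow> 'v \<times> 'v \<Rightarrow> complex" where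
  "theta_term B v x \<tau> \<zeta> =
     e2pi (\<tau> * of_real (B (proj_pos v x) (proj_pos v x)) / 2
         + cnj \<tau> * of_real (B (proj_neg v x) (proj_neg v x)) / 2
         + cform B (cx x) \<zeta>)"

definition Theta ::
  "'v::real_vector set \<Rightarrow> ('v \<Rightarrow> 'v \<Rightarrow> real) \<Rightarrow> 'v set \<times> 'v set \<Rightarrow> complex \<Rightarrow> 'v \<times> 'v \<Rightarrow> 'v set \<Rightarrow> complex" where
  "Theta L B v \<tau> \<zeta> =
     (\<lambda>\<gamma>. if \<gamma> \<in> disc_group L B then (\<Sum>\<^sub>\<infinity>x\<in>\<gamma>. theta_term B v x \<tau> \<zeta>) else 0)"

section \<open>The metaplectic group and the Weil representation\<close>

definition SL2R :: "(real^2^2) set" where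
  "SL2R = {A. det A = 1}"

definition SL2Z :: "(real^2^2) set" where
  "SL2Z = {A \<in> SL2R. \<forall>i j. A $ i $ j \<in> \<int>}"

definition jfac :: "real^2^2 \<Rightarrow> complex \<Rightarrow> complex" where
  "jfac A \<tau> = of_real (A $ 2 $ 1) * \<tau> + of_real (A $ 2 $ 2)"

definition moeb :: "real^2^2 \<Rightarrow> complex \<Rightarrow> complex" where
  "moeb A \<tau> = (of_real (A $ 1 $ 1) * \<tau> + of_real (A $ 1 $ 2)) / jfac A \<tau>"

type_synonym mp_elt = "(real^2^2) \<times> (complex \<Rightarrow> complex)"

text \<open>The functions \<open>\<phi>\<close> live on the upper half plane only; hence \<open>extensional\<close> and \<open>restrict\<close>.\<close>

definition Mp2R :: "mp_elt monoid" where
  "Mp2R = \<lparr>carrier = {(A, \<phi>). A \<in> SL2R \<and> \<phi> \<in> extensional upper_half \<and>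
               \<phi> holomorphic_on upper_half \<and> (\<forall>\<tau>\<in>upper_half. (\<phi> \<tau>)\<^sup>2 = jfac A \<tau>)},
           monoid.mult = (\<lambda>(A, \<phi>) (B, \<psi>). (A ** B, restrict (\<lambda>\<tau>. \<phi> (moeb B \<tau>) * \<psi> \<tau>) upper_half)),
           one = (mat 1, restrict (\<lambda>_. 1) upper_half)\<rparr>"

definition Mp2Z :: "mp_elt monoid" where
  "Mp2Z = Mp2R\<lparr>carrier := {g \<in> carrier Mp2R. fst g \<in> SL2Z}\<rparr>"

definition Mp_T :: "mp_elt" where
  "Mp_T = (vector [vector [1, 1], vector [0, 1]], restrict (\<lambda>_. 1) upper_half)"

text \<open>On the upper half plane the principal root \<open>csqrt\<close> is the root lying in the upper half plane.\<close>

definition Mp_S :: "mp_elt" where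
  "Mp_S = (vector [vector [0, -1], vector [1, 0]], restrict csqrt upper_half)"

definition is_weil_rep ::
  "'v::real_vector set \<Rightarrow> ('v \<Rightarrow> 'v \<Rightarrow> real) \<Rightarrow>
   (mp_elt \<Rightarrow> ('v set \<Rightarrow> complex) \<Rightarrow> ('v set \<Rightarrow> complex)) \<Rightarrow> bool" where
  "is_weil_rep L B \<rho> \<longleftrightarrow>
     (\<forall>g\<in>carrier Mp2Z. \<forall>U\<in>group_space L B. \<rho> g U \<in> group_space L B) \<and>
     (\<forall>g\<in>carrier Mp2Z. \<forall>U\<in>group_space L B. \<forall>V\<in>group_space L B. \<forall>a b.
        \<rho> g (\<lambda>\<gamma>. a * U \<gamma> + b * V \<gamma>) = (\<lambda>\<gamma>. a * \<rho> g U \<gamma> + b * \<rho> g V \<gamma>)) \<and>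
     (\<forall>U\<in>group_space L B. \<rho> \<one>\<^bsub>Mp2Z\<^esub> U = U) \<and>
     (\<forall>g\<in>carrier Mp2Z. \<forall>h\<in>carrier Mp2Z. \<forall>U\<in>group_space L B. \<rho> (g \<otimes>\<^bsub>Mp2Z\<^esub> h) U = \<rho> g (\<rho> h U)) \<and>
     (\<forall>\<gamma>\<in>disc_group L B.
        \<rho> Mp_T (unit_vec \<gamma>) =
          (\<lambda>\<epsilon>. e2pi (of_real (B (coset_rep \<gamma>) (coset_rep \<gamma>)) / 2) * unit_vec \<gamma> \<epsilon>)) \<and>
     (\<forall>\<gamma>\<in>disc_group L B.
        \<rho> Mp_S (unit_vec \<gamma>) =
          (\<lambda>\<epsilon>. e2pi ((of_nat (snd (signature B)) - of_nat (fst (signature B))) / 8)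
                 / of_real (sqrt (real (card (disc_group L B))))
               * (\<Sum>\<delta>\<in>disc_group L B.
                    e2pi (- of_real (B (coset_rep \<gamma>) (coset_rep \<delta>))) * unit_vec \<delta> \<epsilon>)))"

text \<open>The choice is immaterial: \<open>Mp_S\<close> and \<open>Mp_T\<close> generate \<open>Mp2Z\<close>, so \<open>is_weil_rep\<close> determines
  \<open>\<rho> g U\<close> for \<open>g\<close> in \<open>Mp2Z\<close> and \<open>U\<close> in \<open>\<complex>[D\<^sub>L]\<close>, the only arguments ever used.\<close>

definition weil_rep ::
  "'v::real_vector set \<Rightarrow> ('v \<Rightarrow> 'v \<Rightarrow> real) \<Rightarrow>
   mp_elt \<Rightarrow> ('v set \<Rightarrow> complex) \<Rightarrow> ('v set \<Rightarrow> complex)" where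
  "weil_rep L B = (SOME \<rho>. is_weil_rep L B \<rho>)"

text \<open>\<open>\<rho>\<^sub>L\<^sup>* = \<rho>\<^bsub>L(-1)\<^esub>\<close>.\<close>

definition weil_rep_dual ::
  "'v::real_vector set \<Rightarrow> ('v \<Rightarrow> 'v \<Rightarrow> real) \<Rightarrow>
   mp_elt \<Rightarrow> ('v set \<Rightarrow> complex) \<Rightarrow> ('v set \<Rightarrow> complex)" where
  "weil_rep_dual L B = weil_rep L (neg_form B)"

section \<open>Modular forms and Jacobi forms\<close>

definition lin_exp_growth :: "(complex \<Rightarrow> complex) \<Rightarrow> bool" where
  "lin_exp_growth f \<longleftrightarrow>
     (\<forall>A\<in>SL2Z. \<exists>C::real. \<forall>X::real set. bounded X \<longrightarrow>
        (\<exists>K Y. Y > 0 \<and>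
           (\<forall>x\<in>X. \<forall>y\<ge>Y. norm (f (moeb A (Complex x y))) \<le> K * exp (C * y))))"

text \<open>Meant for half-integral \<open>p\<close> and \<open>q\<close>: the floor only turns the integer \<open>2p\<close> of type \<open>real\<close>
  into an \<open>int\<close>.\<close>

definition weight_factor :: "real \<Rightarrow> real \<Rightarrow> (complex \<Rightarrow> complex) \<Rightarrow> complex \<Rightarrow> complex" where
  "weight_factor p q \<phi> \<tau> = \<phi> \<tau> powi \<lfloor>2 * p\<rfloor> * cnj (\<phi> \<tau>) powi \<lfloor>2 * q\<rfloor>"

definition modular_form ::
  "'v::real_vector set \<Rightarrow> ('v \<Rightarrow> 'v \<Rightarrow> real) \<Rightarrow> mp_elt set \<Rightarrow>
   real \<Rightarrow> real \<Rightarrow> (complex \<Rightarrow> 'v set \<Rightarrow> complex) \<Rightarrow> bool" where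
  "modular_form L B \<Gamma> p q F \<longleftrightarrow>
     (\<forall>\<tau>\<in>upper_half. F \<tau> \<in> group_space L (neg_form B)) \<and>
     (\<forall>\<gamma>\<in>disc_group L B. smooth_on upper_half (\<lambda>\<tau>. F \<tau> \<gamma>)) \<and>
     (\<forall>(A, \<phi>)\<in>\<Gamma>. \<forall>\<tau>\<in>upper_half.
        F (moeb A \<tau>) = (\<lambda>\<gamma>. weight_factor p q \<phi> \<tau> * weil_rep_dual L B (A, \<phi>) (F \<tau>) \<gamma>)) \<and>
     (\<forall>\<gamma>\<in>disc_group L B. lin_exp_growth (\<lambda>\<tau>. F \<tau> \<gamma>))"

definition weakly_holomorphic ::
  "'v::real_vector set \<Rightarrow> ('v \<Rightarrow> 'v \<Rightarrow> real) \<Rightarrow> (complex \<Rightarrow> 'v set \<Rightarrow> complex) \<Rightarrow> bool" where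
  "weakly_holomorphic L B F \<longleftrightarrow>
     (\<forall>\<gamma>\<in>disc_group L B. (\<lambda>\<tau>. F \<tau> \<gamma>) holomorphic_on upper_half)"

definition jacobi_form ::
  "'v::real_inner set \<Rightarrow> ('v \<Rightarrow> 'v \<Rightarrow> real) \<Rightarrow> 'v set \<times> 'v set \<Rightarrow>
   mp_elt set \<Rightarrow> real \<Rightarrow> real \<Rightarrow> (complex \<Rightarrow> 'v \<times> 'v \<Rightarrow> complex) \<Rightarrow> bool" where
  "jacobi_form L B v \<Gamma> k l \<Phi> \<longleftrightarrow>
     smooth_on (upper_half \<times> UNIV) (\<lambda>(\<tau>, \<zeta>). \<Phi> \<tau> \<zeta>) \<and>
     (\<forall>\<tau>\<in>upper_half. \<forall>\<zeta>. \<forall>\<sigma>\<in>L. \<forall>\<nu>\<in>L.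
        \<Phi> \<tau> (\<zeta> + cscale \<tau> (cx (proj_pos v \<sigma>)) + cscale (cnj \<tau>) (cx (proj_neg v \<sigma>)) + cx \<nu>) =
        e2pi (- \<tau> * of_real (B (proj_pos v \<sigma>) (proj_pos v \<sigma>)) / 2
              - cnj \<tau> * of_real (B (proj_neg v \<sigma>) (proj_neg v \<sigma>)) / 2
              - cform B (cx \<sigma>) \<zeta>) * \<Phi> \<tau> \<zeta>) \<and>
     (\<forall>(A, \<phi>)\<in>\<Gamma>. \<forall>\<tau>\<in>upper_half. \<forall>\<zeta>.
        \<Phi> (moeb A \<tau>) (cscale (1 / jfac A \<tau>) (cproj_pos v \<zeta>) + cscale (1 / cnj (jfac A \<tau>)) (cproj_neg v \<zeta>)) =
        weight_factor k l \<phi> \<tau> *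
        e2pi (of_real (A $ 2 $ 1) * cform B (cproj_pos v \<zeta>) (cproj_pos v \<zeta>) / (2 * jfac A \<tau>)
            + of_real (A $ 2 $ 1) * cform B (cproj_neg v \<zeta>) (cproj_neg v \<zeta>) / (2 * cnj (jfac A \<tau>))) *
        \<Phi> \<tau> \<zeta>) \<and>
     (\<forall>\<tau>\<in>upper_half. cx_holomorphic (\<Phi> \<tau>)) \<and>
     (\<exists>f. (\<forall>\<tau>\<in>upper_half. \<forall>\<zeta>.
             ((\<lambda>x. f x \<tau> * theta_term B v x \<tau> \<zeta>) has_sum \<Phi> \<tau> \<zeta>) (dual_lattice L B)) \<and>
          (\<forall>x\<in>dual_lattice L B. lin_exp_growth (f x)))"

definition jacobi_of ::
  "'v::real_vector set \<Rightarrow> ('v \<Rightarrow> 'v \<Rightarrow> real) \<Rightarrow> 'v set \<times> 'v set \<Rightarrow>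
   (complex \<Rightarrow> 'v set \<Rightarrow> complex) \<Rightarrow> complex \<Rightarrow> 'v \<times> 'v \<Rightarrow> complex" where
  "jacobi_of L B v F \<tau> \<zeta> = pairing L B (Theta L B v \<tau> \<zeta>) (F \<tau>)"

section \<open>The heat operator\<close>

definition dbar :: "(complex \<Rightarrow> complex) \<Rightarrow> complex \<Rightarrow> complex" where
  "dbar f \<tau> = (frechet_derivative f (at \<tau>) 1 + \<i> * frechet_derivative f (at \<tau>) \<i>) / 2"

definition holo_pderiv ::
  "'v::real_normed_vector \<Rightarrow> ('v \<times> 'v \<Rightarrow> complex) \<Rightarrow> 'v \<times> 'v \<Rightarrow> complex" where
  "holo_pderiv e g \<zeta> = deriv (\<lambda>w. g (\<zeta> + cscale w (cx e))) 0"

definition neg_orthonormal_basis ::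
  "('v::real_vector \<Rightarrow> 'v \<Rightarrow> real) \<Rightarrow> 'v set \<times> 'v set \<Rightarrow> 'v set \<Rightarrow> bool" where
  "neg_orthonormal_basis B v E \<longleftrightarrow>
     finite E \<and> independent E \<and> span E = snd v \<and>
     (\<forall>e\<in>E. \<forall>e'\<in>E. B e e' = (if e = e' then -1 else 0))"

text \<open>On functions holomorphic in \<open>\<zeta>\<close> the result does not depend on the basis chosen.\<close>

definition holo_laplacian_neg ::
  "('v::real_normed_vector \<Rightarrow> 'v \<Rightarrow> real) \<Rightarrow> 'v set \<times> 'v set \<Rightarrow> ('v \<times> 'v \<Rightarrow> complex) \<Rightarrow> 'v \<times> 'v \<Rightarrow> complex" where
  "holo_laplacian_neg B v g \<zeta> =
     - (\<Sum>e\<in>(SOME E. neg_orthonormal_basis B v E). holo_pderiv e (holo_pderiv e g) \<zeta>)"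

definition pseudo_holomorphic ::
  "('v::real_normed_vector \<Rightarrow> 'v \<Rightarrow> real) \<Rightarrow> 'v set \<times> 'v set \<Rightarrow> (complex \<Rightarrow> 'v \<times> 'v \<Rightarrow> complex) \<Rightarrow> bool" where
  "pseudo_holomorphic B v \<Phi> \<longleftrightarrow>
     (\<forall>\<tau>\<in>upper_half. \<forall>\<zeta>.
        4 * of_real pi * \<i> * dbar (\<lambda>t. \<Phi> t \<zeta>) \<tau> - holo_laplacian_neg B v (\<Phi> \<tau>) \<zeta> = 0)"

end

theory Submission
  imports Defs
begin

text \<open>
  Write \<open>H = 4\<pi>\<i> dbar - \<Delta>\<close> for the heat operator. It annihilates every theta term, so termwise
  differentiation gives \<open>H \<Phi> = 4\<pi>\<i> \<Sum>\<^sub>\<gamma> \<Theta>\<^sub>\<gamma> dbar F\<^sub>\<gamma>\<close>. For fixed \<open>\<tau>\<close> this is an absolutely convergent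
  series of pairwise distinct characters in \<open>\<zeta>\<close>, with non-vanishing theta coefficients, hence it
  vanishes for all \<open>\<zeta>\<close> only if every \<open>dbar F\<^sub>\<gamma>\<close> does.

  The restriction on the weight does not need the theta decomposition or the Weil representation.
  Applying \<open>H\<close> to both sides of the transformation law of \<open>\<Psi>\<close> under a group element with
  lower left entry \<open>c\<close>, and using \<open>H \<Psi> = 0\<close> at both points, all derivatives of \<open>\<Psi>\<close> cancel and
  \<open>c (2l - b\<^sub>-) \<Psi> = 0\<close> remains. A subgroup of finite index contains an element with \<open>c \<noteq> 0\<close>.
\<close>

section \<open>Infinite sums\<close>

text \<open>A theta term is annihilated by \<open>H\<close> because two numbers agree:
  \<open>4 * pi * \<i>\<close> times the antiholomorphic rate
  \<open>pi * \<i> * B (pn x) (pn x)\<close> is -4 pi^2 times \<open>B (pn x) (pn x)\<close>, and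
  Parseval for a negative orthonormal basis gives the same value for the Laplacian. All convergence
  is governed by a positive definite form, the majorant, obtained from the indefinite
  \<open>B\<close> by a change of sign on \<open>snd v\<close>. Characters are separated by
  two-point averages along well chosen vectors, which take the place of a Fourier integral over a
  torus. In the weight argument, b_- is a count of Gaussians: along each unit vector of
  \<open>snd v\<close> the exponential factor of the transformation law is exp(\<mu> (w b - w^2/2)),
  with \<mu> a multiple of c, and the second derivative of this at 0 contributes a term -\<mu>. The
  competing 2l comes from \<open>dbar\<close> of the power of \<open>cnj \<phi>\<close>, which
  contributes 2l times the same \<mu>. For c = 0 both sides vanish, whence the search for an element
  with c different from 0.\<close>

lemma has_sum_finite_sum:
  fixes f :: "'j \<Rightarrow> 'i \<Rightarrow> 'b::real_normed_vector"
  assumes "finite I" "\<And>i. i \<in> I \<Longrightarrow> (f i has_sum s i) A"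
  shows "((\<lambda>x. \<Sum>i\<in>I. f i x) has_sum (\<Sum>i\<in>I. s i)) A"
  using assms by (induction I) (auto intro: has_sum_add)

lemma has_sum_diff:
  fixes f g :: "'i \<Rightarrow> 'b::real_normed_vector"
  assumes "(f has_sum a) A" "(g has_sum b) A"
  shows "((\<lambda>x. f x - g x) has_sum (a - b)) A"
  using has_sum_add[OF assms(1), of "\<lambda>x. - g x" "- b"] assms(2) by (simp add: has_sum_uminus)

section \<open>Linear independence of unitary characters in absolutely convergent series\<close>

lemma abs_summable_finite_tail:
  fixes g :: "'i \<Rightarrow> real"
  assumes "g summable_on A" "\<And>x. x \<in> A \<Longrightarrow> 0 \<le> g x" "\<epsilon> > 0"
  obtains F where "finite F" "F \<subseteq> A" "(\<Sum>\<^sub>\<infinity>x\<in>A - F. g x) \<le> \<epsilon>"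
proof -
  obtain F where F: "finite F" "F \<subseteq> A" "dist (sum g F) (infsum g A) \<le> \<epsilon>"
    using infsum_finite_approximation[OF assms(1,3)] by blast
  have "infsum g (A - F) = infsum g A - infsum g F"
    using F by (intro infsum_Diff assms summable_on_finite) auto
  with F have "infsum g (A - F) \<le> \<epsilon>" by (auto simp: dist_real_def)
  with F that show thesis by blast
qed

text \<open>Finitely many competitors of \<open>x0\<close> can be removed without touching
  \<open>d x0\<close>, and the others have arbitrarily small total mass. The hypothesis
  \<open>sep\<close> asks for opposite values, and not merely for different ones, so that a mean of
  two translates annihilates a competitor exactly.\<close>

lemma infsum_characters_eq_0_imp_coeff_eq_0:
  fixes d :: "'i \<Rightarrow> complex" and \<phi> :: "'i \<Rightarrow> 'g::monoid_add \<Rightarrow> complex"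
  assumes summ: "(\<lambda>x. norm (d x)) summable_on A"
    and mult: "\<And>x u w. x \<in> A \<Longrightarrow> \<phi> x (u + w) = \<phi> x u * \<phi> x w"
    and unit: "\<And>x u. x \<in> A \<Longrightarrow> norm (\<phi> x u) = 1"
    and sep: "\<And>x y. x \<in> A \<Longrightarrow> y \<in> A \<Longrightarrow> x \<noteq> y \<Longrightarrow> \<exists>w. \<phi> y w = - \<phi> x w"
    and zero: "\<And>u. (\<Sum>\<^sub>\<infinity>x\<in>A. d x * \<phi> x u) = 0"
    and x0: "x0 \<in> A"
  shows "d x0 = 0"
proof -
  text \<open>The operator \<open>f \<mapsto> (f(u) + f(u + w) / \<phi> x0 w) / 2\<close> fixes the character \<open>\<phi> x0\<close>, kills \<open>\<phi> y\<close>
    when \<open>\<phi> y w = - \<phi> x0 w\<close>, and does not increase any other coefficient.\<close>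
  have kill: "\<exists>d'. (\<forall>x\<in>A. norm (d' x) \<le> norm (d x)) \<and> d' x0 = d x0 \<and> (\<forall>x\<in>F. d' x = 0) \<and>
          (\<forall>u. (\<Sum>\<^sub>\<infinity>x\<in>A. d' x * \<phi> x u) = 0)" if "finite F" "F \<subseteq> A - {x0}" for F
    using that
  proof (induction F)
    case empty
    then show ?case using zero by (intro exI[of _ d]) auto
  next
    case (insert y F)
    then obtain d' where d': "\<And>x. x \<in> A \<Longrightarrow> norm (d' x) \<le> norm (d x)" "d' x0 = d x0"
      "\<And>x. x \<in> F \<Longrightarrow> d' x = 0" "\<And>u. (\<Sum>\<^sub>\<infinity>x\<in>A. d' x * \<phi> x u) = 0" by auto
    have y: "y \<in> A" "y \<noteq> x0" using insert by auto
    then obtain w where w: "\<phi> y w = - \<phi> x0 w" using sep x0 by blast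
    have nz: "\<phi> x0 w \<noteq> 0" using unit[OF x0, of w] by auto
    have summ': "(\<lambda>x. d' x * \<phi> x u) summable_on A" for u
    proof (rule abs_summable_summable, rule summable_on_comparison_test[OF summ])
      show "norm (d' x * \<phi> x u) \<le> norm (d x)" if "x \<in> A" for x
        using d'(1)[OF that] unit[OF that] by (simp add: norm_mult)
    qed simp
    define d2 where "d2 x = d' x * (1 + \<phi> x w / \<phi> x0 w) / 2" for x
    have "norm (d2 x) \<le> norm (d x)" if "x \<in> A" for x
    proof -
      have "norm (1 + \<phi> x w / \<phi> x0 w) \<le> 2"
        using norm_triangle_ineq[of 1 "\<phi> x w / \<phi> x0 w"] unit[OF x0] unit[OF that]
        by (simp add: norm_divide)
      then have "norm (d' x) * norm (1 + \<phi> x w / \<phi> x0 w) \<le> norm (d' x) * 2"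
        by (intro mult_left_mono) auto
      then have "norm (d2 x) \<le> norm (d' x)" by (simp add: d2_def norm_mult)
      then show ?thesis using d'(1)[OF that] by linarith
    qed
    moreover have "d2 x0 = d x0" using d' nz by (simp add: d2_def)
    moreover have "d2 x = 0" if "x \<in> insert y F" for x
      using that d'(3) w nz by (auto simp: d2_def)
    moreover have "(\<Sum>\<^sub>\<infinity>x\<in>A. d2 x * \<phi> x u) = 0" for u
    proof -
      have "(\<Sum>\<^sub>\<infinity>x\<in>A. d2 x * \<phi> x u) =
          (\<Sum>\<^sub>\<infinity>x\<in>A. (1/2) * (d' x * \<phi> x u) + 1 / (2 * \<phi> x0 w) * (d' x * \<phi> x (u + w)))"
        using nz by (intro infsum_cong) (simp add: d2_def mult field_simps)
      also have "\<dots> = (1/2) * (\<Sum>\<^sub>\<infinity>x\<in>A. d' x * \<phi> x u)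
          + 1 / (2 * \<phi> x0 w) * (\<Sum>\<^sub>\<infinity>x\<in>A. d' x * \<phi> x (u + w))"
        by (subst infsum_add) (intro summable_on_cmult_right summ', intro summable_on_cmult_right summ',
              simp only: infsum_cmult_right')
      finally show ?thesis by (simp only: d'(4)) simp
    qed
    ultimately show ?case by blast
  qed
  \<comment> \<open>\<open>F\<close> holds all competitors outside a tail of mass \<epsilon>. Once
    they are killed, the vanishing series at u = 0 balances the term of \<open>x0\<close> against
    that tail, whose coefficients have not grown.\<close>
  have "norm (d x0) \<le> \<epsilon>" if "\<epsilon> > 0" for \<epsilon>
  proof -
    have summ1: "(\<lambda>x. norm (d x)) summable_on C" if "C \<subseteq> A" for C
      by (rule summable_on_subset[OF summ that])
    obtain F where F: "finite F" "F \<subseteq> A - {x0}" "(\<Sum>\<^sub>\<infinity>x\<in>A - {x0} - F. norm (d x)) \<le> \<epsilon>"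
      using abs_summable_finite_tail[of "\<lambda>x. norm (d x)" "A - {x0}" \<epsilon>] summ1 \<open>\<epsilon> > 0\<close> by auto
    obtain d' where d': "\<And>x. x \<in> A \<Longrightarrow> norm (d' x) \<le> norm (d x)" "d' x0 = d x0"
      "\<And>x. x \<in> F \<Longrightarrow> d' x = 0" "\<And>u. (\<Sum>\<^sub>\<infinity>x\<in>A. d' x * \<phi> x u) = 0"
      using kill[OF F(1,2)] by auto
    let ?t = "\<lambda>x. d' x * \<phi> x 0"
    let ?R = "A - {x0} - F"
    have abs: "(\<lambda>x. norm (?t x)) summable_on ?R"
    proof (rule summable_on_comparison_test[OF summ1])
      show "norm (?t x) \<le> norm (d x)" if "x \<in> ?R" for x
        using d'(1)[of x] unit[of x] that by (auto simp: norm_mult)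
    qed auto
    have sR: "?t summable_on ?R" using abs by (rule abs_summable_summable)
    have "0 = infsum ?t (insert x0 ?R)"
      unfolding d'(4)[of 0, symmetric]
      by (rule infsum_cong_neutral) (use d'(3) x0 in auto)
    also have "\<dots> = ?t x0 + infsum ?t ?R"
      using sR by (subst infsum_insert) auto
    finally have "norm (?t x0) = norm (infsum ?t ?R)"
      by (metis add.commute add_eq_0_iff norm_minus_cancel)
    also have "\<dots> \<le> (\<Sum>\<^sub>\<infinity>x\<in>?R. norm (d x))"
    proof (rule norm_infsum_le)
      show "(?t has_sum infsum ?t ?R) ?R" using sR by (rule has_sum_infsum)
      show "((\<lambda>x. norm (d x)) has_sum (\<Sum>\<^sub>\<infinity>x\<in>?R. norm (d x))) ?R"
        by (intro has_sum_infsum summ1) auto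
      show "norm (?t x) \<le> norm (d x)" if "x \<in> ?R" for x
        using d'(1)[of x] unit[of x] that by (auto simp: norm_mult)
    qed
    finally show ?thesis using F unit[OF x0] by (simp add: norm_mult d'(2))
  qed
  then have "norm (d x0) \<le> 0" by (rule field_le_epsilon) simp
  then show ?thesis by simp
qed

section \<open>Termwise differentiation of dominated series\<close>

lemma has_derivative_infsum:
  fixes f :: "'i \<Rightarrow> 'a::real_normed_vector \<Rightarrow> 'b::banach"
  assumes S: "convex S" "open S" "x0 \<in> S"
    and der: "\<And>i x. i \<in> A \<Longrightarrow> x \<in> S \<Longrightarrow> (f i has_derivative f' i x) (at x)"
    and bound: "\<And>i x h. i \<in> A \<Longrightarrow> x \<in> S \<Longrightarrow> norm (f' i x h) \<le> M i * norm h"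
    and M: "M summable_on A" "\<And>i. i \<in> A \<Longrightarrow> 0 \<le> M i"
    and summ: "\<And>x. x \<in> S \<Longrightarrow> (\<lambda>i. f i x) summable_on A"
  shows "((\<lambda>x. \<Sum>\<^sub>\<infinity>i\<in>A. f i x) has_derivative (\<lambda>h. \<Sum>\<^sub>\<infinity>i\<in>A. f' i x0 h)) (at x0)"
proof -
  have bl: "bounded_linear (f' i x0)" if "i \<in> A" for i
    using der[OF that S(3)] by (rule has_derivative_bounded_linear)
  have Mh: "(\<lambda>i. M i * c) summable_on C" if "C \<subseteq> A" for c C
    by (intro summable_on_cmult_left summable_on_subset[OF M(1) that])
  have summ': "(\<lambda>i. f' i x0 h) summable_on A" for h
    by (rule abs_summable_summable, rule summable_on_comparison_test[OF Mh[of A "norm h"]])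
      (use bound S in auto)
  have "bounded_linear (\<lambda>h. \<Sum>\<^sub>\<infinity>i\<in>A. f' i x0 h)"
  proof (rule bounded_linear_intro)
    fix x y
    have "(\<Sum>\<^sub>\<infinity>i\<in>A. f' i x0 (x + y)) = (\<Sum>\<^sub>\<infinity>i\<in>A. f' i x0 x + f' i x0 y)"
      by (rule infsum_cong) (simp add: linear_add bl bounded_linear.linear)
    then show "(\<Sum>\<^sub>\<infinity>i\<in>A. f' i x0 (x + y)) = (\<Sum>\<^sub>\<infinity>i\<in>A. f' i x0 x) + (\<Sum>\<^sub>\<infinity>i\<in>A. f' i x0 y)"
      by (simp add: infsum_add summ')
  next
    fix r x
    have "(\<Sum>\<^sub>\<infinity>i\<in>A. f' i x0 (r *\<^sub>R x)) = (\<Sum>\<^sub>\<infinity>i\<in>A. r *\<^sub>R f' i x0 x)"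
      by (rule infsum_cong) (simp add: linear_cmul bl bounded_linear.linear)
    then show "(\<Sum>\<^sub>\<infinity>i\<in>A. f' i x0 (r *\<^sub>R x)) = r *\<^sub>R (\<Sum>\<^sub>\<infinity>i\<in>A. f' i x0 x)"
      by (simp add: infsum_scaleR_right)
  next
    fix h
    have "norm (\<Sum>\<^sub>\<infinity>i\<in>A. f' i x0 h) \<le> (\<Sum>\<^sub>\<infinity>i\<in>A. M i * norm h)"
      by (rule norm_infsum_le[OF has_sum_infsum[OF summ'] has_sum_infsum[OF Mh[of A "norm h"]]])
        (use bound S in auto)
    also have "\<dots> = norm h * infsum M A" by (simp add: infsum_cmult_left' mult.commute)
    finally show "norm (\<Sum>\<^sub>\<infinity>i\<in>A. f' i x0 h) \<le> norm h * infsum M A" .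
  qed
  moreover have "\<exists>d>0. \<forall>y. norm (y - x0) < d \<longrightarrow>
      norm ((\<Sum>\<^sub>\<infinity>i\<in>A. f i y) - (\<Sum>\<^sub>\<infinity>i\<in>A. f i x0) - (\<Sum>\<^sub>\<infinity>i\<in>A. f' i x0 (y - x0))) \<le> e * norm (y - x0)"
    if "e > 0" for e
  proof -
    from \<open>e > 0\<close> have "e / 4 > 0" by simp
    \<comment> \<open>The Taylor remainder of each term is at most
      \<open>2 * M i * norm (y - x0)\<close> by the mean value inequality on the convex set
      \<open>S\<close>. A tail of mass \<open>e / 4\<close> therefore costs \<open>e / 2\<close>,
      and the finite part may use the other half.\<close>
    from abs_summable_finite_tail[OF M this]
    obtain F where F: "finite F" "F \<subseteq> A" "infsum M (A - F) \<le> e / 4" .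
    have dF: "((\<lambda>x. \<Sum>i\<in>F. f i x) has_derivative (\<lambda>h. \<Sum>i\<in>F. f' i x0 h)) (at x0)"
      using F S der by (intro has_derivative_sum) auto
    from \<open>e > 0\<close> have "e / 2 > 0" by simp
    with dF obtain d1 where d1: "d1 > 0" "\<And>y. norm (y - x0) < d1 \<Longrightarrow>
        norm ((\<Sum>i\<in>F. f i y) - (\<Sum>i\<in>F. f i x0) - (\<Sum>i\<in>F. f' i x0 (y - x0))) \<le> e/2 * norm (y - x0)"
      unfolding has_derivative_at_alt by meson
    obtain d2 where d2: "d2 > 0" "\<And>y. dist y x0 < d2 \<Longrightarrow> y \<in> S"
      using S(2,3) unfolding open_dist by blast
    let ?r = "\<lambda>i y. f i y - f i x0 - f' i x0 (y - x0)"
    have "norm ((\<Sum>\<^sub>\<infinity>i\<in>A. f i y) - (\<Sum>\<^sub>\<infinity>i\<in>A. f i x0) - (\<Sum>\<^sub>\<infinity>i\<in>A. f' i x0 (y - x0))) \<le> e * norm (y - x0)"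
      if y: "norm (y - x0) < min d1 d2" for y
    proof -
      have yS: "y \<in> S" using d2 y by (simp add: dist_norm)
      have rb: "norm (?r i y) \<le> M i * (2 * norm (y - x0))" if i: "i \<in> A" for i
      proof -
        have "norm (f i y - f i x0) \<le> M i * norm (y - x0)"
        proof (rule differentiable_bound[OF S(1)])
          show "(f i has_derivative f' i x) (at x within S)" if "x \<in> S" for x
            using der[OF i that] by (rule has_derivative_at_withinI)
          show "onorm (f' i x) \<le> M i" if "x \<in> S" for x
            using bound[OF i that] M(2)[OF i] by (intro onorm_bound) auto
        qed (use yS S in auto)
        moreover have "norm (f' i x0 (y - x0)) \<le> M i * norm (y - x0)"
          using bound i S by blast
        ultimately show ?thesis using norm_triangle_ineq4[of "f i y - f i x0" "f' i x0 (y - x0)"] by simp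
      qed
      have hs: "((\<lambda>i. ?r i y) has_sum
          ((\<Sum>\<^sub>\<infinity>i\<in>A. f i y) - (\<Sum>\<^sub>\<infinity>i\<in>A. f i x0) - (\<Sum>\<^sub>\<infinity>i\<in>A. f' i x0 (y - x0)))) A"
        by (intro has_sum_diff has_sum_infsum summ summ' yS S)
      have sr: "(\<lambda>i. ?r i y) summable_on C" if "C \<subseteq> A" for C
        by (rule summable_on_subset_banach[OF has_sum_imp_summable[OF hs] that])
      have "(\<Sum>\<^sub>\<infinity>i\<in>A. f i y) - (\<Sum>\<^sub>\<infinity>i\<in>A. f i x0) - (\<Sum>\<^sub>\<infinity>i\<in>A. f' i x0 (y - x0)) = (\<Sum>\<^sub>\<infinity>i\<in>A. ?r i y)"
        using infsumI[OF hs] by simp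
      also have "\<dots> = (\<Sum>\<^sub>\<infinity>i\<in>F \<union> (A - F). ?r i y)" using F by (simp add: Un_absorb1)
      also have "\<dots> = (\<Sum>i\<in>F. ?r i y) + (\<Sum>\<^sub>\<infinity>i\<in>A - F. ?r i y)"
        using F sr by (subst infsum_Un_disjoint) auto
      also have "norm \<dots> \<le> e/2 * norm (y - x0) + e/4 * (2 * norm (y - x0))"
      proof (rule norm_triangle_mono)
        show "norm (\<Sum>i\<in>F. ?r i y) \<le> e/2 * norm (y - x0)"
          using d1(2)[of y] y by (simp add: sum_subtractf)
        have "norm (\<Sum>\<^sub>\<infinity>i\<in>A - F. ?r i y) \<le> (\<Sum>\<^sub>\<infinity>i\<in>A - F. M i * (2 * norm (y - x0)))"
          by (rule norm_infsum_le[OF has_sum_infsum[OF sr] has_sum_infsum[OF Mh]]) (use rb in auto)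
        also have "\<dots> = infsum M (A - F) * (2 * norm (y - x0))" by (rule infsum_cmult_left')
        also have "\<dots> \<le> e/4 * (2 * norm (y - x0))" using F by (intro mult_right_mono) auto
        finally show "norm (\<Sum>\<^sub>\<infinity>i\<in>A - F. ?r i y) \<le> e/4 * (2 * norm (y - x0))" .
      qed
      finally show ?thesis by (simp add: algebra_simps)
    qed
    then show ?thesis using d1 d2 by (intro exI[of _ "min d1 d2"]) auto
  qed
  ultimately show ?thesis unfolding has_derivative_at_alt by blast
qed

section \<open>Exponential sums over integer tuples\<close>

lemma summable_on_prod_PiE_nonneg:
  fixes f :: "'a \<Rightarrow> 'b \<Rightarrow> real"
  assumes "finite A" "\<And>x. x \<in> A \<Longrightarrow> countable (B x)" "\<And>x. x \<in> A \<Longrightarrow> f x summable_on B x"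
    "\<And>x y. 0 \<le> f x y"
  shows "(\<lambda>g. \<Prod>x\<in>A. f x (g x)) summable_on PiE A B"
proof -
  have "Infinite_Set_Sum.abs_summable_on (\<lambda>g. \<Prod>x\<in>A. f x (g x)) (PiE A B)"
    using assms by (intro abs_summable_on_prod_PiE) (auto simp: abs_summable_equivalent[symmetric])
  then show ?thesis using assms by (simp add: abs_summable_equivalent[symmetric] abs_prod)
qed

lemma summable_on_exp_neg_abs_int: "(\<lambda>n::int. exp (- \<bar>of_int n\<bar>) :: real) summable_on UNIV"
proof -
  have geo: "(\<lambda>n::nat. exp (- real n)) summable_on UNIV"
  proof -
    have "summable (\<lambda>n::nat. exp (-1::real) ^ n)" by (rule summable_geometric) simp
    then have "summable (\<lambda>n::nat. norm (exp (- real n)))"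
      by (simp add: exp_of_nat_mult[symmetric])
    then show ?thesis by (rule norm_summable_imp_summable_on)
  qed
  have "(\<lambda>n::int. exp (- \<bar>of_int n\<bar>) :: real) summable_on (range int)"
    using geo by (subst summable_on_reindex) (auto simp: o_def)
  moreover have "(\<lambda>n::int. exp (- \<bar>of_int n\<bar>) :: real) summable_on (range (\<lambda>n. - int n))"
    using geo by (subst summable_on_reindex) (auto simp: o_def inj_on_def)
  ultimately have "(\<lambda>n::int. exp (- \<bar>of_int n\<bar>) :: real) summable_on (range int \<union> range (\<lambda>n. - int n))"
    by (rule summable_on_union)
  moreover have "range int \<union> range (\<lambda>n. - int n) = UNIV"
    by (auto simp: image_iff) (metis int_cases2)
  ultimately show ?thesis by simp
qed

section \<open>Lattices with a splitting\<close>

text \<open>Gram-Schmidt for a form that is definite only on the span in question; it is meant for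
  \<open>neg_form B\<close> on \<open>snd v\<close>. The inner product of the type is unrelated to
  \<open>G\<close>.\<close>

lemma orthonormal_basis_exists:
  fixes G :: "'v::real_vector \<Rightarrow> 'v \<Rightarrow> real"
  assumes G: "bilinear G" "\<And>x y. G x y = G y x" and "finite E0" "pos_def_on G (span E0)"
  shows "\<exists>E. finite E \<and> span E = span E0 \<and> (\<forall>e\<in>E. \<forall>e'\<in>E. G e e' = (if e = e' then 1 else 0))"
  using assms(3,4)
proof (induction E0)
  case empty
  then show ?case by (intro exI[of _ "{}"]) auto
next
  case (insert a E0)
  have "pos_def_on G (span E0)"
    using insert.prems span_mono[of E0 "insert a E0"] by (auto simp: pos_def_on_def)
  with insert.IH obtain E where E: "finite E" "span E = span E0"
    "\<And>e e'. e \<in> E \<Longrightarrow> e' \<in> E \<Longrightarrow> G e e' = (if e = e' then 1 else 0)" by blast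
  interpret Gl: linear "\<lambda>x. G x y" for y using G(1) by (auto simp: bilinear_def)
  interpret Gr: linear "\<lambda>y. G x y" for x using G(1) by (auto simp: bilinear_def)
  show ?case
  proof (cases "a \<in> span E0")
    case True
    with E show ?thesis by (intro exI[of _ E]) (auto simp: span_redundant)
  next
    case False
    define p where "p = (\<Sum>e\<in>E. G a e *\<^sub>R e)"
    define b where "b = a - p"
    have p: "p \<in> span E" unfolding p_def by (intro span_sum span_scale span_base)
    have b0: "b \<noteq> 0" using False p E(2) by (auto simp: b_def)
    have "span (insert a E) = span (insert a E0)"
      using E(2) by (simp add: span_insert)
    moreover have "b \<in> span (insert a E)"
      unfolding b_def using p span_mono[of E "insert a E"] by (intro span_diff) (auto intro: span_base)
    ultimately have bspan: "b \<in> span (insert a E0)"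
      by simp
    define r where "r = sqrt (G b b)"
    have Gbb: "G b b > 0" using insert.prems bspan b0 by (auto simp: pos_def_on_def)
    have r: "r > 0" "r * r = G b b" using Gbb by (auto simp: r_def)
    have orth: "G b e = 0" if "e \<in> E" for e
    proof -
      have "G p e = (\<Sum>e'\<in>E. if e' = e then G a e else 0)"
        unfolding p_def Gl.sum using E(3) that by (intro sum.cong) (auto simp: Gl.scale)
      also have "\<dots> = G a e" using that E(1) by simp
      finally show ?thesis by (simp add: b_def Gl.diff)
    qed
    let ?u = "(1 / r) *\<^sub>R b"
    have "span (insert ?u E) = span (insert a E)"
    proof
      have "?u \<in> span (insert a E)"
        using bspan \<open>span (insert a E) = span (insert a E0)\<close> by (auto intro: span_scale)
      then show "span (insert ?u E) \<subseteq> span (insert a E)"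
        by (intro span_minimal) (auto intro: span_base)
      have "a = r *\<^sub>R ?u + p" using r by (simp add: b_def)
      also have "\<dots> \<in> span (insert ?u E)"
        using p span_mono[of E "insert ?u E"] span_base[of ?u "insert ?u E"]
        by (intro span_add[OF span_scale]) blast+
      finally show "span (insert a E) \<subseteq> span (insert ?u E)"
        by (intro span_minimal) (auto intro: span_base)
    qed
    moreover have "G e e' = (if e = e' then 1 else 0)" if "e \<in> insert ?u E" "e' \<in> insert ?u E" for e e'
    proof -
      have nu: "?u \<notin> E" 
        using orth[of ?u] r by (auto simp: Gr.scale)
      have uu: "G ?u ?u = 1" using r Gbb by (simp add: Gl.scale Gr.scale field_simps)
      have ue: "G ?u e = 0" "G e ?u = 0" if "e \<in> E" for e
        using orth[OF that] G(2)[of e b] by (auto simp: Gl.scale Gr.scale)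
      show ?thesis
      proof (cases "e = ?u")
        case True
        then show ?thesis using that nu uu ue by (cases "e' = ?u") auto
      next
        case False
        then show ?thesis using that nu ue E(3) by (cases "e' = ?u") auto
      qed
    qed
    ultimately show ?thesis
      using E \<open>span (insert a E) = span (insert a E0)\<close> by (intro exI[of _ "insert ?u E"]) auto
  qed
qed

lemma int_span_base:
  fixes E :: "'v::real_vector set"
  assumes "finite E" "e \<in> E" shows "e \<in> int_span E"
proof -
  have "(\<Sum>x\<in>E. of_int (if x = e then 1 else 0) *\<^sub>R x) = (\<Sum>x\<in>E. if x = e then e else 0)"
    by (rule sum.cong) auto
  also have "\<dots> = e" using assms by simp
  finally show ?thesis unfolding int_span_def by (auto intro!: exI[of _ "\<lambda>x. if x = e then 1 else 0"])
qed

lemma int_span_memI: "x = (\<Sum>e\<in>E. of_int (c e) *\<^sub>R e) \<Longrightarrow> x \<in> int_span E"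
  unfolding int_span_def by blast

text \<open>The Siegel majorant of \<open>B\<close> at the point \<open>v\<close>. It is the
  quadratic form that controls the size of the theta terms.\<close>

definition majorant :: "('v \<Rightarrow> 'v \<Rightarrow> real) \<Rightarrow> 'v set \<times> 'v set \<Rightarrow> 'v::real_vector \<Rightarrow> real" where
  "majorant B v x = B (proj_pos v x) (proj_pos v x) - B (proj_neg v x) (proj_neg v x)"

text \<open>Names the coset of a given point, so that a sum over the discriminant group and its
  cosets can be written as one sum over the dual lattice.\<close>

definition lattice_coset :: "'v::real_vector set \<Rightarrow> 'v \<Rightarrow> 'v set" where
  "lattice_coset L x = (\<lambda>y. y + x) ` L"

locale lattice_with_splitting =
  fixes L :: "'v::real_inner set" and B :: "'v \<Rightarrow> 'v \<Rightarrow> real" and v :: "'v set \<times> 'v set"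
  assumes lattice: "even_lattice L B" and splitting: "v \<in> Grass B"
begin

abbreviation "pp \<equiv> proj_pos v"
abbreviation "pn \<equiv> proj_neg v"
abbreviation "dl \<equiv> dual_lattice L B"
abbreviation "maj \<equiv> majorant B v"

section \<open>The splitting, its projections and the majorant\<close>

lemma bilinear_B: "bilinear B" and B_sym: "B x y = B y x"
  using lattice unfolding even_lattice_def by blast+

sublocale Bl: linear "\<lambda>x. B x y" for y using bilinear_B by (auto simp: bilinear_def)
sublocale Br: linear "\<lambda>y. B x y" for x using bilinear_B by (auto simp: bilinear_def)

lemmas B_simps = Bl.add Br.add Bl.diff Br.diff Bl.neg Br.neg Bl.scale Br.scale Bl.zero Br.zero

lemma subspace_pos: "subspace (fst v)" and subspace_neg: "subspace (snd v)"
  and pos_Int_neg: "fst v \<inter> snd v = {0}"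
  and splitting_ex: "\<exists>p\<in>fst v. \<exists>n\<in>snd v. x = p + n"
  and B_pos_neg: "p \<in> fst v \<Longrightarrow> n \<in> snd v \<Longrightarrow> B p n = 0"
  and pos_def_pos: "pos_def_on B (fst v)" and pos_def_neg: "pos_def_on (neg_form B) (snd v)"
  using splitting unfolding Grass_def by auto

lemma proj_pos_eq:
  assumes "p \<in> fst v" "n \<in> snd v"
  shows "pp (p + n) = p"
  unfolding proj_pos_def
proof (rule the_equality)
  show "p \<in> fst v \<and> p + n - p \<in> snd v" using assms by simp
  fix y assume y: "y \<in> fst v \<and> p + n - y \<in> snd v"
  then have "y - p \<in> fst v" using assms subspace_pos by (auto intro: subspace_diff)
  moreover have "n - (p + n - y) \<in> snd v" using y assms subspace_neg by (blast intro: subspace_diff)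
  then have "y - p \<in> snd v" by (simp add: algebra_simps)
  ultimately have "y - p \<in> {0}" using pos_Int_neg by blast
  then show "y = p" by simp
qed

lemma proj_neg_eq:
  assumes "p \<in> fst v" "n \<in> snd v"
  shows "pn (p + n) = n"
  unfolding proj_neg_def
proof (rule the_equality)
  show "n \<in> snd v \<and> p + n - n \<in> fst v" using assms by simp
  fix y assume y: "y \<in> snd v \<and> p + n - y \<in> fst v"
  then have "y - n \<in> snd v" using assms subspace_neg by (auto intro: subspace_diff)
  moreover have "p - (p + n - y) \<in> fst v" using y assms subspace_pos by (blast intro: subspace_diff)
  then have "y - n \<in> fst v" by (simp add: algebra_simps)
  ultimately have "y - n \<in> {0}" using pos_Int_neg by blast
  then show "y = n" by simp
qed

lemma proj_pos_in [simp]: "pp x \<in> fst v" and proj_neg_in [simp]: "pn x \<in> snd v"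
  and proj_sum: "pp x + pn x = x"
proof -
  obtain p n where pn: "p \<in> fst v" "n \<in> snd v" "x = p + n" using splitting_ex[of x] by blast
  then show "pp x \<in> fst v" "pn x \<in> snd v" "pp x + pn x = x"
    using proj_pos_eq[of p n] proj_neg_eq[of p n] by simp_all
qed

lemma linear_proj_pos: "linear pp"
proof (rule linearI)
  fix x y and r :: real
  have "pp ((pp x + pp y) + (pn x + pn y)) = pp x + pp y"
    by (rule proj_pos_eq) (auto intro: subspace_add subspace_pos subspace_neg)
  moreover have "(pp x + pp y) + (pn x + pn y) = x + y"
    using arg_cong2[OF proj_sum[of x] proj_sum[of y], of "(+)"] by (simp only: ac_simps)
  ultimately show "pp (x + y) = pp x + pp y" by simp
  have "pp (r *\<^sub>R pp x + r *\<^sub>R pn x) = r *\<^sub>R pp x"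
    by (rule proj_pos_eq) (auto intro: subspace_scale subspace_pos subspace_neg)
  then show "pp (r *\<^sub>R x) = r *\<^sub>R pp x" by (simp add: scaleR_add_right[symmetric] proj_sum)
qed

lemma linear_proj_neg: "linear pn"
proof (rule linearI)
  fix x y and r :: real
  have "pn ((pp x + pp y) + (pn x + pn y)) = pn x + pn y"
    by (rule proj_neg_eq) (auto intro: subspace_add subspace_pos subspace_neg)
  moreover have "(pp x + pp y) + (pn x + pn y) = x + y"
    using arg_cong2[OF proj_sum[of x] proj_sum[of y], of "(+)"] by (simp only: ac_simps)
  ultimately show "pn (x + y) = pn x + pn y" by simp
  have "pn (r *\<^sub>R pp x + r *\<^sub>R pn x) = r *\<^sub>R pn x"
    by (rule proj_neg_eq) (auto intro: subspace_scale subspace_pos subspace_neg)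
  then show "pn (r *\<^sub>R x) = r *\<^sub>R pn x" by (simp add: scaleR_add_right[symmetric] proj_sum)
qed

sublocale pp: linear pp by (rule linear_proj_pos)
sublocale pn: linear pn by (rule linear_proj_neg)

lemma proj_pos_neg [simp]: "n \<in> snd v \<Longrightarrow> pp n = 0" and proj_neg_neg [simp]: "n \<in> snd v \<Longrightarrow> pn n = n"
  using proj_pos_eq[of 0 n] proj_neg_eq[of 0 n] subspace_0[OF subspace_pos] by auto

lemma proj_pos_pos [simp]: "p \<in> fst v \<Longrightarrow> pp p = p" and proj_neg_pos [simp]: "p \<in> fst v \<Longrightarrow> pn p = 0"
  using proj_pos_eq[of p 0] proj_neg_eq[of p 0] subspace_0[OF subspace_neg] by auto

lemma B_decomp: "B x y = B (pp x) (pp y) + B (pn x) (pn y)"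
proof -
  have "B x y = B (pp x + pn x) (pp y + pn y)" by (simp add: proj_sum)
  also have "\<dots> = B (pp x) (pp y) + B (pn x) (pn y)"
    using B_pos_neg[of "pp x" "pn y"] B_pos_neg[of "pp y" "pn x"] B_sym[of "pn x" "pp y"]
    by (simp add: B_simps)
  finally show ?thesis .
qed

lemma B_neg: "e \<in> snd v \<Longrightarrow> B x e = B (pn x) e"
  by (subst B_decomp) (simp add: B_simps)

lemma B_proj_pos_nonneg: "0 \<le> B (pp x) (pp x)"
  using pos_def_pos proj_pos_in[of x] unfolding pos_def_on_def by (cases "pp x = 0") (auto simp: B_simps less_imp_le)

lemma B_proj_neg_nonpos: "B (pn x) (pn x) \<le> 0"
  using pos_def_neg proj_neg_in[of x] unfolding pos_def_on_def neg_form_def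
  by (cases "pn x = 0") (auto simp: B_simps less_imp_le)

lemma maj_nonneg: "0 \<le> maj x"
  using B_proj_pos_nonneg[of x] B_proj_neg_nonpos[of x] by (simp add: majorant_def)

lemma maj_pos: assumes "x \<noteq> 0" shows "0 < maj x"
proof -
  have "pp x \<noteq> 0 \<or> pn x \<noteq> 0" using assms proj_sum[of x] by auto
  then have "0 < B (pp x) (pp x) \<or> B (pn x) (pn x) < 0"
    using pos_def_pos pos_def_neg proj_pos_in[of x] proj_neg_in[of x]
    unfolding pos_def_on_def neg_form_def by fastforce
  then show ?thesis
    using B_proj_pos_nonneg[of x] B_proj_neg_nonpos[of x] by (auto simp: majorant_def)
qed

lemma maj_lincomb: "maj (s *\<^sub>R x + y) =
    s\<^sup>2 * maj x + 2 * s * (B (pp x) (pp y) - B (pn x) (pn y)) + maj y"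
  using B_sym[of "pp x" "pp y"] B_sym[of "pn x" "pn y"]
  by (simp add: majorant_def B_simps pp.add pp.scale pn.add pn.scale power2_eq_square algebra_simps)

text \<open>Reflecting the negative part preserves the majorant and turns \<open>B\<close> into the
  scalar product that polarizes it. This is how a vector pairing positively with a given nonzero
  vector is produced later.\<close>

lemma maj_flip: "maj (pp y - pn y) = maj y" and B_flip: "B x (pp y - pn y) = B (pp x) (pp y) - B (pn x) (pn y)"
proof -
  have "pp (pp y - pn y) = pp y" "pn (pp y - pn y) = - pn y"
    by (simp_all add: pp.diff pn.diff)
  then show "maj (pp y - pn y) = maj y" by (simp add: majorant_def B_simps)
  show "B x (pp y - pn y) = B (pp x) (pp y) - B (pn x) (pn y)"
    by (subst B_decomp) (simp add: pp.diff pn.diff B_simps)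
qed

lemma B_flip_self: "B x (pp x - pn x) = maj x"
  by (simp add: B_flip majorant_def)

text \<open>Cauchy-Schwarz for the majorant, in additive form: the majorant is nonnegative at
  \<open>s *\<^sub>R x + z\<close> and \<open>(-s) *\<^sub>R x + z\<close>, where z is the reflected
  y. The parameter \<open>s\<close> decides how much of \<open>maj x\<close> is spent on the
  estimate.\<close>

lemma two_abs_B_le: assumes "s > 0" shows "2 * \<bar>B x y\<bar> \<le> s * maj x + maj y / s"
proof -
  define z where "z = pp y - pn y"
  have z: "maj z = maj y" "B x y = B (pp x) (pp z) - B (pn x) (pn z)"
    by (simp_all add: z_def maj_flip pp.diff pn.diff B_simps B_decomp[of x y])
  have "0 \<le> maj (s *\<^sub>R x + z)" "0 \<le> maj ((-s) *\<^sub>R x + z)" by (rule maj_nonneg)+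
  then have "2 * s * \<bar>B x y\<bar> \<le> s\<^sup>2 * maj x + maj y"
    unfolding maj_lincomb z by (auto simp: abs_if algebra_simps)
  then have "2 * s * \<bar>B x y\<bar> / s \<le> (s\<^sup>2 * maj x + maj y) / s"
    using assms by (intro divide_right_mono) auto
  then show ?thesis using assms by (simp add: add_divide_distrib power2_eq_square)
qed

lemma maj_add_le: "maj (x + y) \<le> 2 * maj x + 2 * maj y"
  using maj_lincomb[of 1 x y] maj_lincomb[of "-1" x y] maj_nonneg[of "(-1) *\<^sub>R x + y"] by simp

lemma maj_scale: "maj (r *\<^sub>R x) = r\<^sup>2 * maj x"
  using maj_lincomb[of r x 0] by (simp add: B_simps majorant_def)

section \<open>The lattice, its dual and the discriminant group\<close>

lemma lattice_basis:
  obtains E where "finite E" "independent E" "span E = UNIV" "L = int_span E"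
  using lattice unfolding even_lattice_def by blast

lemma B_lattice_Ints: "x \<in> L \<Longrightarrow> y \<in> L \<Longrightarrow> B x y \<in> \<int>"
  using lattice unfolding even_lattice_def by blast

lemma lattice_diff: assumes "x \<in> L" "y \<in> L" shows "x - y \<in> L"
proof -
  obtain E where E: "L = int_span E" using lattice_basis by metis
  obtain c d where "x = (\<Sum>e\<in>E. of_int (c e) *\<^sub>R e)" "y = (\<Sum>e\<in>E. of_int (d e) *\<^sub>R e)"
    using assms unfolding E int_span_def by blast
  then have "x - y = (\<Sum>e\<in>E. of_int (c e - d e) *\<^sub>R e)"
    by (simp add: sum_subtractf scaleR_left_diff_distrib)
  then show ?thesis unfolding E by (rule int_span_memI)
qed

lemma zero_in_lattice: "0 \<in> L"
proof -
  obtain E where E: "L = int_span E" using lattice_basis by metis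
  show ?thesis unfolding E by (rule int_span_memI[of _ "\<lambda>_. 0"]) simp
qed

lemma lattice_add: "x \<in> L \<Longrightarrow> y \<in> L \<Longrightarrow> x + y \<in> L"
  using lattice_diff[of x "0 - y"] lattice_diff[OF zero_in_lattice, of y] by simp

lemma disc_group_eq: "disc_group L B = lattice_coset L ` dl"
  by (auto simp: disc_group_def lattice_coset_def)

lemma self_in_coset: "x \<in> lattice_coset L x"
  unfolding lattice_coset_def using zero_in_lattice by force

lemma coset_eq: assumes "y \<in> lattice_coset L x" shows "lattice_coset L y = lattice_coset L x"
proof -
  obtain l where l: "l \<in> L" "y = l + x" using assms by (auto simp: lattice_coset_def)
  show ?thesis
  proof
    show "lattice_coset L y \<subseteq> lattice_coset L x"
      using l by (force simp: lattice_coset_def lattice_add add.assoc[symmetric])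
    show "lattice_coset L x \<subseteq> lattice_coset L y"
    proof
      fix z assume "z \<in> lattice_coset L x"
      then obtain m where "m \<in> L" "z = m + x" by (auto simp: lattice_coset_def)
      then show "z \<in> lattice_coset L y"
        unfolding lattice_coset_def using l lattice_diff[of m l] by (intro image_eqI[of _ _ "m - l"]) auto
    qed
  qed
qed

lemma coset_subset_dual: "x \<in> dl \<Longrightarrow> lattice_coset L x \<subseteq> dl"
  by (auto simp: lattice_coset_def dual_lattice_def B_simps B_lattice_Ints)

lemma in_disc_iff:
  assumes "\<gamma> \<in> disc_group L B" "x \<in> dl"
  shows "x \<in> \<gamma> \<longleftrightarrow> \<gamma> = lattice_coset L x"
  using assms coset_eq self_in_coset unfolding disc_group_eq by blast

lemma disc_subset_dual: "\<gamma> \<in> disc_group L B \<Longrightarrow> \<gamma> \<subseteq> dl"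
  using coset_subset_dual unfolding disc_group_eq by blast

text \<open>Pairing with a lattice basis gives integer coordinates on the dual lattice. They
  determine the vector: if all pairings of x - y vanish, so does the pairing with the reflection of
  x - y, which equals \<open>maj (x - y)\<close>. Finiteness of the discriminant group and
  convergence of the theta series both become statements about integer tuples.\<close>

lemma dual_lattice_embedding:
  obtains E where "finite E" "span E = UNIV" "L = int_span E" "E \<subseteq> L"
    "\<And>x e. x \<in> dl \<Longrightarrow> e \<in> E \<Longrightarrow> of_int \<lfloor>B x e\<rfloor> = B x e"
    "inj_on (\<lambda>x. restrict (\<lambda>e. \<lfloor>B x e\<rfloor>) E) dl"
proof -
  obtain E where E: "finite E" "span E = UNIV" "L = int_span E" using lattice_basis by metis
  have EL: "E \<subseteq> L" unfolding E(3) using int_span_base[OF E(1)] by (rule subsetI)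
  have int: "of_int \<lfloor>B x e\<rfloor> = B x e" if "x \<in> dl" "e \<in> E" for x e
  proof -
    have "B x e \<in> \<int>" using that EL unfolding dual_lattice_def by blast
    then show ?thesis by (rule of_int_floor)
  qed
  have "inj_on (\<lambda>x. restrict (\<lambda>e. \<lfloor>B x e\<rfloor>) E) dl"
  proof (rule inj_onI)
    fix x y assume xy: "x \<in> dl" "y \<in> dl" and eq: "restrict (\<lambda>e. \<lfloor>B x e\<rfloor>) E = restrict (\<lambda>e. \<lfloor>B y e\<rfloor>) E"
    have "B (x - y) e = 0" if "e \<in> E" for e
    proof -
      have "\<lfloor>B x e\<rfloor> = \<lfloor>B y e\<rfloor>" using fun_cong[OF eq, of e] that by simp
      then have "B x e = B y e" using int[OF xy(1) that] int[OF xy(2) that] by metis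
      then show ?thesis by (simp add: Bl.diff)
    qed
    then have zero: "B (x - y) w = 0" for w
      using linear_eq_0_on_span[OF Br.linear_axioms, of E "x - y" w] E(2) by simp
    from zero[of "pp (x - y) - pn (x - y)"] have "maj (x - y) = 0" unfolding B_flip_self .
    then have "x - y = 0" using maj_pos[of "x - y"] by (cases "x - y = 0") auto
    then show "x = y" by simp
  qed
  from that[OF E EL int this] show thesis .
qed

text \<open>Removing the integral parts of the coordinates moves every class into the fundamental
  cell, where the pairings with the basis are bounded by \<open>b\<close>. Only finitely many
  integer tuples lie in that box.\<close>

lemma finite_disc_group: "finite (disc_group L B)"
proof -
  obtain E where E: "finite E" "span E = UNIV" "L = int_span E" "E \<subseteq> L"
    "\<And>x e. x \<in> dl \<Longrightarrow> e \<in> E \<Longrightarrow> of_int \<lfloor>B x e\<rfloor> = B x e"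
    "inj_on (\<lambda>x. restrict (\<lambda>e. \<lfloor>B x e\<rfloor>) E) dl"
    using dual_lattice_embedding by blast
  define b where "b e' = (\<Sum>e\<in>E. \<bar>B e e'\<bar>)" for e'
  define T where "T = {x \<in> dl. \<forall>e\<in>E. \<bar>B x e\<bar> \<le> b e}"
  have "(\<lambda>x. restrict (\<lambda>e. \<lfloor>B x e\<rfloor>) E) ` T \<subseteq> (\<Pi>\<^sub>E e\<in>E. {\<lfloor>- b e\<rfloor>..\<lceil>b e\<rceil>})"
  proof
    fix f assume "f \<in> (\<lambda>x. restrict (\<lambda>e. \<lfloor>B x e\<rfloor>) E) ` T"
    then obtain x where x: "x \<in> T" "f = restrict (\<lambda>e. \<lfloor>B x e\<rfloor>) E" by blast
    have "\<lfloor>B x e\<rfloor> \<in> {\<lfloor>- b e\<rfloor>..\<lceil>b e\<rceil>}" if "e \<in> E" for e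
    proof -
      have "- b e \<le> B x e" "B x e \<le> b e" using x(1) that unfolding T_def by fastforce+
      then have "\<lfloor>- b e\<rfloor> \<le> \<lfloor>B x e\<rfloor>" "\<lfloor>B x e\<rfloor> \<le> \<lceil>b e\<rceil>" by linarith+
      then show ?thesis by simp
    qed
    then show "f \<in> (\<Pi>\<^sub>E e\<in>E. {\<lfloor>- b e\<rfloor>..\<lceil>b e\<rceil>})" unfolding x(2) by auto
  qed
  then have "finite ((\<lambda>x. restrict (\<lambda>e. \<lfloor>B x e\<rfloor>) E) ` T)"
    by (rule finite_subset) (intro finite_PiE E, auto)
  then have "finite T"
    by (rule finite_imageD) (rule inj_on_subset[OF E(6)], auto simp: T_def)
  moreover have "disc_group L B \<subseteq> lattice_coset L ` T"
  proof
    fix \<gamma> assume "\<gamma> \<in> disc_group L B"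
    then obtain x where x: "x \<in> dl" "\<gamma> = lattice_coset L x" unfolding disc_group_eq by blast
    have "x \<in> span E" using E(2) by simp
    then obtain r where r: "x = (\<Sum>e\<in>E. r e *\<^sub>R e)" using span_finite[OF E(1)] by auto
    define l where "l = (\<Sum>e\<in>E. of_int (- \<lfloor>r e\<rfloor>) *\<^sub>R e)"
    have l: "l \<in> L" unfolding E(3) by (rule int_span_memI[of _ "\<lambda>e. - \<lfloor>r e\<rfloor>"]) (simp add: l_def)
    define y where "y = l + x"
    have yc: "y \<in> lattice_coset L x" using l by (auto simp: lattice_coset_def y_def)
    then have "y \<in> dl" using coset_subset_dual x by blast
    moreover have "\<bar>B y e'\<bar> \<le> b e'" for e'
    proof -
      have "y = (\<Sum>e\<in>E. (of_int (- \<lfloor>r e\<rfloor>) + r e) *\<^sub>R e)"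
        by (simp only: y_def l_def r sum.distrib scaleR_add_left)
      also have "\<dots> = (\<Sum>e\<in>E. frac (r e) *\<^sub>R e)" by (simp add: frac_def)
      finally have "y = (\<Sum>e\<in>E. frac (r e) *\<^sub>R e)" .
      then have "\<bar>B y e'\<bar> = \<bar>\<Sum>e\<in>E. frac (r e) * B e e'\<bar>" by (simp add: Bl.sum Bl.scale)
      also have "\<dots> \<le> (\<Sum>e\<in>E. \<bar>frac (r e) * B e e'\<bar>)" by (rule sum_abs)
      also have "\<dots> \<le> b e'" unfolding b_def
        by (intro sum_mono) (auto simp: abs_mult intro!: mult_left_le_one_le less_imp_le[OF frac_lt_1])
      finally show ?thesis .
    qed
    ultimately have "y \<in> T" by (auto simp: T_def)
    then show "\<gamma> \<in> lattice_coset L ` T" using coset_eq[OF yc] x by blast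
  qed
  ultimately show ?thesis by (meson finite_surj)
qed

text \<open>The Gaussian is compared with exp of minus the sum of the
  \<open>\<bar>B x e\<bar>\<close>, which is a product of geometric series in the integer
  coordinates.\<close>

lemma summable_exp_majorant:
  assumes "a > 0"
  shows "(\<lambda>x. exp (- (a * maj x))) summable_on dl"
proof -
  obtain E where E: "finite E" "span E = UNIV" "L = int_span E" "E \<subseteq> L"
    "\<And>x e. x \<in> dl \<Longrightarrow> e \<in> E \<Longrightarrow> of_int \<lfloor>B x e\<rfloor> = B x e"
    "inj_on (\<lambda>x. restrict (\<lambda>e. \<lfloor>B x e\<rfloor>) E) dl"
    using dual_lattice_embedding by blast
  let ?f = "\<lambda>x. restrict (\<lambda>e. \<lfloor>B x e\<rfloor>) E"
  let ?g = "\<lambda>\<phi>. \<Prod>e\<in>E. exp (- \<bar>of_int (\<phi> e) :: real\<bar>)"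
  have "?g summable_on (E \<rightarrow>\<^sub>E UNIV)"
    using E(1) summable_on_exp_neg_abs_int by (intro summable_on_prod_PiE_nonneg) auto
  then have "?g summable_on (?f ` dl)"
    by (rule summable_on_subset) auto
  then have "(?g \<circ> ?f) summable_on dl"
    by (simp only: summable_on_reindex[OF E(6)])
  \<comment> \<open>Chosen so that the \<open>card E\<close> estimates, each spending
    \<open>s / 2 * maj x\<close>, stay within \<open>a * maj x\<close>. The summand 1 keeps the
    quotient meaningful in rank 0; \<open>C\<close> collects the parts independent of x.\<close>
  define s where "s = 2 * a / (real (card E) + 1)"
  define C where "C = (\<Sum>e\<in>E. maj e / s / 2)"
  have s: "s > 0" using assms by (simp add: s_def field_simps)
  have "(\<lambda>x. exp C * (?g \<circ> ?f) x) summable_on dl"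
    by (intro summable_on_cmult_right) fact
  then show ?thesis
  proof (rule summable_on_comparison_test)
    fix x assume x: "x \<in> dl"
    have "(\<Sum>e\<in>E. \<bar>B x e\<bar>) \<le> (\<Sum>e\<in>E. s / 2 * maj x + maj e / s / 2)"
      using two_abs_B_le[OF s, of x] by (intro sum_mono) (simp add: field_simps)
    also have "\<dots> = real (card E) * (s / 2) * maj x + C"
      by (simp add: sum.distrib C_def)
    also have "\<dots> \<le> a * maj x + C"
    proof -
      have "real (card E) * (s / 2) \<le> a" using assms by (simp add: s_def field_simps)
      from mult_right_mono[OF this maj_nonneg[of x]] show ?thesis by simp
    qed
    finally have "exp (- (a * maj x)) \<le> exp (C + (\<Sum>e\<in>E. - \<bar>B x e\<bar>))" by (simp add: sum_negf)
    also have "\<dots> = exp C * (\<Prod>e\<in>E. exp (- \<bar>B x e\<bar>))"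
      using E(1) by (simp add: exp_add exp_sum)
    also have "(\<Prod>e\<in>E. exp (- \<bar>B x e\<bar>)) = (\<Prod>e\<in>E. exp (- \<bar>of_int \<lfloor>B x e\<rfloor> :: real\<bar>))"
      by (rule prod.cong) (simp_all only: E(5)[OF x])
    also have "exp C * \<dots> = exp C * (?g \<circ> ?f) x" by simp
    finally show "exp (- (a * maj x)) \<le> exp C * (?g \<circ> ?f) x" .
  qed simp
qed

end

section \<open>Theta functions and the heat operator\<close>

lemma e2pi_add: "e2pi (a + b) = e2pi a * e2pi b"
  by (simp add: e2pi_def algebra_simps exp_add)

lemma norm_e2pi: "norm (e2pi w) = exp (- (2 * pi * Im w))"
  by (simp add: e2pi_def)

lemma e2pi_nonzero [simp]: "e2pi w \<noteq> 0"
  by (simp add: e2pi_def)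

lemma e2pi_half: "e2pi (1/2) = -1"
  by (simp add: e2pi_def)

lemma has_derivative_e2pi:
  assumes "(g has_derivative g') (at x)"
  shows "((\<lambda>x. e2pi (g x)) has_derivative (\<lambda>h. 2 * of_real pi * \<i> * g' h * e2pi (g x))) (at x)"
proof -
  have "(e2pi has_field_derivative 2 * of_real pi * \<i> * e2pi (g x)) (at (g x))"
    unfolding e2pi_def by (auto intro!: derivative_eq_intros)
  from has_derivative_compose[OF assms this[unfolded has_field_derivative_def]]
  show ?thesis by (simp add: mult_ac)
qed

lemma square_le_exp:
  fixes c :: real assumes "c > 0"
  shows "\<exists>K. \<forall>t\<ge>0. (1 + t)\<^sup>2 \<le> K * exp (c * t)"
proof -
  \<comment> \<open>Both bounds on \<open>m\<close> serve
    \<open>m * (1 + t) \<le> 1 + c / 2 * t\<close>, whose right-hand side is at most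
    \<open>exp (c / 2 * t)\<close>; squaring gives the claim.\<close>
  define m where "m = min 1 (c / 2)"
  have m: "m > 0" "m \<le> 1" "m \<le> c / 2" using assms by (auto simp: m_def)
  have "(1 + t)\<^sup>2 \<le> (1 / m\<^sup>2) * exp (c * t)" if "t \<ge> 0" for t
  proof -
    have "m * t \<le> c / 2 * t" using m that by (intro mult_right_mono) auto
    then have "m * (1 + t) \<le> 1 + c / 2 * t" using m by (simp add: algebra_simps)
    also have "\<dots> \<le> exp (c / 2 * t)" by (rule exp_ge_add_one_self)
    finally have "(m * (1 + t))\<^sup>2 \<le> (exp (c / 2 * t))\<^sup>2" using m that by (intro power_mono) auto
    also have "\<dots> = exp (c * t)" by (simp add: power2_eq_square exp_add[symmetric])
    finally have "(1 + t)\<^sup>2 * m\<^sup>2 \<le> exp (c * t)" unfolding power_mult_distrib mult.commute[of "m\<^sup>2"] .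
    then have "(1 + t)\<^sup>2 \<le> exp (c * t) / m\<^sup>2" by (rule mult_imp_le_div_pos[rotated]) (use m in simp)
    then show ?thesis by (simp only: times_divide_eq_left mult_1_left)
  qed
  then show ?thesis by blast
qed

text \<open>Cauchy-Riemann: \<open>dbar\<close> is the coefficient of \<open>cnj h\<close> in the
  real derivative, so it vanishes exactly when that derivative is complex linear.\<close>

lemma dbar_eq_0_iff:
  assumes "f differentiable (at \<tau>)"
  shows "dbar f \<tau> = 0 \<longleftrightarrow> f field_differentiable (at \<tau>)"
proof
  let ?D = "frechet_derivative f (at \<tau>)"
  have D: "(f has_derivative ?D) (at \<tau>)" using assms frechet_derivative_works by blast
  then interpret D: bounded_linear ?D by (rule has_derivative_bounded_linear)
  assume "dbar f \<tau> = 0"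
  then have "\<i> * (?D 1 + \<i> * ?D \<i>) = 0" by (simp add: dbar_def)
  then have i: "?D \<i> = \<i> * ?D 1" by (simp add: algebra_simps)
  have "?D h = ?D 1 * h" for h
  proof -
    have "h = Re h *\<^sub>R 1 + Im h *\<^sub>R \<i>" by (rule complex_eqI) simp_all
    then have "?D h = ?D (Re h *\<^sub>R 1 + Im h *\<^sub>R \<i>)" by (rule arg_cong[of _ _ ?D])
    also have "\<dots> = ?D 1 * h"
      unfolding D.add D.scaleR i by (simp add: complex_eq_iff)
    finally show ?thesis .
  qed
  then have "?D = (*) (?D 1)" by (rule ext)
  with D have "(f has_field_derivative ?D 1) (at \<tau>)" unfolding has_field_derivative_def by metis
  then show "f field_differentiable (at \<tau>)" by (auto simp: field_differentiable_def)
next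
  assume "f field_differentiable (at \<tau>)"
  then obtain c where "(f has_derivative (*) c) (at \<tau>)"
    by (auto simp: field_differentiable_def has_field_derivative_def)
  then have "frechet_derivative f (at \<tau>) = (*) c" by (rule frechet_derivative_at[symmetric])
  then show "dbar f \<tau> = 0" by (simp add: dbar_def complex_eq_iff)
qed

context lattice_with_splitting
begin

section \<open>Orthonormal bases of the negative part\<close>

lemma bilinear_neg_form: "bilinear (neg_form B)"
  unfolding bilinear_def neg_form_def
  using Bl.linear_axioms Br.linear_axioms by (auto intro: linear_compose_neg)

text \<open>Ensures that the basis chosen by \<open>SOME\<close> in the holomorphic Laplacian is a
  genuine one.\<close>

lemma neg_orthonormal_basis_exists: "\<exists>E. neg_orthonormal_basis B v E"
proof -
  obtain E0 :: "'v set" where E0: "finite E0" "span E0 = UNIV" using lattice_basis by metis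
  obtain C where C: "C \<subseteq> snd v" "independent C" "snd v \<subseteq> span C"
    using maximal_independent_subset[of "snd v"] by metis
  have finC: "finite C" using independent_span_bound[OF E0(1) C(2)] unfolding E0(2) by blast
  have spanC: "span C = snd v" using C span_minimal[OF C(1) subspace_neg] by blast
  have "neg_form B x y = neg_form B y x" for x y unfolding neg_form_def B_sym[of x y] ..
  from orthonormal_basis_exists[OF bilinear_neg_form this finC] pos_def_neg
  obtain E where E: "finite E" "span E = span C"
    "\<And>e e'. e \<in> E \<Longrightarrow> e' \<in> E \<Longrightarrow> neg_form B e e' = (if e = e' then 1 else 0)"
    unfolding spanC by blast
  have BE: "B e e' = (if e = e' then -1 else 0)" if "e \<in> E" "e' \<in> E" for e e'
    using E(3)[OF that] unfolding neg_form_def by (cases "e = e'") simp_all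
  have "independent E"
  proof (rule independent_if_scalars_zero[OF E(1)])
    fix f x assume sum0: "(\<Sum>x\<in>E. f x *\<^sub>R x) = 0" and x: "x \<in> E"
    have "0 = B (\<Sum>x\<in>E. f x *\<^sub>R x) x" unfolding sum0 by (simp add: B_simps)
    also have "\<dots> = (\<Sum>y\<in>E. f y * B y x)" by (simp add: Bl.sum Bl.scale)
    also have "\<dots> = (\<Sum>y\<in>E. if y = x then - f x else 0)"
      using BE x by (intro sum.cong) auto
    also have "\<dots> = - f x" using E(1) x by simp
    finally show "f x = 0" by simp
  qed
  have "neg_orthonormal_basis B v E"
    unfolding neg_orthonormal_basis_def E(2) spanC
    by (intro conjI ballI E(1) \<open>independent E\<close> BE refl)
  then show ?thesis by blast
qed

text \<open>The coefficients carry a minus sign because \<open>B e e = -1\<close>. The difference of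
  the two sides lies in \<open>snd v\<close> and is orthogonal to it, and \<open>B\<close> is
  definite there.\<close>

lemma proj_neg_expansion:
  assumes "neg_orthonormal_basis B v E"
  shows "pn x = (\<Sum>e\<in>E. (- B x e) *\<^sub>R e)"
proof -
  have E: "finite E" "span E = snd v" "\<And>e e'. e \<in> E \<Longrightarrow> e' \<in> E \<Longrightarrow> B e e' = (if e = e' then -1 else 0)"
    using assms unfolding neg_orthonormal_basis_def by auto
  have Ein: "e \<in> snd v" if "e \<in> E" for e using span_base[OF that] unfolding E(2) .
  define y where "y = pn x - (\<Sum>e\<in>E. (- B x e) *\<^sub>R e)"
  have yN: "y \<in> snd v" unfolding y_def
    by (intro subspace_diff[OF subspace_neg] subspace_sum[OF subspace_neg] subspace_scale[OF subspace_neg])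
      (auto intro: Ein)
  have ye: "B y e = 0" if "e \<in> E" for e
  proof -
    have "B y e = B (pn x) e + (\<Sum>e'\<in>E. B x e' * B e' e)"
      by (simp add: y_def B_simps Bl.sum sum_negf)
    also have "(\<Sum>e'\<in>E. B x e' * B e' e) = (\<Sum>e'\<in>E. if e' = e then - B x e else 0)"
      using E(3) that by (intro sum.cong) auto
    also have "\<dots> = - B x e" using E(1) that by simp
    finally show ?thesis using B_neg[OF Ein[OF that]] by simp
  qed
  have "B y y = 0"
    using linear_eq_0_on_span[OF Br.linear_axioms ye, of E y] yN unfolding E(2) by simp
  then have "y = 0" using pos_def_neg yN unfolding pos_def_on_def neg_form_def by (metis less_irrefl neg_equal_0_iff_equal)
  then show ?thesis by (simp add: y_def)
qed

text \<open>Parseval on the negative part. This is the identity by which the Laplacian of a theta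
  term matches its derivative in the conjugate of \<tau>.\<close>

lemma sum_B_neg_orthonormal_sq:
  assumes "neg_orthonormal_basis B v E"
  shows "(\<Sum>e\<in>E. (B x e)\<^sup>2) = - B (pn x) (pn x)"
proof -
  have Ein: "e \<in> snd v" if "e \<in> E" for e
    using span_base[OF that] assms unfolding neg_orthonormal_basis_def by blast
  have "B (pn x) (pn x) = B (pn x) (\<Sum>e\<in>E. (- B x e) *\<^sub>R e)"
    using proj_neg_expansion[OF assms, of x] by simp
  also have "\<dots> = - (\<Sum>e\<in>E. B x e * B (pn x) e)"
    by (simp add: Br.sum B_simps sum_negf)
  also have "\<dots> = - (\<Sum>e\<in>E. (B x e)\<^sup>2)"
    by (simp add: power2_eq_square B_neg[OF Ein, symmetric])
  finally show ?thesis by simp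
qed

text \<open>Sylvester's law of inertia: \<open>pn\<close> is injective on any negative definite
  subspace, since a vector in its kernel lies in \<open>fst v\<close>, where \<open>B\<close> is
  positive. Hence no such subspace has dimension above that of \<open>snd v\<close>.\<close>

lemma card_neg_orthonormal_basis:
  assumes "neg_orthonormal_basis B v E"
  shows "card E = snd (signature B)"
proof -
  have E: "finite E" "independent E" "span E = snd v"
    using assms unfolding neg_orthonormal_basis_def by auto
  have "Max {dim W | W. subspace W \<and> pos_def_on (neg_form B) W} = card E"
  proof (rule Max_eqI)
    have le: "dim W \<le> card E" if W: "subspace W" "pos_def_on (neg_form B) W" for W
    proof -
      obtain C where C: "C \<subseteq> W" "independent C" "W \<subseteq> span C" "card C = dim W"
        using basis_exists[of W] by metis
      have spanC: "span C \<subseteq> W" using span_minimal[OF C(1) W(1)] .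
      have inj: "inj_on pn (span C)"
      proof (subst linear_injective_on_subspace_0[OF linear_proj_neg subspace_span], intro ballI impI)
        fix x assume x: "x \<in> span C" "pn x = 0"
        then have "pp x = x" using proj_sum[of x] by simp
        then have xP: "x \<in> fst v" by (metis proj_pos_in)
        show "x = 0"
        proof (rule ccontr)
          assume "x \<noteq> 0"
          then have "B x x > 0" using xP pos_def_pos unfolding pos_def_on_def by blast
          moreover have "neg_form B x x > 0" using x spanC W(2) \<open>x \<noteq> 0\<close> unfolding pos_def_on_def by blast
          ultimately show False by (simp add: neg_form_def)
        qed
      qed
      have "independent (pn ` C)"
        by (rule linear_independent_injective_image[OF linear_proj_neg C(2) inj])
      moreover have "pn ` C \<subseteq> span E" unfolding E(3) by (rule image_subsetI) (rule proj_neg_in)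
      ultimately have "card (pn ` C) \<le> card E" using independent_span_bound[OF E(1)] by blast
      moreover have "card (pn ` C) = card C"
        by (rule card_image) (rule inj_on_subset[OF inj span_superset])
      ultimately show ?thesis using C(4) by simp
    qed
    show "finite {dim W | W. subspace W \<and> pos_def_on (neg_form B) W}"
      by (rule finite_subset[of _ "{..card E}"]) (use le in auto)
    show "y \<le> card E" if "y \<in> {dim W | W. subspace W \<and> pos_def_on (neg_form B) W}" for y
      using that le by blast
    have "dim (snd v) = card E" using E(2,3) dim_span_eq_card_independent by metis
    then show "card E \<in> {dim W | W. subspace W \<and> pos_def_on (neg_form B) W}"
      using subspace_neg pos_def_neg by (metis (mono_tags, lifting) mem_Collect_eq)
  qed
  then show ?thesis by (simp add: signature_def pos_index_def)
qed

section \<open>Bounds for theta terms and derivatives in the elliptic variable\<close>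

abbreviation "th x \<equiv> theta_term B v x"

lemma cform_cx: "cform B (cx x) \<zeta> = Complex (B x (fst \<zeta>)) (B x (snd \<zeta>))"
  by (simp add: cform_def cx_def B_simps)

lemma cform_cx_line: "cform B (cx x) (\<zeta> + cscale w (cx e)) = cform B (cx x) \<zeta> + w * of_real (B x e)"
  unfolding cform_cx by (simp add: cscale_def cx_def B_simps complex_eq_iff)

text \<open>The conjugate of \<tau> in front of the negative part is what replaces the indefinite
  form by the majorant.\<close>

lemma norm_theta_term: "norm (th x \<tau> \<zeta>) = exp (- (pi * Im \<tau> * maj x) - 2 * pi * B x (snd \<zeta>))"
  by (simp add: theta_term_def norm_e2pi cform_cx majorant_def algebra_simps)

text \<open>One summable bound serves a whole half-plane in \<tau> and a region of bounded imaginary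
  part in \<zeta>. The factor \<open>(1 + maj x)\<^sup>2\<close> leaves room for two derivatives in
  \<zeta> or one in \<tau>.\<close>

lemma theta_term_dominated:
  assumes "a > 0"
  obtains M where "M summable_on dl" "\<And>x. 0 \<le> M x"
    "\<And>\<tau> \<zeta> x. a \<le> Im \<tau> \<Longrightarrow> maj (snd \<zeta>) \<le> R \<Longrightarrow> (1 + maj x)\<^sup>2 * norm (th x \<tau> \<zeta>) \<le> M x"
proof -
  \<comment> \<open>The available decay is \<open>pi * a * maj x\<close> in the exponent. Half of it
    absorbs the linear term in \<open>snd \<zeta>\<close>, a quarter absorbs the polynomial weight,
    and the last quarter keeps \<open>M\<close> summable.\<close>
  obtain K where K: "\<And>t. t \<ge> 0 \<Longrightarrow> (1 + t)\<^sup>2 \<le> K * exp ((pi * a / 4) * t)"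
    using square_le_exp[of "pi * a / 4"] assms by auto
  have K0: "0 \<le> K" using K[of 0] by simp
  define M where "M x = K * exp (2 * pi * R / a) * exp (- ((pi * a / 4) * maj x))" for x
  have "M summable_on dl" unfolding M_def
    by (intro summable_on_cmult_right summable_exp_majorant) (use assms in auto)
  moreover have "0 \<le> M x" for x using K0 by (simp add: M_def)
  moreover have "(1 + maj x)\<^sup>2 * norm (th x \<tau> \<zeta>) \<le> M x" if "a \<le> Im \<tau>" "maj (snd \<zeta>) \<le> R" for \<tau> \<zeta> x
  proof -
    have "2 * \<bar>B x (snd \<zeta>)\<bar> \<le> a / 2 * maj x + maj (snd \<zeta>) / (a / 2)"
      using assms by (intro two_abs_B_le) auto
    also have "\<dots> \<le> a / 2 * maj x + R / (a / 2)"
      using that assms by (intro add_left_mono divide_right_mono) auto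
    finally have "pi * (2 * \<bar>B x (snd \<zeta>)\<bar>) \<le> pi * (a / 2 * maj x + R / (a / 2))"
      by (intro mult_left_mono) auto
    also have "\<dots> = pi * a * maj x / 2 + 2 * pi * R / a" using assms by (simp add: field_simps)
    finally have "pi * (2 * \<bar>B x (snd \<zeta>)\<bar>) \<le> pi * a * maj x / 2 + 2 * pi * R / a" .
    moreover have "pi * a * maj x \<le> pi * Im \<tau> * maj x"
      using that maj_nonneg[of x] by (intro mult_right_mono) auto
    moreover have "- (2 * pi * B x (snd \<zeta>)) \<le> pi * (2 * \<bar>B x (snd \<zeta>)\<bar>)"
      using mult_left_mono[of "- B x (snd \<zeta>)" "\<bar>B x (snd \<zeta>)\<bar>" "2 * pi"] by simp
    ultimately have "- (2 * pi * B x (snd \<zeta>)) \<le> pi * a * maj x / 2 + 2 * pi * R / a"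
      "pi * a * maj x \<le> pi * Im \<tau> * maj x" by (blast intro: order_trans)+
    then have "- (pi * Im \<tau> * maj x) - 2 * pi * B x (snd \<zeta>) \<le> 2 * pi * R / a - pi * a * maj x / 2"
      by linarith
    then have "norm (th x \<tau> \<zeta>) \<le> exp (2 * pi * R / a - pi * a * maj x / 2)"
      unfolding norm_theta_term by simp
    then have "(1 + maj x)\<^sup>2 * norm (th x \<tau> \<zeta>)
        \<le> K * exp ((pi * a / 4) * maj x) * exp (2 * pi * R / a - pi * a * maj x / 2)"
      using K[OF maj_nonneg] K0 by (intro mult_mono) auto
    also have "\<dots> = M x" by (simp add: M_def exp_add[symmetric] algebra_simps)
    finally show ?thesis .
  qed
  ultimately show thesis by (rule that)
qed

lemma theta_abs_summable:
  assumes "Im \<tau> > 0" "\<And>x. x \<in> dl \<Longrightarrow> norm (p x) \<le> C * (1 + maj x)\<^sup>2"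
  shows "(\<lambda>x. norm (p x * th x \<tau> \<zeta>)) summable_on dl"
proof -
  obtain M where M: "M summable_on dl" "\<And>x. 0 \<le> M x"
    "\<And>t z x. Im \<tau> \<le> Im t \<Longrightarrow> maj (snd z) \<le> maj (snd \<zeta>) \<Longrightarrow> (1 + maj x)\<^sup>2 * norm (th x t z) \<le> M x"
    using theta_term_dominated[OF assms(1), of "maj (snd \<zeta>)"] by blast
  have "(\<lambda>x. \<bar>C\<bar> * M x) summable_on dl" by (intro summable_on_cmult_right M)
  then show ?thesis
  proof (rule summable_on_comparison_test)
    fix x assume x: "x \<in> dl"
    have "norm (p x * th x \<tau> \<zeta>) \<le> (\<bar>C\<bar> * (1 + maj x)\<^sup>2) * norm (th x \<tau> \<zeta>)"
      unfolding norm_mult using assms(2)[OF x] mult_right_mono[OF abs_ge_self[of C] zero_le_power2[of "1 + maj x"]]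
      by (intro mult_right_mono) auto
    also have "\<dots> \<le> \<bar>C\<bar> * M x"
      using mult_left_mono[OF M(3)[of \<tau> \<zeta> x], of "\<bar>C\<bar>"] by (simp add: mult.assoc)
    finally show "norm (p x * th x \<tau> \<zeta>) \<le> \<bar>C\<bar> * M x" .
  qed simp
qed

lemma abs_B_le: "\<bar>B x e\<bar> \<le> (1 + maj e) * (1 + maj x)"
proof -
  have "2 * \<bar>B x e\<bar> \<le> maj x + maj e" using two_abs_B_le[of 1 x e] by simp
  moreover have "0 \<le> maj e * maj x" by (simp add: maj_nonneg)
  moreover have "(1 + maj e) * (1 + maj x) = 1 + maj e + maj x + maj e * maj x" by (simp add: algebra_simps)
  ultimately show ?thesis using maj_nonneg[of x] maj_nonneg[of e] by linarith
qed

lemma le_abs_majorant: "r \<le> C * (1 + maj x) \<Longrightarrow> r \<le> \<bar>C\<bar> * (1 + maj x)"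
  by (erule order_trans) (intro mult_right_mono, auto simp: maj_nonneg)

text \<open>Each differentiation along e multiplies a coefficient by
  \<open>2 * pi * \<i> * B x e\<close>, which grows at most linearly in \<open>maj x\<close>.
  Admitting linearly growing coefficients \<open>p\<close> allows the lemma to be applied twice to
  bounded ones.\<close>

lemma theta_line_derivative:
  assumes \<tau>: "Im \<tau> > 0" and p: "\<And>x. x \<in> dl \<Longrightarrow> norm (p x) \<le> C * (1 + maj x)"
  shows "((\<lambda>w. \<Sum>\<^sub>\<infinity>x\<in>dl. p x * th x \<tau> (\<zeta> + cscale w (cx e))) has_field_derivative
           (\<Sum>\<^sub>\<infinity>x\<in>dl. p x * (2 * of_real pi * \<i> * of_real (B x e)) * th x \<tau> \<zeta>)) (at 0)"
proof -
  \<comment> \<open>Bounds the majorant of the imaginary part of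
    \<open>\<zeta> + cscale w (cx e)\<close> for w in the unit disc, by
    \<open>maj_add_le\<close>.\<close>
  let ?R = "2 * maj (snd \<zeta>) + 2 * maj e"
  let ?f = "\<lambda>x w. p x * th x \<tau> (\<zeta> + cscale w (cx e))"
  let ?q = "\<lambda>x. p x * (2 * of_real pi * \<i> * of_real (B x e))"
  let ?f' = "\<lambda>x w h. ?q x * th x \<tau> (\<zeta> + cscale w (cx e)) * h"
  obtain M where M: "M summable_on dl" "\<And>x. 0 \<le> M x"
    "\<And>t z x. Im \<tau> \<le> Im t \<Longrightarrow> maj (snd z) \<le> ?R \<Longrightarrow> (1 + maj x)\<^sup>2 * norm (th x t z) \<le> M x"
    using theta_term_dominated[OF \<tau>, of ?R] by blast
  define K where "K = \<bar>C\<bar> * (2 * pi * (1 + maj e))"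
  have K0: "0 \<le> K" by (simp add: K_def maj_nonneg)
  have q: "norm (?q x) \<le> K * (1 + maj x)\<^sup>2" if "x \<in> dl" for x
  proof -
    have "norm (p x) \<le> \<bar>C\<bar> * (1 + maj x)"
      by (rule le_abs_majorant[OF p[OF that]])
    moreover have "2 * pi * \<bar>B x e\<bar> \<le> 2 * pi * ((1 + maj e) * (1 + maj x))"
      using abs_B_le by (intro mult_left_mono) auto
    ultimately have "norm (p x) * (2 * pi * \<bar>B x e\<bar>) \<le> \<bar>C\<bar> * (1 + maj x) * (2 * pi * ((1 + maj e) * (1 + maj x)))"
      using maj_nonneg[of x] by (intro mult_mono) auto
    moreover have "norm (?q x) = norm (p x) * (2 * pi * \<bar>B x e\<bar>)" by (simp add: norm_mult)
    ultimately show ?thesis by (simp only: K_def power2_eq_square mult_ac)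
  qed
  have "((\<lambda>w. \<Sum>\<^sub>\<infinity>x\<in>dl. ?f x w) has_derivative (\<lambda>h. \<Sum>\<^sub>\<infinity>x\<in>dl. ?f' x 0 h)) (at 0)"
  proof (rule has_derivative_infsum[of "ball 0 1" _ dl ?f ?f' "\<lambda>x. K * M x"])
    fix x w assume x: "x \<in> dl" and w: "w \<in> ball (0::complex) 1"
    show "(?f x has_derivative ?f' x w) (at w)"
      unfolding theta_term_def cform_cx_line e2pi_def has_field_derivative_def[symmetric]
      by (auto intro!: derivative_eq_intros simp: algebra_simps)
    fix h
    have "maj (snd (\<zeta> + cscale w (cx e))) \<le> 2 * maj (snd \<zeta>) + 2 * ((Im w)\<^sup>2 * maj e)"
      using maj_add_le[of "snd \<zeta>" "Im w *\<^sub>R e"] by (simp add: cscale_def cx_def maj_scale)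
    also have "(Im w)\<^sup>2 * maj e \<le> 1 * maj e"
      using w abs_Im_le_cmod[of w] maj_nonneg[of e] by (intro mult_right_mono) (auto simp: abs_square_le_1)
    finally have "(1 + maj x)\<^sup>2 * norm (th x \<tau> (\<zeta> + cscale w (cx e))) \<le> M x"
      by (intro M(3)) auto
    then have "K * ((1 + maj x)\<^sup>2 * norm (th x \<tau> (\<zeta> + cscale w (cx e)))) \<le> K * M x"
      using K0 by (rule mult_left_mono)
    moreover have "norm (?q x) * norm (th x \<tau> (\<zeta> + cscale w (cx e)))
        \<le> K * (1 + maj x)\<^sup>2 * norm (th x \<tau> (\<zeta> + cscale w (cx e)))"
      using q[OF x] by (intro mult_right_mono) auto
    ultimately have "norm (?q x * th x \<tau> (\<zeta> + cscale w (cx e))) \<le> K * M x"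
      unfolding norm_mult[of "?q x"] by (simp add: mult.assoc)
    then show "norm (?f' x w h) \<le> K * M x * norm h"
      unfolding norm_mult[of _ h] by (rule mult_right_mono) simp
  next
    show "(\<lambda>x. ?f x w) summable_on dl" for w
    proof (rule abs_summable_summable, rule theta_abs_summable[OF \<tau>])
      fix x assume "x \<in> dl"
      have "norm (p x) \<le> \<bar>C\<bar> * (1 + maj x)"
        by (rule le_abs_majorant[OF p[OF \<open>x \<in> dl\<close>]])
      also have "\<dots> \<le> \<bar>C\<bar> * (1 + maj x)\<^sup>2"
        using maj_nonneg[of x] by (intro mult_left_mono self_le_power) auto
      finally show "norm (p x) \<le> \<bar>C\<bar> * (1 + maj x)\<^sup>2" .
    qed
  qed (use M K0 in \<open>auto intro: summable_on_cmult_right\<close>)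
  moreover have "(\<lambda>h. \<Sum>\<^sub>\<infinity>x\<in>dl. ?f' x 0 h) = (*) (\<Sum>\<^sub>\<infinity>x\<in>dl. ?q x * th x \<tau> \<zeta>)"
    by (rule ext) (simp add: infsum_cmult_left' cscale_def zero_prod_def[symmetric])
  ultimately show ?thesis unfolding has_field_derivative_def by simp
qed

lemma holo_pderiv_theta:
  assumes "Im \<tau> > 0" "\<And>x. x \<in> dl \<Longrightarrow> norm (p x) \<le> C * (1 + maj x)"
  shows "holo_pderiv e (\<lambda>\<zeta>. \<Sum>\<^sub>\<infinity>x\<in>dl. p x * th x \<tau> \<zeta>) =
    (\<lambda>\<zeta>. \<Sum>\<^sub>\<infinity>x\<in>dl. p x * (2 * of_real pi * \<i> * of_real (B x e)) * th x \<tau> \<zeta>)"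
  unfolding holo_pderiv_def by (rule ext) (rule DERIV_imp_deriv[OF theta_line_derivative[OF assms]])

lemma holo_laplacian_neg_theta:
  assumes \<tau>: "Im \<tau> > 0" and c: "\<And>x. x \<in> dl \<Longrightarrow> norm (c x) \<le> C"
  shows "((\<lambda>x. - 4 * of_real (pi\<^sup>2 * B (pn x) (pn x)) * c x * th x \<tau> \<zeta>) has_sum
    holo_laplacian_neg B v (\<lambda>\<zeta>. \<Sum>\<^sub>\<infinity>x\<in>dl. c x * th x \<tau> \<zeta>) \<zeta>) dl"
proof -
  define E where "E = (SOME E. neg_orthonormal_basis B v E)"
  have E: "neg_orthonormal_basis B v E"
    unfolding E_def using neg_orthonormal_basis_exists by (rule someI_ex)
  then have finE: "finite E" unfolding neg_orthonormal_basis_def by blast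
  let ?d = "\<lambda>e x. 2 * of_real pi * \<i> * of_real (B x e) :: complex"
  \<comment> \<open>\<open>c1\<close> and \<open>c2\<close> are the growth conditions for the first
    and the second differentiation.\<close>
  have c1: "norm (c x) \<le> \<bar>C\<bar> * (1 + maj x)" if "x \<in> dl" for x
    using c[OF that] mult_left_mono[of 1 "1 + maj x" "\<bar>C\<bar>"] maj_nonneg[of x] by auto
  have c2: "norm (c x * ?d e x) \<le> \<bar>C\<bar> * (2 * pi * (1 + maj e)) * (1 + maj x)" if "x \<in> dl" for x e
  proof -
    have "norm (c x) * (2 * pi * \<bar>B x e\<bar>) \<le> \<bar>C\<bar> * (2 * pi * ((1 + maj e) * (1 + maj x)))"
      using c[OF that] abs_B_le[of x e] by (intro mult_mono) auto
    moreover have "norm (c x * ?d e x) = norm (c x) * (2 * pi * \<bar>B x e\<bar>)" by (simp add: norm_mult)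
    ultimately show ?thesis by (simp only: mult.assoc)
  qed
  have s: "((\<lambda>x. c x * ?d e x * ?d e x * th x \<tau> \<zeta>) has_sum
      holo_pderiv e (holo_pderiv e (\<lambda>\<zeta>. \<Sum>\<^sub>\<infinity>x\<in>dl. c x * th x \<tau> \<zeta>)) \<zeta>) dl" for e
  proof -
    have "holo_pderiv e (\<lambda>\<zeta>. \<Sum>\<^sub>\<infinity>x\<in>dl. c x * th x \<tau> \<zeta>) =
        (\<lambda>\<zeta>. \<Sum>\<^sub>\<infinity>x\<in>dl. c x * ?d e x * th x \<tau> \<zeta>)"
      using c1 by (rule holo_pderiv_theta[OF \<tau>])
    moreover have "holo_pderiv e (\<lambda>\<zeta>. \<Sum>\<^sub>\<infinity>x\<in>dl. c x * ?d e x * th x \<tau> \<zeta>) =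
        (\<lambda>\<zeta>. \<Sum>\<^sub>\<infinity>x\<in>dl. c x * ?d e x * ?d e x * th x \<tau> \<zeta>)"
      using c2 by (rule holo_pderiv_theta[OF \<tau>])
    ultimately have "holo_pderiv e (holo_pderiv e (\<lambda>\<zeta>. \<Sum>\<^sub>\<infinity>x\<in>dl. c x * th x \<tau> \<zeta>)) \<zeta> =
        (\<Sum>\<^sub>\<infinity>x\<in>dl. c x * ?d e x * ?d e x * th x \<tau> \<zeta>)" by simp
    moreover have "(\<lambda>x. c x * ?d e x * ?d e x * th x \<tau> \<zeta>) summable_on dl"
    proof (rule abs_summable_summable, rule theta_abs_summable[OF \<tau>])
      fix x assume x: "x \<in> dl"
      have "2 * pi * \<bar>B x e\<bar> \<le> 2 * pi * ((1 + maj e) * (1 + maj x))"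
        using abs_B_le by (intro mult_left_mono) auto
      moreover have "norm (?d e x) = 2 * pi * \<bar>B x e\<bar>" by (simp add: norm_mult)
      ultimately have "norm (?d e x) \<le> 2 * pi * (1 + maj e) * (1 + maj x)"
        by (simp only: mult.assoc)
      then have "norm (c x * ?d e x) * norm (?d e x) \<le>
          (\<bar>C\<bar> * (2 * pi * (1 + maj e)) * (1 + maj x)) * (2 * pi * (1 + maj e) * (1 + maj x))"
        using c2[OF x] maj_nonneg[of e] maj_nonneg[of x] by (intro mult_mono) auto
      then show "norm (c x * ?d e x * ?d e x) \<le>
          (\<bar>C\<bar> * (2 * pi * (1 + maj e)) * (2 * pi * (1 + maj e))) * (1 + maj x)\<^sup>2"
        unfolding norm_mult[of "c x * ?d e x"] by (simp add: power2_eq_square mult_ac)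
    qed
    ultimately show ?thesis by simp
  qed
  have "((\<lambda>x. - (\<Sum>e\<in>E. c x * ?d e x * ?d e x * th x \<tau> \<zeta>)) has_sum
      holo_laplacian_neg B v (\<lambda>\<zeta>. \<Sum>\<^sub>\<infinity>x\<in>dl. c x * th x \<tau> \<zeta>) \<zeta>) dl"
    unfolding holo_laplacian_neg_def E_def[symmetric] has_sum_uminus
    using has_sum_finite_sum[OF finE s] by simp
  moreover have "- (\<Sum>e\<in>E. c x * ?d e x * ?d e x * th x \<tau> \<zeta>) =
      - 4 * of_real (pi\<^sup>2 * B (pn x) (pn x)) * c x * th x \<tau> \<zeta>" for x
  proof -
    have "- (\<Sum>e\<in>E. c x * ?d e x * ?d e x * th x \<tau> \<zeta>) =
        (\<Sum>e\<in>E. of_real ((B x e)\<^sup>2) * (4 * of_real (pi\<^sup>2) * c x * th x \<tau> \<zeta>))"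
      unfolding sum_negf[symmetric] by (intro sum.cong) (auto simp: power2_eq_square algebra_simps)
    also have "\<dots> = of_real (\<Sum>e\<in>E. (B x e)\<^sup>2) * (4 * of_real (pi\<^sup>2) * c x * th x \<tau> \<zeta>)"
      by (simp add: sum_distrib_right)
    also have "\<dots> = - 4 * of_real (pi\<^sup>2 * B (pn x) (pn x)) * c x * th x \<tau> \<zeta>"
      unfolding sum_B_neg_orthonormal_sq[OF E] by (simp add: algebra_simps)
    finally show ?thesis .
  qed
  ultimately show ?thesis by simp
qed

section \<open>Theta components and their independence\<close>

lemma Theta_eq: "\<gamma> \<in> disc_group L B \<Longrightarrow> Theta L B v \<tau> \<zeta> \<gamma> = (\<Sum>\<^sub>\<infinity>x\<in>\<gamma>. th x \<tau> \<zeta>)"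
  by (simp add: Theta_def)

text \<open>Each coset sum is extended by zero to the dual lattice and the finitely many sums are
  added; at a point x only the class of x contributes.\<close>

lemma has_sum_disc_group:
  fixes g :: "'v \<Rightarrow> complex"
  assumes "(\<lambda>x. norm (g x)) summable_on dl"
  shows "((\<lambda>x. g x * C (lattice_coset L x)) has_sum
    (\<Sum>\<gamma>\<in>disc_group L B. (\<Sum>\<^sub>\<infinity>x\<in>\<gamma>. g x) * C \<gamma>)) dl"
    (is "(_ has_sum ?S) _")
proof -
  have "((\<lambda>x. (if x \<in> \<gamma> then g x else 0) * C \<gamma>) has_sum (\<Sum>\<^sub>\<infinity>x\<in>\<gamma>. g x) * C \<gamma>) dl"
    if \<gamma>: "\<gamma> \<in> disc_group L B" for \<gamma>
  proof (rule has_sum_cmult_left)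
    have "g summable_on \<gamma>"
      by (rule abs_summable_summable, rule summable_on_subset[OF assms disc_subset_dual[OF \<gamma>]])
    then have "(g has_sum (\<Sum>\<^sub>\<infinity>x\<in>\<gamma>. g x)) \<gamma>" by (rule has_sum_infsum)
    then show "((\<lambda>x. if x \<in> \<gamma> then g x else 0) has_sum (\<Sum>\<^sub>\<infinity>x\<in>\<gamma>. g x)) dl"
      by (rule has_sum_cong_neutral[THEN iffD1, rotated -1]) (use disc_subset_dual[OF \<gamma>] in auto)
  qed
  then have "((\<lambda>x. \<Sum>\<gamma>\<in>disc_group L B. (if x \<in> \<gamma> then g x else 0) * C \<gamma>) has_sum ?S) dl"
    by (rule has_sum_finite_sum[OF finite_disc_group])
  moreover have "(\<Sum>\<gamma>\<in>disc_group L B. (if x \<in> \<gamma> then g x else 0) * C \<gamma>) = g x * C (lattice_coset L x)"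
    if x: "x \<in> dl" for x
  proof -
    have "(\<Sum>\<gamma>\<in>disc_group L B. (if x \<in> \<gamma> then g x else 0) * C \<gamma>) =
        (\<Sum>\<gamma>\<in>disc_group L B. if \<gamma> = lattice_coset L x then g x * C (lattice_coset L x) else 0)"
      using in_disc_iff x by (intro sum.cong) auto
    also have "\<dots> = g x * C (lattice_coset L x)"
      using finite_disc_group x by (simp add: disc_group_eq)
    finally show ?thesis .
  qed
  ultimately show ?thesis using has_sum_cong by (metis (no_types, lifting))
qed

lemma theta_summable: "Im \<tau> > 0 \<Longrightarrow> (\<lambda>x. norm (th x \<tau> \<zeta>)) summable_on dl"
  using theta_abs_summable[of \<tau> "\<lambda>_. 1" 1 \<zeta>] maj_nonneg by (simp add: one_le_power)

lemma coset_coeff_bounded: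
  assumes "x \<in> dl"
  shows "norm (C (lattice_coset L x)) \<le> (\<Sum>\<gamma>\<in>disc_group L B. norm (C \<gamma>))"
  by (rule member_le_sum) (use assms finite_disc_group in \<open>auto simp: disc_group_eq\<close>)

lemma jacobi_of_eq:
  assumes "Im \<tau> > 0"
  shows "jacobi_of L B v F \<tau> = (\<lambda>\<zeta>. \<Sum>\<^sub>\<infinity>x\<in>dl. F \<tau> (lattice_coset L x) * th x \<tau> \<zeta>)"
proof
  fix \<zeta>
  have "jacobi_of L B v F \<tau> \<zeta> = (\<Sum>\<gamma>\<in>disc_group L B. (\<Sum>\<^sub>\<infinity>x\<in>\<gamma>. th x \<tau> \<zeta>) * F \<tau> \<gamma>)"
    unfolding jacobi_of_def pairing_def by (rule sum.cong) (simp_all add: Theta_eq)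
  also have "\<dots> = (\<Sum>\<^sub>\<infinity>x\<in>dl. F \<tau> (lattice_coset L x) * th x \<tau> \<zeta>)"
    using infsumI[OF has_sum_disc_group[OF theta_summable[OF assms, of \<zeta>], where C = "F \<tau>"]] by (simp add: mult.commute)
  finally show "jacobi_of L B v F \<tau> \<zeta> = (\<Sum>\<^sub>\<infinity>x\<in>dl. F \<tau> (lattice_coset L x) * th x \<tau> \<zeta>)" .
qed

text \<open>At real points \<open>cx u\<close> each theta term is its value at 0 times a unitary
  character of u. The independence of characters then kills every coefficient, and an exponential is
  never zero.\<close>

lemma theta_coeffs_eq_0:
  assumes \<tau>: "Im \<tau> > 0" and zero: "\<And>\<zeta>. (\<Sum>\<gamma>\<in>disc_group L B. Theta L B v \<tau> \<zeta> \<gamma> * C \<gamma>) = 0"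
    and \<gamma>: "\<gamma> \<in> disc_group L B"
  shows "C \<gamma> = 0"
proof -
  let ?d = "\<lambda>x. C (lattice_coset L x) * th x \<tau> 0"
  let ?\<phi> = "\<lambda>x u. e2pi (of_real (B x u))"
  obtain x0 where x0: "x0 \<in> dl" "\<gamma> = lattice_coset L x0" using \<gamma> unfolding disc_group_eq by blast
  have "?d x0 = 0"
  proof (rule infsum_characters_eq_0_imp_coeff_eq_0[where A = dl and d = ?d and \<phi> = ?\<phi>])
    show "(\<lambda>x. norm (?d x)) summable_on dl"
    proof (rule theta_abs_summable[OF \<tau>])
      fix x assume x: "x \<in> dl"
      let ?K = "\<Sum>\<gamma>\<in>disc_group L B. norm (C \<gamma>)"
      have "norm (C (lattice_coset L x)) \<le> ?K" by (rule coset_coeff_bounded[OF x])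
      also have "\<dots> \<le> ?K * (1 + maj x)\<^sup>2"
        using mult_left_mono[OF one_le_power, of "1 + maj x" ?K 2] maj_nonneg[of x] by (simp add: sum_nonneg)
      finally show "norm (C (lattice_coset L x)) \<le> ?K * (1 + maj x)\<^sup>2" .
    qed
    show "?\<phi> x (u + w) = ?\<phi> x u * ?\<phi> x w" for x u w by (simp add: B_simps e2pi_add)
    show "norm (?\<phi> x u) = 1" for x u by (simp add: norm_e2pi)
    show "\<exists>w. ?\<phi> y w = - ?\<phi> x w" if "x \<noteq> y" for x y
    proof -
      define z where "z = y - x"
      have z: "maj z > 0" using that by (intro maj_pos) (auto simp: z_def)
      \<comment> \<open>The reflection of z pairs with z to \<open>maj z\<close>, so this multiple
        gives \<open>B z w = 1 / 2\<close>, and \<open>e2pi (1/2) = -1\<close> is the required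
        opposite value.\<close>
      define w where "w = (1 / (2 * maj z)) *\<^sub>R (pp z - pn z)"
      have "B z w = 1 / 2" using z by (simp only: w_def Br.scale B_flip_self) simp
      then have "B y w = B x w + 1 / 2" by (simp add: z_def Bl.diff)
      then have "?\<phi> y w = ?\<phi> x w * e2pi (1 / 2)" by (simp add: e2pi_add)
      then show ?thesis by (auto simp: e2pi_half)
    qed
    show "(\<Sum>\<^sub>\<infinity>x\<in>dl. ?d x * ?\<phi> x u) = 0" for u
    proof -
      have "th x \<tau> (cx u) = th x \<tau> 0 * ?\<phi> x u" for x
        unfolding theta_term_def cform_cx
        by (simp add: e2pi_add[symmetric] cx_def B_simps Complex_eq)
      then have "(\<Sum>\<^sub>\<infinity>x\<in>dl. ?d x * ?\<phi> x u) = (\<Sum>\<^sub>\<infinity>x\<in>dl. th x \<tau> (cx u) * C (lattice_coset L x))"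
        by (simp add: mult_ac)
      also have "\<dots> = (\<Sum>\<gamma>\<in>disc_group L B. (\<Sum>\<^sub>\<infinity>x\<in>\<gamma>. th x \<tau> (cx u)) * C \<gamma>)"
        by (rule infsumI[OF has_sum_disc_group[OF theta_summable[OF \<tau>]]])
      also have "\<dots> = (\<Sum>\<gamma>\<in>disc_group L B. Theta L B v \<tau> (cx u) \<gamma> * C \<gamma>)"
        by (rule sum.cong) (simp_all add: Theta_eq)
      finally show ?thesis using zero by simp
    qed
  qed (rule x0)
  then show ?thesis by (simp add: x0 theta_term_def)
qed

section \<open>Derivatives in the modular variable and the heat operator\<close>

lemma maj_le_square: "maj x \<le> (1 + maj x)\<^sup>2"
  using maj_nonneg[of x] by (simp add: power2_eq_square algebra_simps)

lemma theta_tau_derivative: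
  fixes \<zeta> :: "'v \<times> 'v"
  assumes \<gamma>: "\<gamma> \<in> disc_group L B" and \<tau>: "Im \<tau> > 0"
  defines "D \<equiv> \<lambda>h. \<Sum>\<^sub>\<infinity>x\<in>\<gamma>. of_real pi * \<i> * (h * of_real (B (pp x) (pp x)) + cnj h * of_real (B (pn x) (pn x))) * th x \<tau> \<zeta>"
  shows "((\<lambda>t. Theta L B v t \<zeta> \<gamma>) has_derivative D) (at \<tau>)"
    and "D 1 + \<i> * D \<i> = 2 * (\<Sum>\<^sub>\<infinity>x\<in>\<gamma>. of_real pi * \<i> * of_real (B (pn x) (pn x)) * th x \<tau> \<zeta>)"
proof -
  let ?p = "\<lambda>x. B (pp x) (pp x)" and ?n = "\<lambda>x. B (pn x) (pn x)"
  let ?c = "\<lambda>x h. of_real pi * \<i> * (h * of_real (?p x) + cnj h * of_real (?n x))"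
  let ?f' = "\<lambda>x t h. ?c x h * th x t \<zeta>"
  have c: "norm (?c x h) \<le> pi * maj x * norm h" for x h
  proof -
    have "norm (h * of_real (?p x) + cnj h * of_real (?n x)) \<le> norm h * \<bar>?p x\<bar> + norm h * \<bar>?n x\<bar>"
      by (rule norm_triangle_le) (simp add: norm_mult)
    also have "\<dots> = maj x * norm h"
      using B_proj_pos_nonneg[of x] B_proj_neg_nonpos[of x] by (simp add: majorant_def algebra_simps)
    finally have "pi * norm (h * of_real (?p x) + cnj h * of_real (?n x)) \<le> pi * (maj x * norm h)"
      by (rule mult_left_mono) simp
    then show ?thesis by (simp add: norm_mult mult.assoc)
  qed
  \<comment> \<open>Halving the imaginary part leaves an open convex half-plane around \<tau> on
    which a single majorant works.\<close>
  have a: "Im \<tau> / 2 > 0" using \<tau> by simp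
  obtain M where M: "M summable_on dl" "\<And>x. 0 \<le> M x"
    "\<And>t z x. Im \<tau> / 2 \<le> Im t \<Longrightarrow> maj (snd z) \<le> maj (snd \<zeta>) \<Longrightarrow> (1 + maj x)\<^sup>2 * norm (th x t z) \<le> M x"
    using theta_term_dominated[OF a, of "maj (snd \<zeta>)"] by blast
  have sub: "\<gamma> \<subseteq> dl" by (rule disc_subset_dual[OF \<gamma>])
  have "((\<lambda>t. \<Sum>\<^sub>\<infinity>x\<in>\<gamma>. th x t \<zeta>) has_derivative (\<lambda>h. \<Sum>\<^sub>\<infinity>x\<in>\<gamma>. ?f' x \<tau> h)) (at \<tau>)"
  proof (rule has_derivative_infsum[of "{t. Im t > Im \<tau> / 2}" _ \<gamma> _ ?f' "\<lambda>x. pi * M x"])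
    show "convex {t. Im t > Im \<tau> / 2}" by (rule convex_halfspace_Im_gt)
    show "open {t. Im t > Im \<tau> / 2}" by (rule open_halfspace_Im_gt)
    fix x t assume t: "t \<in> {t. Im t > Im \<tau> / 2}"
    let ?g = "\<lambda>h. h * (of_real (?p x) / 2) + cnj h * (of_real (?n x) / 2)"
    have "bounded_linear ?g"
      by (intro bounded_linear_add bounded_linear_mult_left
        bounded_linear_compose[OF bounded_linear_mult_left bounded_linear_cnj])
    then have "((\<lambda>t. ?g t + cform B (cx x) \<zeta>) has_derivative ?g) (at t)"
      by (intro has_derivative_add_const bounded_linear_imp_has_derivative)
    from has_derivative_e2pi[OF this] show "((\<lambda>t. th x t \<zeta>) has_derivative ?f' x t) (at t)"
      unfolding theta_term_def by (simp add: algebra_simps)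
    have "norm (?c x h) * norm (th x t \<zeta>) \<le> pi * M x * norm h" for h
    proof -
      have "norm (?c x h) * norm (th x t \<zeta>) \<le> pi * maj x * norm h * norm (th x t \<zeta>)"
        using c by (intro mult_right_mono) auto
      also have "\<dots> \<le> pi * (1 + maj x)\<^sup>2 * norm h * norm (th x t \<zeta>)"
        using maj_le_square[of x] by (intro mult_right_mono mult_left_mono) auto
      also have "\<dots> = pi * norm h * ((1 + maj x)\<^sup>2 * norm (th x t \<zeta>))" by simp
      also have "\<dots> \<le> pi * norm h * M x"
        using t by (intro mult_left_mono M) auto
      finally show ?thesis by (simp add: mult_ac)
    qed
    then show "norm (?f' x t h) \<le> pi * M x * norm h" for h by (simp only: norm_mult)
  next
    show "(\<lambda>x. th x t \<zeta>) summable_on \<gamma>" if "t \<in> {t. Im t > Im \<tau> / 2}" for t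
    proof -
      have "Im t > 0" using that \<tau> by simp
      from summable_on_subset[OF theta_summable[OF this] sub] show ?thesis
        by (rule abs_summable_summable)
    qed
    show "(\<lambda>x. pi * M x) summable_on \<gamma>"
      by (intro summable_on_cmult_right summable_on_subset[OF M(1) sub])
  qed (use M \<tau> in auto)
  then show "((\<lambda>t. Theta L B v t \<zeta> \<gamma>) has_derivative D) (at \<tau>)"
    unfolding D_def Theta_eq[OF \<gamma>] .
  have s: "(\<lambda>x. ?f' x \<tau> h) summable_on \<gamma>" for h
  proof (rule abs_summable_summable, rule summable_on_subset[OF _ sub], rule theta_abs_summable[OF \<tau>])
    fix x
    have "norm (?c x h) \<le> (pi * norm h) * maj x" using c[where x = x and h = h] by (simp only: mult_ac)
    also have "\<dots> \<le> (pi * norm h) * (1 + maj x)\<^sup>2" using maj_le_square by (intro mult_left_mono) auto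
    finally show "norm (?c x h) \<le> (pi * norm h) * (1 + maj x)\<^sup>2" .
  qed
  have "D 1 + \<i> * D \<i> = (\<Sum>\<^sub>\<infinity>x\<in>\<gamma>. ?f' x \<tau> 1) + (\<Sum>\<^sub>\<infinity>x\<in>\<gamma>. \<i> * ?f' x \<tau> \<i>)"
    by (simp only: D_def infsum_cmult_right')
  also have "\<dots> = (\<Sum>\<^sub>\<infinity>x\<in>\<gamma>. ?f' x \<tau> 1 + \<i> * ?f' x \<tau> \<i>)"
    by (rule infsum_add[symmetric]) (intro s summable_on_cmult_right)+
  \<comment> \<open>In \<open>D 1 + \<i> * D \<i>\<close> the part linear in h cancels, as 1 +
    \<i>^2 = 0, while the part linear in \<open>cnj h\<close> is doubled. Only the negative
    projection survives.\<close>
  also have "\<dots> = (\<Sum>\<^sub>\<infinity>x\<in>\<gamma>. 2 * (of_real pi * \<i> * of_real (?n x) * th x \<tau> \<zeta>))"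
    by (rule infsum_cong) (simp add: algebra_simps)
  also have "\<dots> = 2 * (\<Sum>\<^sub>\<infinity>x\<in>\<gamma>. of_real pi * \<i> * of_real (?n x) * th x \<tau> \<zeta>)"
    by (rule infsum_cmult_right')
  finally show "D 1 + \<i> * D \<i> = 2 * (\<Sum>\<^sub>\<infinity>x\<in>\<gamma>. of_real pi * \<i> * of_real (?n x) * th x \<tau> \<zeta>)" .
qed

text \<open>By the product rule \<open>dbar\<close> falls either on \<open>F\<close> or on the theta
  components. The second contribution and the Laplacian are exhibited as sums of the same series
  over the dual lattice, so they cancel by uniqueness of sums.\<close>

lemma heat_jacobi_of:
  assumes \<tau>: "Im \<tau> > 0"
    and F: "\<And>\<gamma>. \<gamma> \<in> disc_group L B \<Longrightarrow> (\<lambda>t. F t \<gamma>) differentiable (at \<tau>)"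
  shows "4 * of_real pi * \<i> * dbar (\<lambda>t. jacobi_of L B v F t \<zeta>) \<tau> - holo_laplacian_neg B v (jacobi_of L B v F \<tau>) \<zeta>
    = 4 * of_real pi * \<i> * (\<Sum>\<gamma>\<in>disc_group L B. Theta L B v \<tau> \<zeta> \<gamma> * dbar (\<lambda>t. F t \<gamma>) \<tau>)"
proof -
  let ?n = "\<lambda>x. B (pn x) (pn x)"
  define D where "D \<gamma> h = (\<Sum>\<^sub>\<infinity>x\<in>\<gamma>. of_real pi * \<i> * (h * of_real (B (pp x) (pp x)) + cnj h * of_real (?n x)) * th x \<tau> \<zeta>)" for \<gamma> h
  let ?F' = "\<lambda>\<gamma>. frechet_derivative (\<lambda>t. F t \<gamma>) (at \<tau>)"
  let ?N = "\<lambda>x. of_real pi * \<i> * of_real (?n x) * th x \<tau> \<zeta>"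
  have dF: "((\<lambda>t. F t \<gamma>) has_derivative ?F' \<gamma>) (at \<tau>)" if "\<gamma> \<in> disc_group L B" for \<gamma>
    using F[OF that] frechet_derivative_works by blast
  have "((\<lambda>t. jacobi_of L B v F t \<zeta>) has_derivative
      (\<lambda>h. \<Sum>\<gamma>\<in>disc_group L B. Theta L B v \<tau> \<zeta> \<gamma> * ?F' \<gamma> h + D \<gamma> h * F \<tau> \<gamma>)) (at \<tau>)"
    unfolding jacobi_of_def pairing_def D_def
    by (intro has_derivative_sum has_derivative_mult theta_tau_derivative \<tau> dF)
  from frechet_derivative_at[OF this, symmetric]
  have "dbar (\<lambda>t. jacobi_of L B v F t \<zeta>) \<tau> =
      (\<Sum>\<gamma>\<in>disc_group L B. Theta L B v \<tau> \<zeta> \<gamma> * ((?F' \<gamma> 1 + \<i> * ?F' \<gamma> \<i>) / 2) + (D \<gamma> 1 + \<i> * D \<gamma> \<i>) / 2 * F \<tau> \<gamma>)"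
    unfolding dbar_def by (simp add: sum_distrib_left sum_divide_distrib sum.distrib[symmetric] add_divide_distrib algebra_simps)
  also have "\<dots> = (\<Sum>\<gamma>\<in>disc_group L B. Theta L B v \<tau> \<zeta> \<gamma> * dbar (\<lambda>t. F t \<gamma>) \<tau> + (\<Sum>\<^sub>\<infinity>x\<in>\<gamma>. ?N x) * F \<tau> \<gamma>)"
    using theta_tau_derivative(2)[OF _ \<tau>, of _ \<zeta>] by (intro sum.cong) (auto simp: dbar_def D_def)
  finally have dbar: "dbar (\<lambda>t. jacobi_of L B v F t \<zeta>) \<tau> =
      (\<Sum>\<gamma>\<in>disc_group L B. Theta L B v \<tau> \<zeta> \<gamma> * dbar (\<lambda>t. F t \<gamma>) \<tau>) +
      (\<Sum>\<gamma>\<in>disc_group L B. (\<Sum>\<^sub>\<infinity>x\<in>\<gamma>. ?N x) * F \<tau> \<gamma>)"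
    by (simp add: sum.distrib)
  have "(\<lambda>x. norm (?N x)) summable_on dl"
  proof (rule theta_abs_summable[OF \<tau>])
    fix x
    have "\<bar>?n x\<bar> \<le> (1 + maj x)\<^sup>2"
      using B_proj_pos_nonneg[of x] B_proj_neg_nonpos[of x] maj_le_square[of x] by (simp add: majorant_def)
    then show "norm (of_real pi * \<i> * of_real (?n x) :: complex) \<le> pi * (1 + maj x)\<^sup>2"
      by (simp add: norm_mult)
  qed
  from has_sum_disc_group[OF this, where C = "F \<tau>"]
  have "((\<lambda>x. 4 * of_real pi * \<i> * (?N x * F \<tau> (lattice_coset L x))) has_sum
      4 * of_real pi * \<i> * (\<Sum>\<gamma>\<in>disc_group L B. (\<Sum>\<^sub>\<infinity>x\<in>\<gamma>. ?N x) * F \<tau> \<gamma>)) dl"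
    by (rule has_sum_cmult_right)
  moreover have "4 * of_real pi * \<i> * (?N x * F \<tau> (lattice_coset L x)) =
      - 4 * of_real (pi\<^sup>2 * ?n x) * F \<tau> (lattice_coset L x) * th x \<tau> \<zeta>" for x
    by (simp add: power2_eq_square mult_ac)
  ultimately have "((\<lambda>x. - 4 * of_real (pi\<^sup>2 * ?n x) * F \<tau> (lattice_coset L x) * th x \<tau> \<zeta>) has_sum
      4 * of_real pi * \<i> * (\<Sum>\<gamma>\<in>disc_group L B. (\<Sum>\<^sub>\<infinity>x\<in>\<gamma>. ?N x) * F \<tau> \<gamma>)) dl"
    by (simp only:)
  moreover have "((\<lambda>x. - 4 * of_real (pi\<^sup>2 * ?n x) * F \<tau> (lattice_coset L x) * th x \<tau> \<zeta>) has_sum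
      holo_laplacian_neg B v (jacobi_of L B v F \<tau>) \<zeta>) dl"
    unfolding jacobi_of_eq[OF \<tau>] using coset_coeff_bounded by (rule holo_laplacian_neg_theta[OF \<tau>])
  ultimately have lap: "4 * of_real pi * \<i> * (\<Sum>\<gamma>\<in>disc_group L B. (\<Sum>\<^sub>\<infinity>x\<in>\<gamma>. ?N x) * F \<tau> \<gamma>) =
      holo_laplacian_neg B v (jacobi_of L B v F \<tau>) \<zeta>"
    by (rule has_sum_unique)
  show ?thesis unfolding dbar lap[symmetric] by (simp only: distrib_left add_diff_cancel_right')
qed

text \<open>Both properties say that \<open>dbar\<close> of every component vanishes. The passage
  from the theta combination to its components takes place at a fixed \<tau>, where the numbers
  \<open>dbar (\<lambda>t. F t \<gamma>) \<tau>\<close> are constants with respect to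
  \<zeta>.\<close>

lemma weakly_holomorphic_iff_pseudo_holomorphic:
  assumes F: "\<And>\<gamma>. \<gamma> \<in> disc_group L B \<Longrightarrow> smooth_on upper_half (\<lambda>\<tau>. F \<tau> \<gamma>)"
  shows "weakly_holomorphic L B F \<longleftrightarrow> pseudo_holomorphic B v (jacobi_of L B v F)"
proof -
  have diff: "(\<lambda>t. F t \<gamma>) differentiable (at \<tau>)" if "\<gamma> \<in> disc_group L B" "Im \<tau> > 0" for \<gamma> \<tau>
    using F[OF that(1)] that(2) unfolding smooth_on_def by (auto dest: spec[of _ "Suc 0"])
  have "weakly_holomorphic L B F \<longleftrightarrow>
      (\<forall>\<gamma>\<in>disc_group L B. \<forall>\<tau>\<in>upper_half. (\<lambda>t. F t \<gamma>) field_differentiable (at \<tau>))"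
    unfolding weakly_holomorphic_def
    using at_within_open[OF _ open_halfspace_Im_gt] by (simp add: holomorphic_on_def)
  also have "\<dots> \<longleftrightarrow> (\<forall>\<gamma>\<in>disc_group L B. \<forall>\<tau>\<in>upper_half. dbar (\<lambda>t. F t \<gamma>) \<tau> = 0)"
    using dbar_eq_0_iff[OF diff] by simp
  also have "\<dots> \<longleftrightarrow> (\<forall>\<tau>\<in>upper_half. \<forall>\<zeta>.
      (\<Sum>\<gamma>\<in>disc_group L B. Theta L B v \<tau> \<zeta> \<gamma> * dbar (\<lambda>t. F t \<gamma>) \<tau>) = 0)"
  proof (intro iffI ballI allI)
    fix \<gamma> \<tau>
    assume zero: "\<forall>\<tau>\<in>upper_half. \<forall>\<zeta>. (\<Sum>\<gamma>\<in>disc_group L B. Theta L B v \<tau> \<zeta> \<gamma> * dbar (\<lambda>t. F t \<gamma>) \<tau>) = 0"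
      and \<gamma>: "\<gamma> \<in> disc_group L B" and \<tau>: "\<tau> \<in> upper_half"
    show "dbar (\<lambda>t. F t \<gamma>) \<tau> = 0"
      by (rule theta_coeffs_eq_0[where C = "\<lambda>\<gamma>. dbar (\<lambda>t. F t \<gamma>) \<tau>", OF _ _ \<gamma>]) (use zero \<tau> in auto)
  qed (auto intro!: sum.neutral)
  also have "\<dots> \<longleftrightarrow> pseudo_holomorphic B v (jacobi_of L B v F)"
    unfolding pseudo_holomorphic_def using heat_jacobi_of diff by simp
  finally show ?thesis .
qed

end

section \<open>The weight of a pseudo-holomorphic Jacobi form\<close>

lemma dbar_eq: "(f has_derivative D) (at \<tau>) \<Longrightarrow> dbar f \<tau> = (D 1 + \<i> * D \<i>) / 2"
  unfolding dbar_def by (drule frechet_derivative_at) simp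

lemma dbar_mult:
  assumes "f differentiable (at \<tau>)" "g differentiable (at \<tau>)"
  shows "dbar (\<lambda>t. f t * g t) \<tau> = f \<tau> * dbar g \<tau> + dbar f \<tau> * g \<tau>"
proof -
  obtain D D' where D: "(f has_derivative D) (at \<tau>)" "(g has_derivative D') (at \<tau>)"
    using assms unfolding differentiable_def by blast
  show ?thesis unfolding dbar_eq[OF has_derivative_mult[OF D]] dbar_eq[OF D(1)] dbar_eq[OF D(2)]
    by (simp add: field_simps)
qed

lemma has_derivative_cnj_field:
  assumes "(f has_field_derivative f') (at \<tau>)"
  shows "((\<lambda>t. cnj (f t)) has_derivative (\<lambda>h. cnj (f' * h))) (at \<tau>)"
  by (rule bounded_linear.has_derivative[OF bounded_linear_cnj])
    (use assms in \<open>simp add: has_field_derivative_def\<close>)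

lemma dbar_cnj:
  assumes "(f has_field_derivative f') (at \<tau>)"
  shows "dbar (\<lambda>t. cnj (f t)) \<tau> = cnj f'"
  using dbar_eq[OF has_derivative_cnj_field[OF assms]] by (simp add: complex_eq_iff)

lemma dbar_holomorphic:
  assumes "(f has_field_derivative f') (at \<tau>)"
  shows "dbar f \<tau> = 0"
  using dbar_eq[OF assms[unfolded has_field_derivative_def]] by (simp add: complex_eq_iff)

lemma real_linear_complex_decomp:
  fixes D :: "complex \<Rightarrow> complex"
  assumes "linear D"
  shows "D h = (D 1 - \<i> * D \<i>) / 2 * h + (D 1 + \<i> * D \<i>) / 2 * cnj h"
proof -
  interpret linear D by fact
  have h: "h = Re h *\<^sub>R 1 + Im h *\<^sub>R \<i>" by (rule complex_eqI) simp_all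
  have "D h = Re h *\<^sub>R D 1 + Im h *\<^sub>R D \<i>"
    by (subst h) (simp only: add scale)
  then show ?thesis by (simp add: complex_eq_iff field_simps)
qed

text \<open>Models the transformation law on a complex line in a negative direction:
  \<open>J\<close> is the conjugate automorphy factor, \<open>f\<close> lives at the transformed
  point and \<open>g\<close> at the original one. The exponent -w^2/2 reflects
  \<open>B e e = -1\<close>; its second derivative produces the \<open>- \<mu>\<close> from which
  b_- is later counted.\<close>

lemma gaussian_factor_derivs:
  fixes J W \<mu> b :: complex
  assumes J: "J \<noteq> 0" and f: "f holomorphic_on UNIV" and g: "g holomorphic_on UNIV"
    and eq: "\<And>w. f (w / J) = W * exp (\<mu> * (w * b - w\<^sup>2 / 2)) * g w"
  shows "deriv f 0 / J = W * (\<mu> * b * g 0 + deriv g 0)"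
    and "deriv (deriv f) 0 / J\<^sup>2 =
      W * ((\<mu>\<^sup>2 * b\<^sup>2 - \<mu>) * g 0 + 2 * \<mu> * b * deriv g 0 + deriv (deriv g) 0)"
proof -
  let ?m = "\<lambda>w. exp (\<mu> * (w * b - w\<^sup>2 / 2))"
  have m: "(?m has_field_derivative \<mu> * (b - w) * ?m w) (at w)" for w
    by (auto intro!: derivative_eq_intros simp: field_simps)
  have d: "(h has_field_derivative deriv h w) (at w)" if "h holomorphic_on UNIV" for h w
    using holomorphic_derivI[OF that, of w] by simp
  have dJ: "((\<lambda>w. h (w / J)) has_field_derivative deriv h (w / J) / J) (at w)"
    if "h holomorphic_on UNIV" for h w
  proof -
    have "((\<lambda>w. w / J) has_field_derivative 1 / J) (at w)"
      using DERIV_cdivide[OF DERIV_ident] .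
    from DERIV_chain2[OF d[OF that] this] show ?thesis by simp
  qed
  \<comment> \<open>Proved for all w, and not only at 0, so that both sides can be differentiated
    once more.\<close>
  have f1: "deriv f (w / J) / J = W * (\<mu> * (b - w) * ?m w * g w + ?m w * deriv g w)" for w
  proof (rule DERIV_unique)
    show "((\<lambda>w. f (w / J)) has_field_derivative deriv f (w / J) / J) (at w)" by (rule dJ[OF f])
    show "((\<lambda>w. f (w / J)) has_field_derivative W * (\<mu> * (b - w) * ?m w * g w + ?m w * deriv g w)) (at w)"
      unfolding eq by (auto intro!: derivative_eq_intros m d[OF g] simp: algebra_simps)
  qed
  from f1[of 0] show "deriv f 0 / J = W * (\<mu> * b * g 0 + deriv g 0)" by simp
  have df: "deriv f holomorphic_on UNIV" and dg: "deriv g holomorphic_on UNIV"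
    using f g by (auto intro: holomorphic_deriv)
  have "deriv (deriv f) 0 / J / J = W * (\<mu> * (b * (\<mu> * b * g 0) - g 0 + b * deriv g 0) + (\<mu> * b * deriv g 0 + deriv (deriv g) 0))"
  proof (rule DERIV_unique)
    show "((\<lambda>w. deriv f (w / J) / J) has_field_derivative deriv (deriv f) 0 / J / J) (at 0)"
      using DERIV_cdivide[OF dJ[OF df, of 0], of J] by simp
    show "((\<lambda>w. deriv f (w / J) / J) has_field_derivative
        W * (\<mu> * (b * (\<mu> * b * g 0) - g 0 + b * deriv g 0) + (\<mu> * b * deriv g 0 + deriv (deriv g) 0))) (at 0)"
      unfolding f1 by (auto intro!: derivative_eq_intros m d[OF g] d[OF dg] simp: algebra_simps)
  qed
  then show "deriv (deriv f) 0 / J\<^sup>2 =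
      W * ((\<mu>\<^sup>2 * b\<^sup>2 - \<mu>) * g 0 + 2 * \<mu> * b * deriv g 0 + deriv (deriv g) 0)"
    by (simp add: power2_eq_square algebra_simps)
qed

section \<open>Complex lines in the complexified space\<close>

lemma cscale_add_left: "cscale (a + b) z = cscale a z + cscale b z"
  and cscale_add_right: "cscale a (z + w) = cscale a z + cscale a w"
  and cscale_cscale: "cscale a (cscale b z) = cscale (a * b) z"
  and cscale_0 [simp]: "cscale 0 z = 0"
  by (simp_all add: cscale_def prod_eq_iff algebra_simps)

lemma bounded_linear_cscale: "bounded_linear (\<lambda>w. cscale w z)"
  for z :: "'v::real_normed_vector \<times> 'v"
proof -
  have "(\<lambda>w. cscale w z) = (\<lambda>w. Re w *\<^sub>R z + Im w *\<^sub>R (- snd z, fst z))"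
    by (auto simp: cscale_def prod_eq_iff)
  then show ?thesis
    by (simp only:) (intro bounded_linear_add bounded_linear_compose[OF bounded_linear_scaleR_left]
      bounded_linear_Re bounded_linear_Im)
qed

lemma holomorphic_on_line:
  assumes "cx_holomorphic h"
  shows "(\<lambda>w. h (\<zeta> + cscale w (cx e))) holomorphic_on UNIV"
    and "(h has_derivative D) (at \<zeta>) \<Longrightarrow> deriv (\<lambda>w. h (\<zeta> + cscale w (cx e))) 0 = D (cx e)"
proof -
  have line: "((\<lambda>w. h (\<zeta> + cscale w (cx e))) has_field_derivative D (cx e)) (at w)"
    if "(h has_derivative D) (at (\<zeta> + cscale w (cx e)))" for D w
  proof -
    obtain D' where D': "(h has_derivative D') (at (\<zeta> + cscale w (cx e)))" "\<And>c k. D' (cscale c k) = c * D' k"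
      using assms unfolding cx_holomorphic_def by blast
    have D: "D = D'" using has_derivative_unique[OF that D'(1)] .
    have "((\<lambda>w. \<zeta> + cscale w (cx e)) has_derivative (\<lambda>w. cscale w (cx e))) (at w)"
      using has_derivative_add[OF has_derivative_const bounded_linear_imp_has_derivative[OF bounded_linear_cscale]]
      by simp
    from has_derivative_compose[OF this D'(1)]
    have "((\<lambda>w. h (\<zeta> + cscale w (cx e))) has_derivative (\<lambda>w. w * D (cx e))) (at w)"
      unfolding D D'(2) .
    then show ?thesis unfolding has_field_derivative_def by (simp add: mult_commute_abs)
  qed
  show "(\<lambda>w. h (\<zeta> + cscale w (cx e))) holomorphic_on UNIV"
    unfolding holomorphic_on_def field_differentiable_def
    using line assms unfolding cx_holomorphic_def by fastforce
  show "deriv (\<lambda>w. h (\<zeta> + cscale w (cx e))) 0 = D (cx e)" if "(h has_derivative D) (at \<zeta>)"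
    by (rule DERIV_imp_deriv, rule line) (use that in simp)
qed

text \<open>Moves the base point along the line, since \<open>holo_pderiv\<close> is defined by a
  derivative at 0. Iterated holomorphic partial derivatives thereby become ordinary derivatives of
  one function of one variable.\<close>

lemma holo_pderiv_line:
  "holo_pderiv e h (\<zeta> + cscale w (cx e)) = deriv (\<lambda>w. h (\<zeta> + cscale w (cx e))) w"
  unfolding holo_pderiv_def
  by (subst (2) deriv_shift_0) (simp add: o_def cscale_add_left add.assoc)

lemma holo_pderiv_twice:
  "holo_pderiv e (holo_pderiv e h) \<zeta> = deriv (deriv (\<lambda>w. h (\<zeta> + cscale w (cx e)))) 0"
  unfolding holo_pderiv_def[of e "holo_pderiv e h"] holo_pderiv_line ..

section \<open>The Moebius action and automorphy factors\<close>

lemma jfac_nonzero: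
  assumes "A \<in> SL2R" "Im \<tau> > 0" shows "jfac A \<tau> \<noteq> 0"
proof
  assume "jfac A \<tau> = 0"
  then have "Im (jfac A \<tau>) = 0" "Re (jfac A \<tau>) = 0" by simp_all
  then have "A $ 2 $ 1 = 0" "A $ 2 $ 2 = 0" using assms(2) by (auto simp: jfac_def)
  then show False using assms(1) by (simp add: SL2R_def det_2)
qed

lemma Im_moeb_pos:
  assumes "A \<in> SL2R" "Im \<tau> > 0" shows "Im (moeb A \<tau>) > 0"
proof -
  have det: "A $ 1 $ 1 * A $ 2 $ 2 - A $ 1 $ 2 * A $ 2 $ 1 = 1" using assms by (simp add: SL2R_def det_2)
  have "Im ((of_real (A $ 1 $ 1) * \<tau> + of_real (A $ 1 $ 2)) * cnj (jfac A \<tau>)) =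
      (A $ 1 $ 1 * A $ 2 $ 2 - A $ 1 $ 2 * A $ 2 $ 1) * Im \<tau>"
    by (simp add: jfac_def algebra_simps)
  then show ?thesis unfolding moeb_def Im_complex_div_gt_0 det using assms by simp
qed

lemma jfac_deriv: "(jfac A has_field_derivative of_real (A $ 2 $ 1)) (at \<tau>)"
  unfolding jfac_def by (auto intro!: derivative_eq_intros)

lemma moeb_deriv:
  assumes "A \<in> SL2R" "Im \<tau> > 0"
  shows "(moeb A has_field_derivative 1 / (jfac A \<tau>)\<^sup>2) (at \<tau>)"
proof -
  have "A $ 1 $ 1 * A $ 2 $ 2 - A $ 1 $ 2 * A $ 2 $ 1 = 1" using assms by (simp add: SL2R_def det_2)
  then have "of_real (A $ 1 $ 1 * A $ 2 $ 2 - A $ 1 $ 2 * A $ 2 $ 1) = (1::complex)" by simp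
  then have "of_real (A $ 1 $ 1) * jfac A \<tau> - (of_real (A $ 1 $ 1) * \<tau> + of_real (A $ 1 $ 2)) * of_real (A $ 2 $ 1) = 1"
    by (simp add: jfac_def algebra_simps)
  moreover have "(moeb A has_field_derivative (of_real (A $ 1 $ 1) * jfac A \<tau>
      - (of_real (A $ 1 $ 1) * \<tau> + of_real (A $ 1 $ 2)) * of_real (A $ 2 $ 1)) / (jfac A \<tau> * jfac A \<tau>)) (at \<tau>)"
    unfolding moeb_def
    by (rule DERIV_divide[OF _ jfac_deriv jfac_nonzero[OF assms]]) (auto intro!: derivative_eq_intros)
  ultimately show ?thesis by (simp add: power2_eq_square)
qed

text \<open>The factor is a product \<open>?H t * cnj (?K t)\<close> with \<open>?H\<close> and
  \<open>?K\<close> holomorphic, so \<open>dbar\<close> sees only the derivative of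
  \<open>?K\<close>. Differentiating \<open>(\<phi> t)\<^sup>2 = jfac A t\<close> gives c / (2 j) as
  logarithmic derivative of \<phi>. \<open>P\<close> and \<open>N\<close> stand for the squares of
  the two projections of \<zeta>, constant in \<tau>.\<close>

lemma automorphy_factor_dbar:
  fixes A :: "real^2^2" and P N :: complex and k l :: real
  assumes A: "A \<in> SL2R" and \<phi>: "\<phi> holomorphic_on upper_half"
    and sq: "\<And>t. Im t > 0 \<Longrightarrow> (\<phi> t)\<^sup>2 = jfac A t" and \<tau>: "Im \<tau> > 0"
  defines "c \<equiv> of_real (A $ 2 $ 1) :: complex"
  defines "W \<equiv> \<lambda>t. weight_factor k l \<phi> t * e2pi (c * P / (2 * jfac A t) + c * N / (2 * cnj (jfac A t)))"
  shows "W differentiable (at \<tau>)" "W \<tau> \<noteq> 0"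
    and "dbar W \<tau> = W \<tau> * (of_int \<lfloor>2 * l\<rfloor> * c / (2 * cnj (jfac A \<tau>)) - of_real pi * \<i> * c\<^sup>2 * N / (cnj (jfac A \<tau>))\<^sup>2)"
proof -
  let ?j = "jfac A"
  let ?H = "\<lambda>t. \<phi> t powi \<lfloor>2 * k\<rfloor> * e2pi (c * P / (2 * ?j t))"
  \<comment> \<open>The minus sign and \<open>cnj N\<close> anticipate that conjugating
    \<open>e2pi z\<close> gives \<open>e2pi (- cnj z)\<close>.\<close>
  let ?K = "\<lambda>t. \<phi> t powi \<lfloor>2 * l\<rfloor> * e2pi (- (c * cnj N / (2 * ?j t)))"
  have j: "?j \<tau> \<noteq> 0" by (rule jfac_nonzero[OF A \<tau>])
  then have \<phi>0: "\<phi> \<tau> \<noteq> 0" using sq[OF \<tau>] by auto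
  have openU: "open upper_half" by (rule open_halfspace_Im_gt)
  obtain \<phi>' where \<phi>': "(\<phi> has_field_derivative \<phi>') (at \<tau>)"
    using holomorphic_derivI[OF \<phi> openU] \<tau> by blast
  have "2 * \<phi> \<tau> * \<phi>' = c"
  proof (rule DERIV_unique)
    show "((\<lambda>t. (\<phi> t)\<^sup>2) has_field_derivative 2 * \<phi> \<tau> * \<phi>') (at \<tau>)"
      by (auto intro!: derivative_eq_intros \<phi>')
    have "(?j has_field_derivative c) (at \<tau>)" unfolding c_def by (rule jfac_deriv)
    then show "((\<lambda>t. (\<phi> t)\<^sup>2) has_field_derivative c) (at \<tau>)"
      by (rule has_field_derivative_transform_within_open[OF _ openU]) (use \<tau> sq in auto)
  qed
  then have \<phi>'_eq: "\<phi>' = c / (2 * \<phi> \<tau>)" using \<phi>0 by (simp add: field_simps)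
  have pow: "((\<lambda>t. \<phi> t powi n) has_field_derivative \<phi> \<tau> powi n * (of_int n * c / (2 * ?j \<tau>))) (at \<tau>)" for n
  proof -
    have "((\<lambda>t. \<phi> t powi n) has_field_derivative of_int n * \<phi> \<tau> powi (n - 1) * \<phi>') (at \<tau>)"
      by (rule DERIV_power_int[OF \<phi>' disjI2[OF \<phi>0]])
    moreover have "of_int n * \<phi> \<tau> powi (n - 1) * \<phi>' = \<phi> \<tau> powi n * (of_int n * c / (2 * ?j \<tau>))"
      using \<phi>0 by (simp add: \<phi>'_eq sq[OF \<tau>, symmetric] power_int_diff power2_eq_square mult_ac)
    ultimately show ?thesis by simp
  qed
  have ex: "((\<lambda>t. e2pi (q / (2 * ?j t))) has_field_derivative
      e2pi (q / (2 * ?j \<tau>)) * (- (of_real pi * \<i> * c * q / (?j \<tau>)\<^sup>2))) (at \<tau>)" for q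
    unfolding e2pi_def using j
    by (auto intro!: derivative_eq_intros jfac_deriv simp: c_def power2_eq_square field_simps)
  obtain H' where H': "(?H has_field_derivative H') (at \<tau>)"
    using DERIV_mult'[OF pow ex[of "c * P"]] by blast
  have K': "(?K has_field_derivative ?K \<tau> * (of_int \<lfloor>2 * l\<rfloor> * c / (2 * ?j \<tau>) + of_real pi * \<i> * c\<^sup>2 * cnj N / (?j \<tau>)\<^sup>2)) (at \<tau>)"
    using DERIV_mult'[OF pow[of "\<lfloor>2 * l\<rfloor>"] ex[of "- (c * cnj N)"]]
    by (simp add: algebra_simps power2_eq_square)
  have "cnj (e2pi z) = e2pi (- cnj z)" for z by (simp add: e2pi_def exp_cnj)
  then have W: "W = (\<lambda>t. ?H t * cnj (?K t))"
    by (rule_tac ext) (simp add: W_def weight_factor_def e2pi_add c_def)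
  have dH: "?H differentiable (at \<tau>)" using H' by (auto simp: has_field_derivative_def differentiable_def)
  have dK: "(\<lambda>t. cnj (?K t)) differentiable (at \<tau>)"
    using has_derivative_cnj_field[OF K'] by (auto simp: differentiable_def)
  show "W differentiable (at \<tau>)" unfolding W by (rule differentiable_mult[OF dH dK])
  show "W \<tau> \<noteq> 0" using \<phi>0 by (simp add: W)
  have "dbar W \<tau> = ?H \<tau> * dbar (\<lambda>t. cnj (?K t)) \<tau>"
    unfolding W dbar_mult[OF dH dK] dbar_holomorphic[OF H'] by simp
  also have "dbar (\<lambda>t. cnj (?K t)) \<tau> = cnj (?K \<tau>) *
      (of_int \<lfloor>2 * l\<rfloor> * c / (2 * cnj (?j \<tau>)) - of_real pi * \<i> * c\<^sup>2 * N / (cnj (?j \<tau>))\<^sup>2)"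
    unfolding dbar_cnj[OF K'] by (simp add: c_def)
  finally show "dbar W \<tau> = W \<tau> * (of_int \<lfloor>2 * l\<rfloor> * c / (2 * cnj (?j \<tau>)) - of_real pi * \<i> * c\<^sup>2 * N / (cnj (?j \<tau>))\<^sup>2)"
    unfolding W by (simp only: mult.assoc)
qed

lemma metaplectic_finite_index_nonparabolic:
  assumes \<Gamma>: "subgroup \<Gamma> Mp2Z" and fin: "finite (rcosets\<^bsub>Mp2Z\<^esub> \<Gamma>)"
  obtains A :: "real^2^2" and \<phi> where "(A, \<phi>) \<in> \<Gamma>" "A $ 2 $ 1 \<noteq> 0"
proof -
  text \<open>Two of the infinitely many lower unipotents lie in the same coset.\<close>
  define M :: "nat \<Rightarrow> real^2^2" where "M n = vector [vector [1, 0], vector [real n, 1]]" for n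
  define g where "g n = (M n, restrict (\<lambda>\<tau>. csqrt (of_nat n * \<tau> + 1)) upper_half)" for n
  have M: "M n $ 1 $ 1 = 1" "M n $ 1 $ 2 = 0" "M n $ 2 $ 1 = real n" "M n $ 2 $ 2 = 1" for n
    by (simp_all add: M_def)
  have g: "g n \<in> carrier Mp2Z" for n
  proof -
    have SL: "M n \<in> SL2Z" by (auto simp: SL2Z_def SL2R_def det_2 M forall_2)
    have "(\<lambda>\<tau>. csqrt (of_nat n * \<tau> + 1)) holomorphic_on upper_half"
    proof (intro holomorphic_intros)
      fix \<tau> :: complex assume "\<tau> \<in> upper_half"
      then have \<tau>: "Im \<tau> > 0" by simp
      \<comment> \<open>The principal root is holomorphic off the nonpositive reals: for n > 0 the
        argument stays in the upper half plane, and for n = 0 it is 1.\<close>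
      show "of_nat n * \<tau> + 1 \<notin> \<real>\<^sub>\<le>\<^sub>0"
      proof (cases "n = 0")
        case False
        then have "Im (of_nat n * \<tau> + 1) \<noteq> 0" using \<tau> by simp
        then show ?thesis by (auto simp: complex_nonpos_Reals_iff)
      qed simp
    qed
    then have "restrict (\<lambda>\<tau>. csqrt (of_nat n * \<tau> + 1)) upper_half holomorphic_on upper_half"
      by (rule holomorphic_transform) simp
    then show ?thesis using SL
      by (auto simp: Mp2Z_def Mp2R_def g_def SL2Z_def jfac_def M)
  qed
  define f where "f n = \<Gamma> #>\<^bsub>Mp2Z\<^esub> g n" for n
  have "range f \<subseteq> rcosets\<^bsub>Mp2Z\<^esub> \<Gamma>" using g by (auto simp: RCOSETS_def f_def)
  then have "finite (range f)" using fin finite_subset by blast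
  then have "\<not> inj f" using finite_imageD infinite_UNIV_nat by blast
  then obtain n m where nm: "n \<noteq> m" "f n = f m" by (auto simp: inj_on_def)
  have "\<one>\<^bsub>Mp2Z\<^esub> \<otimes>\<^bsub>Mp2Z\<^esub> g n \<in> f n"
    using subgroup.one_closed[OF \<Gamma>] by (auto simp: f_def r_coset_def)
  then obtain h where h: "h \<in> \<Gamma>" "\<one>\<^bsub>Mp2Z\<^esub> \<otimes>\<^bsub>Mp2Z\<^esub> g n = h \<otimes>\<^bsub>Mp2Z\<^esub> g m"
    unfolding nm(2) by (auto simp: f_def r_coset_def)
  obtain A \<phi> where A: "h = (A, \<phi>)" by fastforce
  \<comment> \<open>On matrices the equality of cosets reads A = M n (M m)^(-1), a lower unipotent
    with lower left entry n - m.\<close>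
  from h(2) have mat: "M n = A ** M m" by (simp add: Mp2Z_def Mp2R_def g_def A)
  have "A $ 2 $ 2 = 1" "A $ 2 $ 1 + A $ 2 $ 2 * real m = real n"
    using arg_cong[OF mat, of "\<lambda>X :: real^2^2. X $ 2 $ 2"] arg_cong[OF mat, of "\<lambda>X :: real^2^2. X $ 2 $ 1"]
    by (simp_all add: matrix_matrix_mult_def sum_2 M)
  then have "A $ 2 $ 1 \<noteq> 0" using nm(1) by auto
  with h(1) A that show thesis by blast
qed

context lattice_with_splitting
begin

section \<open>The heat equation under the transformation law\<close>

lemma cproj_line:
  assumes "e \<in> snd v"
  shows "cproj_pos v (\<zeta> + cscale w (cx e)) = cproj_pos v \<zeta>"
    and "cproj_neg v (\<zeta> + cscale w (cx e)) = cproj_neg v \<zeta> + cscale w (cx e)"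
  using assms by (simp_all add: cproj_pos_def cproj_neg_def cscale_def cx_def prod_eq_iff
    pp.add pp.scale pp.zero pn.add pn.scale pn.zero)

lemma cform_line_square:
  "cform B (z + cscale w (cx e)) (z + cscale w (cx e)) =
     cform B z z + 2 * w * cform B (cx e) z + w\<^sup>2 * of_real (B e e)"
  using B_sym[of e "fst z"] B_sym[of e "snd z"]
  by (simp add: cform_def cscale_def cx_def B_simps complex_eq_iff power2_eq_square algebra_simps)

lemma cproj_neg_expansion:
  assumes E: "neg_orthonormal_basis B v E"
  shows "cproj_neg v \<zeta> = (\<Sum>e\<in>E. cscale (- cform B (cx e) (cproj_neg v \<zeta>)) (cx e))"
    and "cform B (cproj_neg v \<zeta>) (cproj_neg v \<zeta>) = - (\<Sum>e\<in>E. (cform B (cx e) (cproj_neg v \<zeta>))\<^sup>2)"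
proof -
  define p q where "p = pn (fst \<zeta>)" and "q = pn (snd \<zeta>)"
  have z: "cproj_neg v \<zeta> = (p, q)" by (simp add: cproj_neg_def p_def q_def prod_eq_iff)
  have pq: "p = (\<Sum>e\<in>E. (- B p e) *\<^sub>R e)" "q = (\<Sum>e\<in>E. (- B q e) *\<^sub>R e)"
    using proj_neg_expansion[OF E, of p] proj_neg_expansion[OF E, of q] by (simp_all add: p_def q_def)
  have b: "cform B (cx e) (p, q) = Complex (B p e) (B q e)" for e
    by (simp add: cform_cx B_sym[of e])
  show "cproj_neg v \<zeta> = (\<Sum>e\<in>E. cscale (- cform B (cx e) (cproj_neg v \<zeta>)) (cx e))"
    unfolding z b using pq by (simp add: cscale_def cx_def prod_eq_iff fst_sum snd_sum)
  have "B x y = - (\<Sum>e\<in>E. B x e * B y e)" if "y = (\<Sum>e\<in>E. (- B y e) *\<^sub>R e)" for x y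
  proof -
    have "B x y = B x (\<Sum>e\<in>E. (- B y e) *\<^sub>R e)" using that by (rule arg_cong)
    also have "\<dots> = - (\<Sum>e\<in>E. B x e * B y e)" by (simp add: Br.sum B_simps sum_negf mult.commute)
    finally show ?thesis .
  qed
  note this[OF pq(1), of p] this[OF pq(2), of p] this[OF pq(2), of q]
  then show "cform B (cproj_neg v \<zeta>) (cproj_neg v \<zeta>) = - (\<Sum>e\<in>E. (cform B (cx e) (cproj_neg v \<zeta>))\<^sup>2)"
    unfolding z b using B_sym[of q p]
    by (simp add: cform_def complex_eq_iff power2_eq_square sum_subtractf sum.distrib sum_distrib_left sum_negf mult.commute)
qed

lemma pseudo_holomorphic_weight:
  fixes A :: "real^2^2"
  assumes smooth: "smooth_on (upper_half \<times> UNIV) (\<lambda>(\<tau>, \<zeta>). \<Psi> \<tau> \<zeta>)"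
    and hol: "\<And>\<tau>. Im \<tau> > 0 \<Longrightarrow> cx_holomorphic (\<Psi> \<tau>)"
    and heat: "pseudo_holomorphic B v \<Psi>"
    and A: "A \<in> SL2R" and \<phi>: "\<phi> holomorphic_on upper_half"
    and sq: "\<And>t. Im t > 0 \<Longrightarrow> (\<phi> t)\<^sup>2 = jfac A t"
    and trans: "\<And>\<tau> \<zeta>. Im \<tau> > 0 \<Longrightarrow>
        \<Psi> (moeb A \<tau>) (cscale (1 / jfac A \<tau>) (cproj_pos v \<zeta>) + cscale (1 / cnj (jfac A \<tau>)) (cproj_neg v \<zeta>)) =
        weight_factor k l \<phi> \<tau> *
        e2pi (of_real (A $ 2 $ 1) * cform B (cproj_pos v \<zeta>) (cproj_pos v \<zeta>) / (2 * jfac A \<tau>)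
            + of_real (A $ 2 $ 1) * cform B (cproj_neg v \<zeta>) (cproj_neg v \<zeta>) / (2 * cnj (jfac A \<tau>))) *
        \<Psi> \<tau> \<zeta>"
    and c0: "A $ 2 $ 1 \<noteq> 0" and \<tau>: "Im \<tau> > 0" and nz: "\<Psi> \<tau> \<zeta> \<noteq> 0"
  shows "\<lfloor>2 * l\<rfloor> = int (snd (signature B))"
proof -
  define E where "E = (SOME E. neg_orthonormal_basis B v E)"
  have E: "neg_orthonormal_basis B v E"
    unfolding E_def using neg_orthonormal_basis_exists by (rule someI_ex)
  have Ein: "e \<in> snd v" if "e \<in> E" for e
    using span_base[OF that] E unfolding neg_orthonormal_basis_def by blast
  have Eneg: "B e e = -1" if "e \<in> E" for e
    using E that unfolding neg_orthonormal_basis_def by auto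
  define c where "c = (of_real (A $ 2 $ 1) :: complex)"
  define j where "j = jfac A \<tau>"
  define J where "J = cnj j"
  define y z where "y = cproj_pos v \<zeta>" and "z = cproj_neg v \<zeta>"
  define W where "W t = weight_factor k l \<phi> t *
    e2pi (c * cform B y y / (2 * jfac A t) + c * cform B z z / (2 * cnj (jfac A t)))" for t
  define Z where "Z t = cscale (1 / jfac A t) y + cscale (1 / cnj (jfac A t)) z" for t
  \<comment> \<open>Moving \<zeta> by w e changes the square of its negative part by
    \<open>2 * w * b e - w\<^sup>2\<close>, which multiplies the exponential factor by exp(\<mu> (w
    b e - w^2/2)).\<close>
  define \<mu> where "\<mu> = 2 * of_real pi * \<i> * c / J"
  define b where "b e = cform B (cx e) z" for e
  define f g where "f e w = \<Psi> (moeb A \<tau>) (Z \<tau> + cscale w (cx e))" and "g e w = \<Psi> \<tau> (\<zeta> + cscale w (cx e))" for e w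
  define u where "u = \<Psi> \<tau> \<zeta>"
  have j: "j \<noteq> 0" "J \<noteq> 0" using jfac_nonzero[OF A \<tau>] by (simp_all add: j_def J_def)
  have \<mu>: "\<mu> \<noteq> 0" using c0 j by (simp add: \<mu>_def c_def)
  have \<tau>': "Im (moeb A \<tau>) > 0" by (rule Im_moeb_pos[OF A \<tau>])
  have diff: "(\<lambda>(\<tau>, \<zeta>). \<Psi> \<tau> \<zeta>) differentiable (at (t, \<xi>))" if "Im t > 0" for t \<xi>
  proof -
    have "Ck_on (Suc 0) (upper_half \<times> UNIV) (\<lambda>(\<tau>, \<zeta>). \<Psi> \<tau> \<zeta>)"
      using smooth unfolding smooth_on_def by blast
    then have "\<forall>x\<in>upper_half \<times> UNIV. (\<lambda>(\<tau>, \<zeta>). \<Psi> \<tau> \<zeta>) differentiable (at x)"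
      unfolding Ck_on.simps by blast
    then show ?thesis by (rule bspec) (use that in simp)
  qed
  have W_eq: "W = (\<lambda>t. weight_factor k l \<phi> t *
      e2pi (c * cform B y y / (2 * jfac A t) + c * cform B z z / (2 * cnj (jfac A t))))"
    by (rule ext) (rule W_def)
  have W_facts: "W differentiable (at \<tau>)" "W \<tau> \<noteq> 0"
    "dbar W \<tau> = W \<tau> * (of_int \<lfloor>2 * l\<rfloor> * c / (2 * J) - of_real pi * \<i> * c\<^sup>2 * cform B z z / J\<^sup>2)"
    using automorphy_factor_dbar[OF A \<phi> sq \<tau>, of k l "cform B y y" "cform B z z"]
    by (simp_all only: W_eq c_def j_def J_def simp_thms)

  text \<open>The transformation law at \<open>\<zeta>\<close> is differentiated in \<open>\<tau>\<close>; since its left-hand side also moves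
    in the elliptic variable, \<open>dbar\<close> produces the derivative of \<open>\<Psi>\<close> in the direction \<open>z\<close>.\<close>
  obtain D where D: "((\<lambda>(\<tau>, \<zeta>). \<Psi> \<tau> \<zeta>) has_derivative D) (at (moeb A \<tau>, Z \<tau>))"
    using diff[OF \<tau>'] unfolding differentiable_def by blast
  interpret D: bounded_linear D using D by (rule has_derivative_bounded_linear)
  have D1: "((\<lambda>t. \<Psi> t (Z \<tau>)) has_derivative (\<lambda>h. D (h, 0))) (at (moeb A \<tau>))"
    using has_derivative_compose[OF has_derivative_Pair[OF has_derivative_ident has_derivative_const] D] by simp
  have D2: "(\<Psi> (moeb A \<tau>) has_derivative (\<lambda>h. D (0, h))) (at (Z \<tau>))"
    using has_derivative_compose[OF has_derivative_Pair[OF has_derivative_const has_derivative_ident] D] by simp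
  \<comment> \<open>\<open>D\<close> is only a real derivative in both variables jointly; its
    restriction to the elliptic variable is complex linear by uniqueness of derivatives.\<close>
  have D2_cscale: "D (0, cscale a h) = a * D (0, h)" for a h
  proof -
    obtain D' where D': "(\<Psi> (moeb A \<tau>) has_derivative D') (at (Z \<tau>))" "\<And>c h. D' (cscale c h) = c * D' h"
      using hol[OF \<tau>'] unfolding cx_holomorphic_def by blast
    have "D' = (\<lambda>h. D (0, h))" by (rule has_derivative_unique[OF D'(1) D2])
    then show ?thesis using D'(2) by auto
  qed
  have D_Pair: "D (a, h) = D (a, 0) + D (0, h)" for a h
    using D.add[of "(a, 0)" "(0, h)"] by simp
  \<comment> \<open>The coefficient of \<open>cnj h\<close>, which the heat equation at the
    transformed point controls. Its companion \<alpha> drops out of \<open>dbar\<close> because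
    \<open>moeb A\<close> is holomorphic.\<close>
  define \<beta> where "\<beta> = dbar (\<lambda>t. \<Psi> t (Z \<tau>)) (moeb A \<tau>)"
  define \<alpha> where "\<alpha> = (D (1, 0) - \<i> * D (\<i>, 0)) / 2"
  have D1_eq: "D (h, 0) = \<alpha> * h + \<beta> * cnj h" for h
  proof -
    have "linear (\<lambda>h. D (h, 0))" using has_derivative_linear[OF D1] .
    from real_linear_complex_decomp[OF this, of h] show ?thesis
      unfolding \<alpha>_def \<beta>_def dbar_eq[OF D1] .
  qed

  have inv: "((\<lambda>t. 1 / jfac A t) has_field_derivative - c / j\<^sup>2) (at \<tau>)"
    using DERIV_inverse'[OF jfac_deriv[of A \<tau>]] j
    by (simp add: j_def c_def inverse_eq_divide power2_eq_square)
  have "(Z has_derivative (\<lambda>h. cscale (- c / j\<^sup>2 * h) y + cscale (cnj (- c / j\<^sup>2 * h)) z)) (at \<tau>)"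
    unfolding Z_def
    using has_derivative_add[OF bounded_linear.has_derivative[OF bounded_linear_cscale inv[unfolded has_field_derivative_def], of y]
        bounded_linear.has_derivative[OF bounded_linear_cscale has_derivative_cnj_field[OF inv], of z]]
    by simp
  from has_derivative_compose[OF has_derivative_Pair[OF moeb_deriv[OF A \<tau>, unfolded has_field_derivative_def] this] D]
  have "((\<lambda>t. \<Psi> (moeb A t) (Z t)) has_derivative
      (\<lambda>h. D (1 / j\<^sup>2 * h, cscale (- c / j\<^sup>2 * h) y + cscale (cnj (- c / j\<^sup>2 * h)) z))) (at \<tau>)"
    by (simp add: j_def)
  then have der: "((\<lambda>t. W t * \<Psi> t \<zeta>) has_derivative
      (\<lambda>h. D (1 / j\<^sup>2 * h, cscale (- c / j\<^sup>2 * h) y + cscale (cnj (- c / j\<^sup>2 * h)) z))) (at \<tau>)"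
    by (rule has_derivative_transform_within_open[OF _ open_halfspace_Im_gt[of 0]])
      (use \<tau> trans[of _ \<zeta>] in \<open>auto simp: W_def Z_def y_def z_def c_def\<close>)
  have dbar_W\<Psi>: "dbar (\<lambda>t. W t * \<Psi> t \<zeta>) \<tau> = \<beta> * cnj (1 / j\<^sup>2) + cnj (- c / j\<^sup>2) * D (0, z)"
  proof -
    have *: "D (1 / j\<^sup>2 * h, cscale (- c / j\<^sup>2 * h) y + cscale (cnj (- c / j\<^sup>2 * h)) z) =
        (\<alpha> * (1 / j\<^sup>2) - c / j\<^sup>2 * D (0, y)) * h + (\<beta> * cnj (1 / j\<^sup>2) + cnj (- c / j\<^sup>2) * D (0, z)) * cnj h" for h
    proof -
      have "D (0, cscale (- c / j\<^sup>2 * h) y + cscale (cnj (- c / j\<^sup>2 * h)) z) =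
          (- c / j\<^sup>2 * h) * D (0, y) + cnj (- c / j\<^sup>2 * h) * D (0, z)"
        using D.add[of "(0, cscale (- c / j\<^sup>2 * h) y)" "(0, cscale (cnj (- c / j\<^sup>2 * h)) z)"]
        by (simp add: D2_cscale)
      then show ?thesis by (subst D_Pair) (simp add: D1_eq algebra_simps)
    qed
    show ?thesis unfolding dbar_eq[OF der] *
      by (simp add: field_simps)
  qed
  have "(\<lambda>t. \<Psi> t \<zeta>) differentiable (at \<tau>)"
    using diff[OF \<tau>, of \<zeta>] has_derivative_compose[OF has_derivative_Pair[OF has_derivative_ident has_derivative_const]]
    unfolding differentiable_def by fastforce
  from dbar_mult[OF W_facts(1) this]
  have I: "\<beta> / J\<^sup>2 - c / J\<^sup>2 * D (0, z) = W \<tau> * dbar (\<lambda>t. \<Psi> t \<zeta>) \<tau> +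
      W \<tau> * (of_int \<lfloor>2 * l\<rfloor> * c / (2 * J) - of_real pi * \<i> * c\<^sup>2 * cform B z z / J\<^sup>2) * u"
    unfolding W_facts(3) dbar_W\<Psi> by (simp add: J_def u_def c_def)

  text \<open>The transformation law on the line \<open>\<zeta> + w e\<close> compares the first two derivatives of \<open>f e\<close> and
    \<open>g e\<close> at \<open>0\<close>, which the heat equation relates to \<open>dbar\<close> at the two points.\<close>
  have fg: "f e (w / J) = W \<tau> * exp (\<mu> * (w * b e - w\<^sup>2 / 2)) * g e w" if e: "e \<in> E" for e w
  proof -
    have "f e (w / J) = \<Psi> (moeb A \<tau>) (cscale (1 / jfac A \<tau>) (cproj_pos v (\<zeta> + cscale w (cx e))) +
        cscale (1 / cnj (jfac A \<tau>)) (cproj_neg v (\<zeta> + cscale w (cx e))))"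
      unfolding cproj_line[OF Ein[OF e]]
      by (simp add: f_def Z_def y_def z_def cscale_add_right cscale_cscale J_def j_def add.assoc)
    also have "\<dots> = weight_factor k l \<phi> \<tau> * e2pi (c * cform B y y / (2 * j) +
        c * (cform B z z + 2 * w * b e - w\<^sup>2) / (2 * J)) * g e w"
      using trans[OF \<tau>, of "\<zeta> + cscale w (cx e)"]
      unfolding cproj_line[OF Ein[OF e]] cform_line_square Eneg[OF e]
      by (simp add: c_def y_def z_def b_def j_def J_def g_def)
    also have "e2pi (c * cform B y y / (2 * j) + c * (cform B z z + 2 * w * b e - w\<^sup>2) / (2 * J)) =
        e2pi (c * cform B y y / (2 * j) + c * cform B z z / (2 * J)) * e2pi (c * (2 * w * b e - w\<^sup>2) / (2 * J))"
      unfolding e2pi_add[symmetric] by (simp add: algebra_simps add_divide_distrib diff_divide_distrib)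
    also have "e2pi (c * (2 * w * b e - w\<^sup>2) / (2 * J)) = exp (\<mu> * (w * b e - w\<^sup>2 / 2))"
      unfolding e2pi_def \<mu>_def by (rule arg_cong[of _ _ exp]) (simp add: field_simps)
    finally show ?thesis by (simp add: W_def j_def J_def mult_ac)
  qed
  have f_hol: "f e holomorphic_on UNIV" and g_hol: "g e holomorphic_on UNIV" for e
    unfolding f_def g_def using holomorphic_on_line(1) hol \<tau> \<tau>' by blast+
  note derivs = gaussian_factor_derivs[OF j(2) f_hol g_hol fg]
  have f1: "deriv (f e) 0 = D (0, cx e)" for e
    unfolding f_def by (rule holomorphic_on_line(2)[OF hol[OF \<tau>'] D2])
  have g0: "g e 0 = u" for e by (simp add: g_def u_def)

  define n where "n = (of_nat (card E) :: complex)"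
  \<comment> \<open>The quantities in which the identity is balanced: minus the square of
    \<open>z\<close>, minus the derivative of \<Psi> at (\<tau>, \<zeta>) in the direction
    \<open>z\<close>, and minus the Laplacian there.\<close>
  define SB SG1 SG where "SB = (\<Sum>e\<in>E. (b e)\<^sup>2)" and "SG1 = (\<Sum>e\<in>E. b e * deriv (g e) 0)"
    and "SG = (\<Sum>e\<in>E. deriv (deriv (g e)) 0)"
  have Dz: "D (0, z) = - (J * W \<tau> * (\<mu> * u * SB + SG1))"
  proof -
    have "D (0, z) = (\<Sum>e\<in>E. D (0, cscale (- b e) (cx e)))"
    proof -
      have "linear (\<lambda>h. D (0, h))" using has_derivative_linear[OF D2] .
      then have "D (0, \<Sum>e\<in>E. cscale (- b e) (cx e)) = (\<Sum>e\<in>E. D (0, cscale (- b e) (cx e)))"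
        by (rule linear_sum)
      then show ?thesis using cproj_neg_expansion(1)[OF E, of \<zeta>] by (simp add: b_def z_def)
    qed
    also have "\<dots> = (\<Sum>e\<in>E. - (J * W \<tau> * (\<mu> * u * (b e)\<^sup>2 + b e * deriv (g e) 0)))"
    proof (rule sum.cong)
      fix e assume e: "e \<in> E"
      have "D (0, cx e) = J * (W \<tau> * (\<mu> * b e * u + deriv (g e) 0))"
        using derivs(1)[OF e] j by (simp add: f1 g0 field_simps)
      then show "D (0, cscale (- b e) (cx e)) = - (J * W \<tau> * (\<mu> * u * (b e)\<^sup>2 + b e * deriv (g e) 0))"
        by (simp add: D2_cscale algebra_simps power2_eq_square)
    qed simp
    finally show ?thesis
      by (simp add: SB_def SG1_def sum_negf sum.distrib sum_subtractf sum_distrib_left distrib_left)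
  qed
  have heat_eq: "4 * of_real pi * \<i> * dbar (\<lambda>t. \<Psi> t \<xi>) t =
      - (\<Sum>e\<in>E. deriv (deriv (\<lambda>w. \<Psi> t (\<xi> + cscale w (cx e)))) 0)" if "Im t > 0" for t \<xi>
  proof -
    have "4 * of_real pi * \<i> * dbar (\<lambda>t. \<Psi> t \<xi>) t
        - - (\<Sum>e\<in>E. deriv (deriv (\<lambda>w. \<Psi> t (\<xi> + cscale w (cx e)))) 0) = 0"
      using heat that unfolding pseudo_holomorphic_def holo_laplacian_neg_def E_def[symmetric] holo_pderiv_twice
      by blast
    then show ?thesis by (simp add: eq_neg_iff_add_eq_0)
  qed
  have \<beta>: "4 * of_real pi * \<i> * \<beta> = - (J\<^sup>2 * W \<tau> * ((\<mu>\<^sup>2 * SB - n * \<mu>) * u + 2 * \<mu> * SG1 + SG))"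
  proof -
    have "4 * of_real pi * \<i> * \<beta> = - (\<Sum>e\<in>E. deriv (deriv (f e)) 0)"
      unfolding \<beta>_def heat_eq[OF \<tau>'] f_def ..
    also have "(\<Sum>e\<in>E. deriv (deriv (f e)) 0) =
        (\<Sum>e\<in>E. J\<^sup>2 * W \<tau> * ((\<mu>\<^sup>2 * (b e)\<^sup>2 - \<mu>) * u + 2 * \<mu> * (b e * deriv (g e) 0) + deriv (deriv (g e)) 0))"
    proof (rule sum.cong)
      fix e assume "e \<in> E"
      from derivs(2)[OF this] j
      show "deriv (deriv (f e)) 0 = J\<^sup>2 * W \<tau> * ((\<mu>\<^sup>2 * (b e)\<^sup>2 - \<mu>) * u + 2 * \<mu> * (b e * deriv (g e) 0) + deriv (deriv (g e)) 0)"
        by (simp add: g0 field_simps)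
    qed simp
    also have "\<dots> = J\<^sup>2 * W \<tau> * ((\<mu>\<^sup>2 * SB - n * \<mu>) * u + 2 * \<mu> * SG1 + SG)"
      by (simp add: SB_def SG1_def SG_def n_def sum.distrib sum_subtractf sum_distrib_left[symmetric] sum_distrib_right[symmetric])
    finally show ?thesis .
  qed
  have ut: "4 * of_real pi * \<i> * dbar (\<lambda>t. \<Psi> t \<zeta>) \<tau> = - SG"
    unfolding heat_eq[OF \<tau>] SG_def g_def ..
  have N: "cform B z z = - SB"
    unfolding SB_def b_def z_def by (rule cproj_neg_expansion(2)[OF E])

  have L1: "4 * of_real pi * \<i> * (\<beta> / J\<^sup>2) = - (W \<tau> * ((\<mu>\<^sup>2 * SB - n * \<mu>) * u + 2 * \<mu> * SG1 + SG))"
    using \<beta> j by (simp add: field_simps)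
  have L2: "4 * of_real pi * \<i> * (c / J\<^sup>2 * D (0, z)) = - (2 * \<mu> * W \<tau> * (\<mu> * u * SB + SG1))"
    unfolding Dz \<mu>_def using j by (simp add: field_simps power2_eq_square)
  have R2: "4 * of_real pi * \<i> * (of_int \<lfloor>2 * l\<rfloor> * c / (2 * J) - of_real pi * \<i> * c\<^sup>2 * cform B z z / J\<^sup>2) =
      of_int \<lfloor>2 * l\<rfloor> * \<mu> + \<mu>\<^sup>2 * SB"
    unfolding N \<mu>_def using j by (simp add: field_simps power2_eq_square)
  have "4 * of_real pi * \<i> * (\<beta> / J\<^sup>2) - 4 * of_real pi * \<i> * (c / J\<^sup>2 * D (0, z)) =
      W \<tau> * (4 * of_real pi * \<i> * dbar (\<lambda>t. \<Psi> t \<zeta>) \<tau>) +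
      W \<tau> * (4 * of_real pi * \<i> * (of_int \<lfloor>2 * l\<rfloor> * c / (2 * J) - of_real pi * \<i> * c\<^sup>2 * cform B z z / J\<^sup>2)) * u"
    using arg_cong[OF I, of "\<lambda>x. 4 * of_real pi * \<i> * x"] by (simp only: right_diff_distrib distrib_left mult_ac)
  \<comment> \<open>Balance, with \<open>W \<tau>\<close> divided out: the left side has -\<mu>^2 +
    2 \<mu>^2 in front of \<open>SB * u\<close>, matching the \<mu>^2 on the right; the two
    multiples of \<open>SG1\<close> on the left cancel; and \<open>- SG\<close> stands on both
    sides. What remains is \<open>n * \<mu> * u\<close> against
    \<open>\<lfloor>2 * l\<rfloor> * \<mu> * u\<close>.\<close>
  then have "W \<tau> * (\<mu> * u * (n - of_int \<lfloor>2 * l\<rfloor>)) = 0"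
    unfolding L1 L2 R2 ut by (simp add: algebra_simps power2_eq_square)
  then have "n = of_int \<lfloor>2 * l\<rfloor>" using W_facts(2) \<mu> nz by (simp add: u_def)
  then have "of_int (int (card E)) = (of_int \<lfloor>2 * l\<rfloor> :: complex)" by (simp add: n_def)
  then have "int (card E) = \<lfloor>2 * l\<rfloor>" by (simp only: of_int_eq_iff)
  then show ?thesis using card_neg_orthonormal_basis[OF E] by simp
qed

lemma jacobi_form_weight:
  assumes \<Gamma>: "subgroup \<Gamma> Mp2Z" "finite (rcosets\<^bsub>Mp2Z\<^esub> \<Gamma>)" and l: "2 * l \<in> \<int>"
    and \<Psi>: "jacobi_form L B v \<Gamma> k l \<Psi>" "pseudo_holomorphic B v \<Psi>"
    and nz: "\<tau> \<in> upper_half" "\<Psi> \<tau> \<zeta> \<noteq> 0"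
  shows "l = real (snd (signature B)) / 2"
proof -
  obtain A :: "real^2^2" and \<phi> where A: "(A, \<phi>) \<in> \<Gamma>" "A $ 2 $ 1 \<noteq> 0"
    using metaplectic_finite_index_nonparabolic[OF \<Gamma>] .
  then have "(A, \<phi>) \<in> carrier Mp2Z" using subgroup.subset[OF \<Gamma>(1)] by blast
  then have A': "A \<in> SL2R" "\<phi> holomorphic_on upper_half" "\<And>t. Im t > 0 \<Longrightarrow> (\<phi> t)\<^sup>2 = jfac A t"
    by (auto simp: Mp2Z_def Mp2R_def)
  have "\<lfloor>2 * l\<rfloor> = int (snd (signature B))"
  proof (rule pseudo_holomorphic_weight[OF _ _ \<Psi>(2) A' _ A(2) _ nz(2)])
    show "smooth_on (upper_half \<times> UNIV) (\<lambda>(\<tau>, \<zeta>). \<Psi> \<tau> \<zeta>)"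
      using \<Psi>(1) unfolding jacobi_form_def by blast
    show "cx_holomorphic (\<Psi> \<tau>)" if "Im \<tau> > 0" for \<tau>
      using \<Psi>(1) that unfolding jacobi_form_def by blast
    have "\<forall>\<tau>\<in>upper_half. \<forall>\<zeta>.
        \<Psi> (moeb A \<tau>) (cscale (1 / jfac A \<tau>) (cproj_pos v \<zeta>) + cscale (1 / cnj (jfac A \<tau>)) (cproj_neg v \<zeta>)) =
        weight_factor k l \<phi> \<tau> *
        e2pi (of_real (A $ 2 $ 1) * cform B (cproj_pos v \<zeta>) (cproj_pos v \<zeta>) / (2 * jfac A \<tau>)
            + of_real (A $ 2 $ 1) * cform B (cproj_neg v \<zeta>) (cproj_neg v \<zeta>) / (2 * cnj (jfac A \<tau>))) *
        \<Psi> \<tau> \<zeta>"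
      using \<Psi>(1) A(1) unfolding jacobi_form_def by blast
    then show "\<Psi> (moeb A \<tau>) (cscale (1 / jfac A \<tau>) (cproj_pos v \<zeta>) + cscale (1 / cnj (jfac A \<tau>)) (cproj_neg v \<zeta>)) =
        weight_factor k l \<phi> \<tau> *
        e2pi (of_real (A $ 2 $ 1) * cform B (cproj_pos v \<zeta>) (cproj_pos v \<zeta>) / (2 * jfac A \<tau>)
            + of_real (A $ 2 $ 1) * cform B (cproj_neg v \<zeta>) (cproj_neg v \<zeta>) / (2 * cnj (jfac A \<tau>))) *
        \<Psi> \<tau> \<zeta>" if "Im \<tau> > 0" for \<tau> \<zeta>
      using that by blast
    show "Im \<tau> > 0" using nz(1) by simp
  qed
  \<comment> \<open>Half-integrality of l makes the floor exact.\<close>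
  then have "2 * l = real (snd (signature B))" using of_int_floor[OF l] by simp
  then show ?thesis by simp
qed

end

theorem proposition2p7:
  fixes L :: "'v::real_inner set" and B :: "'v \<Rightarrow> 'v \<Rightarrow> real" and bp bm :: nat
    and v :: "'v set \<times> 'v set" and \<Gamma> :: "mp_elt set" and k l :: real
  assumes "even_lattice L B" and "signature B = (bp, bm)" and "v \<in> Grass B"
    and "subgroup \<Gamma> Mp2Z" and "finite (rcosets\<^bsub>Mp2Z\<^esub> \<Gamma>)"
    and "2 * k \<in> \<int>" and "2 * l \<in> \<int>"
  shows "(\<forall>F. modular_form L B \<Gamma> (k - real bp / 2) (l - real bm / 2) F \<longrightarrow>
              (weakly_holomorphic L B F \<longleftrightarrow> pseudo_holomorphic B v (jacobi_of L B v F))) \<and>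
         (\<forall>\<Psi>. jacobi_form L B v \<Gamma> k l \<Psi> \<and> pseudo_holomorphic B v \<Psi> \<and>
              (\<exists>\<tau>\<in>upper_half. \<exists>\<zeta>. \<Psi> \<tau> \<zeta> \<noteq> 0) \<longrightarrow> l = real bm / 2)"
proof -
  interpret lattice_with_splitting L B v by unfold_locales (fact assms(1), fact assms(3))
  have "weakly_holomorphic L B F \<longleftrightarrow> pseudo_holomorphic B v (jacobi_of L B v F)"
    if "modular_form L B \<Gamma> (k - real bp / 2) (l - real bm / 2) F" for F
    by (rule weakly_holomorphic_iff_pseudo_holomorphic) (use that in \<open>simp add: modular_form_def\<close>)
  moreover have "l = real bm / 2"
    if "jacobi_form L B v \<Gamma> k l \<Psi>" "pseudo_holomorphic B v \<Psi>" "\<tau> \<in> upper_half" "\<Psi> \<tau> \<zeta> \<noteq> 0" for \<Psi> \<tau> \<zeta>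
    using jacobi_form_weight[OF assms(4,5,7) that] assms(2) by simp
  ultimately show ?thesis by blast
qed

end
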